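(* Let $A\in\mathbb{R}^{n\times n}$ be a non-singular matrix diagonalizable over $\mathbb{C}$ whose spectrum satisfies: (P1) every eigenvalue of $A$ is an algebraic integer; (P2) every complex $\mu$ with $|\mu|>1$ algebraically conjugate to an eigenvalue of $A$ is an eigenvalue of $A$, and $m_A(\mu)\geq m_A(\nu)$ for all algebraic conjugates $\nu$ of $\mu$, with strict inequality for at least one such $\nu$. Let $\mu_{A,\mathbb{Q}}=f_1\cdots f_k$ be the factorization of the minimal polynomial of $A$ over $\mathbb{Q}$ into distinct monic polynomials $f_i\in\mathbb{Z}[X]$ irreducible over $\mathbb{Q}$, let $d_i=\deg f_i$ and $M_i:=\max\{m_A(\lambda):\lambda\text{ a root of }f_i\}$. Define $s_i=M_id_i$ if $f_i$ is not a cyclotomic polynomial; if $f_i$ is a cyclotomic polynomial, define $s_i=M_id_i$ if $M_i>\min\{m_A(\lambda):\lambda\text{ a root of }f_i\}$ and $s_i=(M_i+1)d_i$ otherwise. Then $s=s_1+\cdots+s_k$ is the minimal dimension of a lattice $\mathcal{L}\subset\mathbb{R}^s$ for which there exist a generic cut-and-project scheme $\Lambda=(\mathcal{L}\subset\mathbb{R}^s,\mathbb{R}^n)$ and a cut-and-project set $\Sigma(\Omega)$ with $A\Sigma(\Omega)\subset\Sigma(\Omega)$.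
   Context: $m_T(\lambda)$ denotes the algebraic multiplicity of $\lambda$ as an eigenvalue of $T$ ($0$ if not an eigenvalue). The minimal polynomial $\mu_{A,\mathbb{Q}}$ of $A$ over $\mathbb{Q}$ is the monic polynomial in $\mathbb{Q}[X]$ of smallest degree annihilating $A$. A lattice $\mathcal{L}\subset\mathbb{R}^s$ is $\{L\mathbf{r}:\mathbf{r}\in\mathbb{Z}^s\}$ for a non-singular $L\in\mathbb{R}^{s\times s}$. For $1\le n<s$, the cut-and-project scheme $\Lambda=(\mathcal{L}\subset\mathbb{R}^s,\mathbb{R}^n)$ consists of $\mathcal{L}$ with projections $\pi_\parallel(\mathbf{x})=(x_1,\dots,x_n)^\top$, $\pi_\perp(\mathbf{x})=(x_{n+1},\dots,x_s)^\top$; it is generic if $\pi_\parallel|_{\mathcal{L}}$ and $\pi_\perp|_{\mathcal{L}}$ are injective and $\pi_\perp(\mathcal{L})$ is dense in $\mathbb{R}^{s-n}$. For a bounded $\Omega\subset\mathbb{R}^{s-n}$ with $\overline{\Omega^\circ}=\overline{\Omega}\neq\emptyset$, the cut-and-project set is $\Sigma(\Omega)=\{\pi_\parallel(\mathbf{l}):\mathbf{l}\in\mathcal{L},\ \pi_\perp(\mathbf{l})\in\Omega\}$. *)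

theory Defs
  imports "HOL-Analysis.Analysis" "HOL-Computational_Algebra.Polynomial_Factorial" "HOL-Computational_Algebra.Field_as_Ring"
begin

section \<open>Spectral notions for a real square matrix A, viewed over the complex numbers\<close>

definition cmat :: "real^'n^'n \<Rightarrow> complex^'n^'n" where
  "cmat A = (\<chi> i j. complex_of_real (A $ i $ j))"

text \<open>Characteristic polynomial det(X I - A) over the complex numbers.\<close>
definition char_poly_c :: "real^'n^'n \<Rightarrow> complex poly" where
  "char_poly_c A = det (\<chi> i j. (if i = j then [:0, 1:] else 0) - [: complex_of_real (A $ i $ j) :])"

definition is_eigenvalue :: "real^'n^'n \<Rightarrow> complex \<Rightarrow> bool" where
  "is_eigenvalue A lam \<longleftrightarrow> poly (char_poly_c A) lam = 0"

text \<open>Algebraic multiplicity m_A(lambda); it is 0 if lambda is not an eigenvalue.\<close>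
definition alg_mult :: "real^'n^'n \<Rightarrow> complex \<Rightarrow> nat" where
  "alg_mult A lam = order lam (char_poly_c A)"

definition diagonalizable_C :: "real^'n^'n \<Rightarrow> bool" where
  "diagonalizable_C A \<longleftrightarrow> (\<exists>P Q :: complex^'n^'n. \<exists>d :: 'n \<Rightarrow> complex.
      P ** Q = mat 1 \<and> Q ** P = mat 1 \<and> Q ** cmat A ** P = (\<chi> i j. if i = j then d i else 0))"

section \<open>Algebraic integers and conjugates\<close>

definition algebraic_integer :: "complex \<Rightarrow> bool" where
  "algebraic_integer x \<longleftrightarrow> (\<exists>p :: int poly. lead_coeff p = 1 \<and> poly (map_poly of_int p) x = 0)"

text \<open>mu and nu are algebraically conjugate: both are roots of one irreducible polynomial over Q.\<close>
definition alg_conjugate :: "complex \<Rightarrow> complex \<Rightarrow> bool" where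
  "alg_conjugate \<mu> \<nu> \<longleftrightarrow> (\<exists>p :: rat poly. irreducible p \<and>
      poly (map_poly of_rat p) \<mu> = 0 \<and> poly (map_poly of_rat p) \<nu> = 0)"

section \<open>Minimal polynomial over Q\<close>

definition mat_pow :: "real^'n^'n \<Rightarrow> nat \<Rightarrow> real^'n^'n" where
  "mat_pow M k = (((**) M) ^^ k) (mat 1)"

definition poly_mat_rat :: "rat poly \<Rightarrow> real^'n^'n \<Rightarrow> real^'n^'n" where
  "poly_mat_rat p M = (\<Sum>i\<le>degree p. real_of_rat (coeff p i) *\<^sub>R mat_pow M i)"

definition min_poly_Q :: "real^'n^'n \<Rightarrow> rat poly" where
  "min_poly_Q A = (THE p. lead_coeff p = 1 \<and> poly_mat_rat p A = 0 \<and>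
      (\<forall>q. lead_coeff q = 1 \<and> poly_mat_rat q A = 0 \<longrightarrow> degree p \<le> degree q))"

section \<open>Cyclotomic polynomials and the dimension s\<close>

definition is_cyclotomic :: "rat poly \<Rightarrow> bool" where
  "is_cyclotomic f \<longleftrightarrow> (\<exists>k::nat. k > 0 \<and> map_poly of_rat f =
      (\<Prod>j\<in>{j. j < k \<and> coprime j k}. [: - cis (2 * pi * real j / real k), 1 :]))"

definition roots_Q :: "rat poly \<Rightarrow> complex set" where
  "roots_Q f = {lam. poly (map_poly of_rat f) lam = 0}"

definition M_max :: "real^'n^'n \<Rightarrow> rat poly \<Rightarrow> nat" where
  "M_max A f = Max (alg_mult A ` roots_Q f)"

definition M_min :: "real^'n^'n \<Rightarrow> rat poly \<Rightarrow> nat" where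
  "M_min A f = Min (alg_mult A ` roots_Q f)"

definition s_factor :: "real^'n^'n \<Rightarrow> rat poly \<Rightarrow> nat" where
  "s_factor A f = (if is_cyclotomic f \<and> \<not> M_max A f > M_min A f
                   then (M_max A f + 1) * degree f else M_max A f * degree f)"

text \<open>The distinct monic irreducible factors f_1,...,f_k of the minimal polynomial
  are its (normalized) prime factors.\<close>
definition s_dim :: "real^'n^'n \<Rightarrow> nat" where
  "s_dim A = (\<Sum>f\<in>prime_factors (min_poly_Q A). s_factor A f)"

section \<open>Cut-and-project schemes\<close>

text \<open>R^s is modelled as real^('n + 'p), with s = n + CARD('p); the first n coordinates
  are the Inl-coordinates, the last s - n coordinates the Inr-coordinates.\<close>

definition lattice_of :: "real^('n::finite+'p::finite)^('n+'p) \<Rightarrow> (real^('n+'p)) set" where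
  "lattice_of L = {L *v r | r. \<forall>i. r $ i \<in> \<int>}"

definition pi_par :: "real^('n::finite+'p::finite) \<Rightarrow> real^'n" where
  "pi_par x = (\<chi> i. x $ Inl i)"

definition pi_perp :: "real^('n::finite+'p::finite) \<Rightarrow> real^'p" where
  "pi_perp x = (\<chi> j. x $ Inr j)"

definition generic_cps :: "real^('n::finite+'p::finite)^('n+'p) \<Rightarrow> bool" where
  "generic_cps L \<longleftrightarrow> invertible L \<and>
     inj_on (pi_par :: real^('n+'p) \<Rightarrow> real^'n) (lattice_of L) \<and>
     inj_on (pi_perp :: real^('n+'p) \<Rightarrow> real^'p) (lattice_of L) \<and>
     closure (pi_perp ` lattice_of L) = UNIV"

definition window :: "(real^'p) set \<Rightarrow> bool" where
  "window \<Omega> \<longleftrightarrow> bounded \<Omega> \<and> closure (interior \<Omega>) = closure \<Omega> \<and> closure \<Omega> \<noteq> {}"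

definition cps_set :: "real^('n::finite+'p::finite)^('n+'p) \<Rightarrow> (real^'p) set \<Rightarrow> (real^'n) set" where
  "cps_set L \<Omega> = {pi_par l | l. l \<in> lattice_of L \<and> pi_perp l \<in> \<Omega>}"

text \<open>There is a generic cut-and-project scheme (L in R^(n + CARD('p)), R^n) and a
  cut-and-project set Sigma(Omega) with A Sigma(Omega) contained in Sigma(Omega).\<close>
definition invariant_cps_exists :: "real^'n^'n \<Rightarrow> 'p::finite itself \<Rightarrow> bool" where
  "invariant_cps_exists A _ \<longleftrightarrow> (\<exists>(L :: real^('n+'p)^('n+'p)) (\<Omega> :: (real^'p) set).
      generic_cps L \<and> window \<Omega> \<and> (\<lambda>x. A *v x) ` cps_set L \<Omega> \<subseteq> cps_set L \<Omega>)"

end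

theory Submission
  imports Defs "HOL-Computational_Algebra.Fundamental_Theorem_Algebra"
begin

text \<open>
  Lower bound: lattice points projecting into the window generate the lattice, so \<open>A\<close> lifts to an
  integer matrix \<open>N\<close>; boundedness of the window forces \<open>N\<close> to be conjugate to a block diagonal
  matrix with blocks \<open>A\<close> and \<open>B\<close>. The characteristic polynomial of \<open>N\<close> is rational, so conjugate
  numbers have equal multiplicity, which is at least \<open>M\<^sub>i\<close> on the roots of \<open>f\<^sub>i\<close>. If it were
  equal to \<open>m\<^sub>A\<close> at every root of \<open>f\<^sub>i\<close>, then \<open>f\<^sub>i(B)\<close> would be injective, while \<open>f\<^sub>i(N)\<close> kills a
  nonzero lattice vector, contradicting the injectivity of the projection along \<open>\<real>\<^sup>n\<close>.

  Construction: let \<open>N\<close> be the sum of \<open>s\<^sub>i / d\<^sub>i\<close> companion matrices of each \<open>f\<^sub>i\<close>. In its eigenspace for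
  \<open>z\<close>, rotate \<open>\<real>\<^sup>e\<close> (\<open>e = s\<^sub>i / d\<^sub>i\<close>) by the Householder reflection along \<open>(1, t, t\<^sup>2, \<dots>)\<close> with \<open>t\<close>
  transcendental over the eigenvalues, and give the first \<open>m\<^sub>A(z)\<close> coordinates to \<open>A\<close> and the others
  to the window space. Genericity of \<open>t\<close> yields injectivity of both projections and, through the
  dual criterion for density of subgroups, density. By (P2) all eigenvalues with modulus greater
  than \<open>1\<close> are used up by \<open>A\<close>, so the other block is a contraction and the unit ball is a window.

  That some root of \<open>f\<^sub>i\<close> has \<open>m\<^sub>A(z) < e\<close> rests on (P2) if some root has modulus greater than \<open>1\<close>;
  otherwise Kronecker's theorem and the irreducibility of the cyclotomic polynomials show that
  \<open>f\<^sub>i\<close> is cyclotomic.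
\<close>

section \<open>Rational and integer polynomials evaluated at complex numbers\<close>

text \<open>The obstacle is that each projection sees only some eigencoordinates of an integer
  vector and yet must be injective on integer vectors. The entries of one row of the rotation
  satisfy no nontrivial linear relation over \<open>\<int>[z]\<close>, so one vanishing
  eigencoordinate at one root \<open>z\<close> kills all \<open>e\<close> polynomials at
  \<open>z\<close> and, by irreducibility, at every conjugate of \<open>z\<close>. Hence a factor
  \<open>f\<close> needs just one coordinate on each side: an eigenvalue of \<open>A\<close>
  provides it in \<open>\<real>\<^sup>n\<close>, and \<open>m\<^sub>A(z) < e\<close> provides it in
  the window space. This explains the exceptional case of \<open>s\<^sub>i\<close>: if all
  multiplicities equal \<open>M\<^sub>i\<close>, then \<open>M\<^sub>i\<close> copies of
  \<open>\<int>[X]/(f)\<close> would be absorbed by \<open>\<real>\<^sup>n\<close> entirely, and one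
  more copy leaves room. Density is the same argument on the dual side: an integral functional is
  described by numbers \<open>y(z)\<close> with \<open>f'(z) y(z)\<close> in
  \<open>\<int>[z]\<close>. A Householder reflection serves as rotation because it is its own
  inverse and its entries are, up to one common denominator, polynomials in \<open>t\<close>. The
  coordinates \<open>Re + Im\<close> treat real and nonreal eigenvalues alike, with no choice of a
  representative in conjugate pairs.\<close>

lemma map_poly_hom_add:
  assumes "h 0 = 0" "\<And>x y. h (x + y) = h x + h y"
  shows "map_poly h (p + q) = map_poly h p + map_poly h q"
  by (intro poly_eqI) (simp add: coeff_map_poly assms)

lemma map_poly_hom_mult:
  fixes h :: "'a::comm_ring_1 \<Rightarrow> 'b::comm_ring_1"
  assumes "h 0 = 0" "\<And>x y. h (x + y) = h x + h y" "\<And>x y. h (x * y) = h x * h y"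
  shows "map_poly h (p * q) = map_poly h p * map_poly h q"
proof (intro poly_eqI)
  have *: "h (sum g A) = (\<Sum>x\<in>A. h (g x))" for g :: "nat \<Rightarrow> 'a" and A
    by (induction A rule: infinite_finite_induct) (auto simp: assms)
  show "coeff (map_poly h (p * q)) n = coeff (map_poly h p * map_poly h q) n" for n
    by (simp add: coeff_map_poly assms coeff_mult *)
qed

abbreviation rpoly :: "rat poly \<Rightarrow> complex poly" where
  "rpoly \<equiv> map_poly of_rat"

abbreviation zpoly :: "int poly \<Rightarrow> complex poly" where
  "zpoly \<equiv> map_poly of_int"

abbreviation zrpoly :: "int poly \<Rightarrow> rat poly" where
  "zrpoly \<equiv> map_poly of_int"

lemma rpoly_simps [simp]:
  "rpoly (p + q) = rpoly p + rpoly q"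
  "rpoly (p * q) = rpoly p * rpoly q"
  "rpoly (smult c p) = smult (of_rat c) (rpoly p)"
  "rpoly (pCons c p) = pCons (of_rat c) (rpoly p)"
  "rpoly (- p) = - rpoly p"
  "rpoly (p - q) = rpoly p - rpoly q"
  "degree (rpoly p) = degree p"
  "coeff (rpoly p) i = of_rat (coeff p i)"
  "rpoly p = 0 \<longleftrightarrow> p = 0"
  "rpoly 1 = 1"
  by (auto intro!: poly_eqI simp: map_poly_hom_mult map_poly_hom_add of_rat_add of_rat_mult
      map_poly_smult map_poly_pCons coeff_map_poly of_rat_minus of_rat_diff degree_map_poly
      map_poly_eq_0_iff)

lemma rpoly_prod_power [simp]:
  "rpoly (prod g A) = (\<Prod>x\<in>A. rpoly (g x))"
  "rpoly (p ^ n) = rpoly p ^ n"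
  by (induction A rule: infinite_finite_induct; simp) (induction n; simp)

lemma zpoly_simps [simp]:
  "zpoly (p + q) = zpoly p + zpoly q"
  "zpoly (p * q) = zpoly p * zpoly q"
  "zpoly (smult c p) = smult (of_int c) (zpoly p)"
  "zpoly (pCons c p) = pCons (of_int c) (zpoly p)"
  "zpoly (- p) = - zpoly p"
  "zpoly (p - q) = zpoly p - zpoly q"
  "degree (zpoly p) = degree p"
  "coeff (zpoly p) i = of_int (coeff p i)"
  "zpoly p = 0 \<longleftrightarrow> p = 0"
  "zpoly 1 = 1"
  by (auto intro!: poly_eqI simp: map_poly_hom_mult map_poly_hom_add
      map_poly_smult map_poly_pCons coeff_map_poly degree_map_poly
      map_poly_eq_0_iff)

lemma zrpoly_simps [simp]:
  "zrpoly (p + q) = zrpoly p + zrpoly q"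
  "zrpoly (p * q) = zrpoly p * zrpoly q"
  "zrpoly (smult c p) = smult (of_int c) (zrpoly p)"
  "zrpoly (pCons c p) = pCons (of_int c) (zrpoly p)"
  "zrpoly (- p) = - zrpoly p"
  "zrpoly (p - q) = zrpoly p - zrpoly q"
  "degree (zrpoly p) = degree p"
  "coeff (zrpoly p) i = of_int (coeff p i)"
  "zrpoly p = 0 \<longleftrightarrow> p = 0"
  "zrpoly 1 = 1"
  "zrpoly p = zrpoly q \<longleftrightarrow> p = q"
  "rpoly (zrpoly p) = zpoly p"
  by (auto intro!: poly_eqI simp: map_poly_hom_mult map_poly_hom_add
      map_poly_smult map_poly_pCons coeff_map_poly degree_map_poly
      map_poly_eq_0_iff poly_eq_iff)

text \<open>If \<open>f\<close> does not divide \<open>g\<close>, primality gives a Bezout identity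
  \<open>a * f + b * g = 1\<close>, which is absurd at \<open>z\<close>. This is how rational
  relations pass from one conjugate to another.\<close>

lemma irreducible_rat_root_dvd_iff:
  fixes f g :: "rat poly"
  assumes "irreducible f" "poly (rpoly f) z = 0"
  shows "poly (rpoly g) z = 0 \<longleftrightarrow> f dvd g"
proof
  assume "f dvd g"
  then show "poly (rpoly g) z = 0" using assms(2) by (auto elim!: dvdE)
next
  assume g: "poly (rpoly g) z = 0"
  show "f dvd g"
  proof (rule ccontr)
    assume "\<not> f dvd g"
    moreover have "prime_elem f"
      using assms(1) by (simp add: field_poly_irreducible_imp_prime)
    ultimately have "coprime f g"
      by (simp add: prime_elem_imp_coprime)
    then obtain a b where "a * f + b * g = 1"
      by (metis bezout_coefficients_fst_snd coprime_iff_gcd_eq_1)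
    then have "poly (rpoly (a * f + b * g)) z = poly (rpoly 1) z" by simp
    then show False using assms(2) g by simp
  qed
qed

lemma irreducible_rat_conj_root:
  fixes f g :: "rat poly"
  assumes "irreducible f" "poly (rpoly f) z = 0" "poly (rpoly f) w = 0" "poly (rpoly g) z = 0"
  shows "poly (rpoly g) w = 0"
  using irreducible_rat_root_dvd_iff assms by blast

lemma irreducible_rat_degree_pos:
  fixes f :: "rat poly"
  assumes "irreducible f"
  shows "degree f > 0"
proof (rule ccontr)
  assume "\<not> degree f > 0"
  then obtain c where "f = [:c:]" by (auto elim: degree_eq_zeroE)
  then show False using assms by (auto simp: irreducible_def is_unit_pCons_iff)
qed

text \<open>In characteristic 0 the derivative of \<open>f\<close> is nonzero of smaller degree, so
  \<open>f\<close> cannot divide it; a common root would force that.\<close>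

lemma irreducible_rat_rsquarefree:
  fixes f :: "rat poly"
  assumes "irreducible f"
  shows "rsquarefree (rpoly f)"
proof -
  have d: "degree f > 0" using irreducible_rat_degree_pos assms .
  have pd: "pderiv (rpoly f) = rpoly (pderiv f)"
    by (intro poly_eqI) (simp add: coeff_pderiv of_rat_mult of_rat_add)
  have "\<not> (poly (rpoly f) a = 0 \<and> poly (pderiv (rpoly f)) a = 0)" for a
  proof
    assume *: "poly (rpoly f) a = 0 \<and> poly (pderiv (rpoly f)) a = 0"
    then have "f dvd pderiv f"
      using irreducible_rat_root_dvd_iff[OF assms] pd by auto
    then have "degree f \<le> degree (pderiv f)"
      using d by (intro dvd_imp_degree_le) (auto simp: pderiv_eq_0_iff)
    then show False using d by (simp add: degree_pderiv)
  qed
  then show ?thesis by (simp add: rsquarefree_roots)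
qed

lemma roots_Q_finite: "f \<noteq> 0 \<Longrightarrow> finite (roots_Q f)"
  unfolding roots_Q_def by (rule poly_roots_finite) simp

lemma rpoly_irreducible_prod:
  assumes "irreducible f" "lead_coeff f = 1"
  shows "rpoly f = (\<Prod>z\<in>roots_Q f. [:- z, 1:])"
  using complex_poly_decompose_rsquarefree[OF irreducible_rat_rsquarefree[OF assms(1)]] assms(2)
  by (simp add: roots_Q_def)

lemma card_roots_Q:
  assumes "irreducible f"
  shows "card (roots_Q f) = degree f"
proof -
  have fin: "finite (roots_Q f)" using assms by (intro roots_Q_finite) auto
  have nz: "rpoly f \<noteq> 0" using assms by auto
  have "degree f = degree (smult (lead_coeff (rpoly f)) (\<Prod>z\<in>roots_Q f. [:- z, 1:]))"
    using complex_poly_decompose_rsquarefree[OF irreducible_rat_rsquarefree[OF assms]]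
    by (simp add: roots_Q_def)
  also have "\<dots> = degree (\<Prod>z\<in>roots_Q f. [:- z, 1:])" using nz by simp
  also have "\<dots> = card (roots_Q f)" by (subst degree_prod_sum_eq) auto
  finally show ?thesis by simp
qed

text \<open>Divide out \<open>f\<close> as long as possible: by separability each division lowers
  both orders by exactly 1, and a polynomial not divisible by \<open>f\<close> vanishes at neither
  point.\<close>

lemma order_rpoly_conj:
  fixes f g :: "rat poly"
  assumes "irreducible f" "z \<in> roots_Q f" "w \<in> roots_Q f" "g \<noteq> 0"
  shows "order z (rpoly g) = order w (rpoly g)"
  using assms(4)
proof (induction "degree g" arbitrary: g rule: less_induct)
  case less
  have f: "f \<noteq> 0" "degree f > 0" using assms(1) irreducible_rat_degree_pos by auto
  show ?case
  proof (cases "f dvd g")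
    case False
    then have "poly (rpoly g) z \<noteq> 0" "poly (rpoly g) w \<noteq> 0"
      using irreducible_rat_root_dvd_iff assms(1-3) unfolding roots_Q_def by blast+
    then show ?thesis by (simp add: order_0I)
  next
    case True
    then obtain h where h: "g = f * h" ..
    then have h0: "h \<noteq> 0" using less.prems by auto
    then have "degree h < degree g" using h f by (simp add: degree_mult_eq)
    then have IH: "order z (rpoly h) = order w (rpoly h)" using less.hyps h0 by blast
    have "order z (rpoly f) = 1" "order w (rpoly f) = 1"
      using rsquarefree_root_order[OF irreducible_rat_rsquarefree[OF assms(1)]] assms f
      by (auto simp: roots_Q_def)
    then show ?thesis using IH f h0 by (simp add: h order_mult)
  qed
qed

lemma irreducible_monic_roots_disjoint:
  assumes "irreducible f" "irreducible g" "lead_coeff f = 1" "lead_coeff g = 1"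
    "z \<in> roots_Q f" "z \<in> roots_Q g"
  shows "f = g"
proof -
  have "f dvd g" "g dvd f"
    using irreducible_rat_root_dvd_iff assms unfolding roots_Q_def by blast+
  then obtain c where c: "g = f * c" by blast
  have "degree f = degree g"
    using \<open>f dvd g\<close> \<open>g dvd f\<close> assms by (intro antisym dvd_imp_degree_le) auto
  moreover have "f \<noteq> 0" "c \<noteq> 0" using c assms by auto
  ultimately have "degree c = 0" using c by (simp add: degree_mult_eq)
  then obtain k where "c = [:k:]" by (auto elim: degree_eq_zeroE)
  then have "g = smult k f" using c by simp
  moreover have "k = 1" using assms(3,4) by (cases "k = 0") (simp_all add: \<open>g = smult k f\<close>)
  ultimately show ?thesis by simp
qed

section \<open>Gauss's lemma and the integrality of monic rational factors\<close>

lemma rat_poly_primitive_multiple: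
  fixes f :: "rat poly"
  assumes "f \<noteq> 0"
  obtains c F where "c \<noteq> 0" "smult c f = zrpoly F" "content F = 1"
proof -
  have frac: "\<exists>a b. x = of_int a / of_int b \<and> b \<noteq> 0" for x :: rat
  proof -
    obtain a b where "quotient_of x = (a, b)" by fastforce
    then show ?thesis using quotient_of_div quotient_of_denom_pos by fastforce
  qed
  have den: "\<exists>d::int. d \<noteq> 0 \<and> (\<forall>i\<le>n. of_int d * coeff f i \<in> \<int>)" for n
  proof (induction n)
    case 0
    obtain a b where ab: "coeff f 0 = of_int a / of_int b" "b \<noteq> 0"
      using frac by blast
    then show ?case by (intro exI[of _ b]) auto
  next
    case (Suc n)
    then obtain d where d: "d \<noteq> 0" "\<forall>i\<le>n. of_int d * coeff f i \<in> \<int>" by blast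
    obtain a b where ab: "coeff f (Suc n) = of_int a / of_int b" "b \<noteq> 0"
      using frac by blast
    have "of_int (b * d) * coeff f i \<in> \<int>" if "i \<le> Suc n" for i
    proof (cases "i = Suc n")
      case True
      then show ?thesis using ab by simp
    next
      case False
      then have "of_int d * coeff f i \<in> \<int>" using d that by auto
      then have "of_int b * (of_int d * coeff f i) \<in> \<int>" by (rule Ints_mult[OF Ints_of_int])
      then show ?thesis by (simp only: of_int_mult mult.assoc)
    qed
    then have "\<forall>i\<le>Suc n. of_int (b * d) * coeff f i \<in> \<int>" by blast
    moreover have "b * d \<noteq> 0" using d ab by simp
    ultimately show ?case by blast
  qed
  obtain d :: int where d: "d \<noteq> 0" "\<forall>i\<le>degree f. of_int d * coeff f i \<in> \<int>"
    using den by blast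
  have "coeff (smult (of_int d) f) i \<in> \<int>" for i
    using d by (cases "i \<le> degree f") (auto simp: coeff_eq_0)
  then obtain G where G: "smult (of_int d) f = zrpoly G"
    using intpolyE[of "smult (of_int d) f"] by blast
  then have G0: "G \<noteq> 0" using d assms by auto
  define c where "c = of_int d / rat_of_int (content G)"
  have "smult c f = smult (inverse (of_int (content G))) (smult (of_int d) f)"
    by (simp add: c_def field_simps)
  also have "\<dots> = smult (inverse (of_int (content G))) (zrpoly (smult (content G) (primitive_part G)))"
    by (simp add: G)
  also have "\<dots> = zrpoly (primitive_part G)" using G0 by (subst zrpoly_simps) simp
  finally have "smult c f = zrpoly (primitive_part G)" .
  moreover have "c \<noteq> 0" using d G0 by (simp add: c_def)
  moreover have "content (primitive_part G) = 1" using G0 by simp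
  ultimately show ?thesis using that by blast
qed

text \<open>Scale both factors to primitive integer polynomials \<open>F\<close> and
  \<open>H\<close>. Their product is primitive and equals \<open>lead_coeff (F * H)\<close> times
  \<open>P\<close>, so this coefficient is a unit. Hence the scaling constant of the monic
  \<open>f\<close>, which is \<open>lead_coeff F\<close>, is 1 or -1.\<close>

lemma monic_rat_factor_integral:
  fixes f :: "rat poly"
  assumes "lead_coeff f = 1" "f dvd zrpoly P" "lead_coeff P = 1"
  obtains F where "f = zrpoly F" "lead_coeff F = 1"
proof -
  obtain h where h: "zrpoly P = f * h" using assms(2) ..
  have P0: "P \<noteq> 0" using assms by auto
  then have "f \<noteq> 0" "h \<noteq> 0" using h by (metis mult_eq_0_iff zrpoly_simps(9))+
  then obtain c F d H where F: "c \<noteq> 0" "smult c f = zrpoly F" "content F = 1"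
    and H: "d \<noteq> 0" "smult d h = zrpoly H" "content H = 1"
    using rat_poly_primitive_multiple by metis
  have cd: "smult (c * d) (zrpoly P) = zrpoly (F * H)"
    by (simp add: h mult_ac flip: F H)
  have lF: "of_int (lead_coeff F) = c"
    using assms(1) F(1) arg_cong[OF F(2), of lead_coeff] by simp
  have "lead_coeff (smult (c*d) (zrpoly P)) = c * d" using assms by simp
  then have "c * d = of_int (lead_coeff (F * H))" unfolding cd by (simp add: lead_coeff_mult)
  then have "zrpoly (smult (lead_coeff (F * H)) P) = zrpoly (F * H)" 
    using cd by simp
  then have eq: "smult (lead_coeff (F * H)) P = F * H" by (simp only: zrpoly_simps(11))
  have "content (F * H) = 1" using F H by (simp add: content_mult)
  then have "content (smult (lead_coeff (F * H)) P) = 1" using eq by simp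
  then have "\<bar>lead_coeff (F * H)\<bar> * content P = 1" by simp
  then have "is_unit (\<bar>lead_coeff (F * H)\<bar>)" by (metis dvd_triv_left)
  then have "is_unit (lead_coeff (F * H))" by simp
  then have "is_unit (lead_coeff F)" by (metis is_unit_mult_iff lead_coeff_mult)
  then have "lead_coeff F = 1 \<or> lead_coeff F = -1" by auto
  then consider "c = 1" "lead_coeff F = 1" | "c = -1" "lead_coeff F = -1" using lF by auto
  then show ?thesis
  proof cases
    case 1
    then show ?thesis using that F by auto
  next
    case 2
    then have "f = zrpoly (- F)" using F(2) by (simp add: minus_equation_iff)
    then show ?thesis using that[of "-F"] 2 by simp
  qed
qed

section \<open>Kronecker's theorem and cyclotomic polynomials\<close>

text \<open>Horner induction: multiplying the remainder by the indeterminate may create one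
  coefficient of degree \<open>degree F\<close>, and subtracting a multiple of \<open>F\<close>
  removes it. The quotient stays integral because \<open>F\<close> is monic.\<close>

lemma monic_int_poly_reduce:
  fixes F P :: "int poly"
  assumes "lead_coeff F = 1" "degree F > 0"
  shows "\<exists>Q R. P = F * Q + R \<and> degree R < degree F"
proof (induction P)
  case 0
  then show ?case using assms by (intro exI[of _ 0]) auto
next
  case (pCons a P)
  then obtain Q R where QR: "P = F * Q + R" "degree R < degree F" by blast
  define c where "c = coeff (pCons a R) (degree F)"
  have "degree (pCons a R - smult c F) < degree F"
  proof -
    have "degree (pCons a R - smult c F) \<le> degree F"
      using QR(2) by (intro degree_diff_le) (auto simp: degree_pCons_eq_if)
    moreover have "coeff (pCons a R - smult c F) (degree F) = 0"
      using assms by (simp add: c_def)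
    ultimately show ?thesis
      using assms(2) by (metis eq_zero_or_degree_less degree_0)
  qed
  moreover have "pCons a P = F * ([:c:] + pCons 0 Q) + (pCons a R - smult c F)"
    by (simp add: QR(1) algebra_simps)
  ultimately show ?case by blast
qed

lemma zpoly_monom_eval [simp]: "poly (zpoly (monom 1 m)) z = z ^ m"
  by (simp add: map_poly_monom poly_monom)

lemma finite_bounded_int_polys:
  "finite {R :: int poly. degree R < d \<and> (\<forall>i. \<bar>coeff R i\<bar> \<le> K)}"
proof (rule finite_subset)
  show "finite (Poly ` {xs. set xs \<subseteq> {-K..K} \<and> length xs = d})"
    by (intro finite_imageI finite_lists_length_eq) auto
  show "{R :: int poly. degree R < d \<and> (\<forall>i. \<bar>coeff R i\<bar> \<le> K)} \<subseteq>
      Poly ` {xs. set xs \<subseteq> {-K..K} \<and> length xs = d}"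
  proof (intro subsetI, elim CollectE conjE)
    fix R :: "int poly" assume R: "degree R < d" "\<forall>i. \<bar>coeff R i\<bar> \<le> K"
    have "R = Poly (map (coeff R) [0..<d])"
      using R(1) by (intro poly_eqI) (auto simp: coeff_Poly_eq nth_default_def coeff_eq_0)
    moreover have "set (map (coeff R) [0..<d]) \<subseteq> {-K..K}"
      using R(2) by (auto simp: abs_le_iff minus_le_iff)
    ultimately show "R \<in> Poly ` {xs. set xs \<subseteq> {-K..K} \<and> length xs = d}"
      by (intro image_eqI[where x = "map (coeff R) [0..<d]"]) auto
  qed
qed

text \<open>Lagrange interpolation: with \<open>card S\<close> nodes, the coefficients are fixed
  linear functions of the values. The \<open>l z\<close> are the interpolation basis
  polynomials.\<close>

lemma coeff_bound_from_values:
  fixes S :: "complex set"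
  assumes "finite S"
  shows "\<exists>K. \<forall>R. degree R < card S \<and> (\<forall>z\<in>S. cmod (poly R z) \<le> 1) \<longrightarrow>
    (\<forall>i. cmod (coeff R i) \<le> K)"
proof -
  define l where "l z = smult (inverse (\<Prod>w\<in>S - {z}. z - w)) (\<Prod>w\<in>S - {z}. [:- w, 1:])" for z
  have l: "poly (l z) u = (if u = z then 1 else 0)" if "z \<in> S" "u \<in> S" for z u
    using that assms by (auto simp: l_def poly_prod)
  have deg: "degree (l z) < card S" if "z \<in> S" for z
  proof -
    have "degree (\<Prod>w\<in>S - {z}. [:- w, 1:]) = card (S - {z})"
      by (subst degree_prod_sum_eq) auto
    moreover have "card (S - {z}) < card S" using that assms by (rule card_Diff1_less[rotated])
    moreover have "degree (l z) \<le> degree (\<Prod>w\<in>S - {z}. [:- w, 1:])"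
      unfolding l_def by (rule degree_smult_le)
    ultimately show ?thesis by linarith
  qed
  define K where "K = (\<Sum>z\<in>S. \<Sum>i<card S. cmod (coeff (l z) i))"
  have "cmod (coeff R i) \<le> K" if R: "degree R < card S" "\<forall>z\<in>S. cmod (poly R z) \<le> 1" for R i
  proof (cases "i < card S")
    case False
    then show ?thesis using R by (auto simp: coeff_eq_0 K_def sum_nonneg)
  next
    case True
    have "R = (\<Sum>z\<in>S. smult (poly R z) (l z))"
    proof (rule ccontr)
      let ?D = "R - (\<Sum>z\<in>S. smult (poly R z) (l z))"
      assume "R \<noteq> (\<Sum>z\<in>S. smult (poly R z) (l z))"
      then have D: "?D \<noteq> 0" by simp
      have "degree (\<Sum>z\<in>S. smult (poly R z) (l z)) < card S"
        using deg R(1) by (intro degree_sum_less) (auto intro: le_less_trans[OF degree_smult_le])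
      then have "degree ?D < card S" using R(1) by (intro degree_diff_less)
      moreover have "S \<subseteq> {x. poly ?D x = 0}"
      proof
        fix u assume u: "u \<in> S"
        have "poly (\<Sum>z\<in>S. smult (poly R z) (l z)) u = (\<Sum>z\<in>S. if z = u then poly R u else 0)"
          unfolding poly_sum by (intro sum.cong) (auto simp: l u)
        also have "\<dots> = poly R u" using u assms by (simp add: sum.delta)
        finally show "u \<in> {x. poly ?D x = 0}" by (simp only: mem_Collect_eq poly_diff diff_self)
      qed
      then have "card S \<le> degree ?D"
        using card_mono[OF poly_roots_finite[OF D]] card_poly_roots_bound[OF D] by (meson order_trans)
      ultimately show False by simp
    qed
    then have "coeff R i = coeff (\<Sum>z\<in>S. smult (poly R z) (l z)) i" by (rule arg_cong)
    also have "\<dots> = (\<Sum>z\<in>S. poly R z * coeff (l z) i)" by (simp add: coeff_sum)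
    finally have "cmod (coeff R i) \<le> (\<Sum>z\<in>S. cmod (poly R z) * cmod (coeff (l z) i))"
      by (simp add: norm_mult sum_norm_le)
    also have "\<dots> \<le> (\<Sum>z\<in>S. cmod (coeff (l z) i))"
      using R(2) by (intro sum_mono) (simp add: mult_left_le_one_le)
    also have "\<dots> \<le> K"
      unfolding K_def using True by (intro sum_mono member_le_sum) auto
    finally show ?thesis .
  qed
  then show ?thesis by blast
qed

text \<open>The remainders of \<open>X\<^sup>m\<close> modulo \<open>F\<close> are integer polynomials bounded by \<open>1\<close> at all roots of \<open>F\<close>;
  there are finitely many such polynomials, so two powers of \<open>z\<close> coincide.\<close>
theorem kronecker_root_of_unity:
  assumes F: "lead_coeff F = 1" "irreducible (zrpoly F)"
    and bd: "\<And>w. w \<in> roots_Q (zrpoly F) \<Longrightarrow> cmod w \<le> 1"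
    and z: "z \<in> roots_Q (zrpoly F)" "z \<noteq> 0"
  shows "\<exists>n>0. z ^ n = 1"
proof -
  define S where "S = roots_Q (zrpoly F)"
  have fin: "finite S" and card: "card S = degree F" and d: "degree F > 0"
    using F(2) card_roots_Q irreducible_rat_degree_pos roots_Q_finite[of "zrpoly F"]
    unfolding S_def by fastforce+
  have "\<exists>R. degree R < degree F \<and> (\<forall>w\<in>S. poly (zpoly R) w = w ^ m)" for m
  proof -
    obtain Q R where "monom 1 m = F * Q + R" "degree R < degree F"
      using monic_int_poly_reduce[OF F(1) d] by blast
    moreover from this have "poly (zpoly R) w = w ^ m" if "w \<in> S" for w
      using that zpoly_monom_eval[of m w] by (simp add: S_def roots_Q_def)
    ultimately show ?thesis by blast
  qed
  then obtain R where R: "\<And>m. degree (R m) < degree F"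
    "\<And>m w. w \<in> S \<Longrightarrow> poly (zpoly (R m)) w = w ^ m" by metis
  obtain K where K: "\<And>P i. degree P < card S \<Longrightarrow> (\<forall>w\<in>S. cmod (poly P w) \<le> 1) \<Longrightarrow>
      cmod (coeff P i) \<le> K"
    using coeff_bound_from_values[OF fin] by blast
  have "\<bar>coeff (R m) i\<bar> \<le> \<lfloor>K\<rfloor>" for m i
  proof -
    have "cmod (coeff (zpoly (R m)) i) \<le> K"
      using R bd card by (intro K) (auto simp: S_def norm_power power_le_one)
    then show ?thesis by (simp add: le_floor_iff)
  qed
  then have "range R \<subseteq> {P. degree P < degree F \<and> (\<forall>i. \<bar>coeff P i\<bar> \<le> \<lfloor>K\<rfloor>)}"
    using R(1) by auto
  then have "finite (range R)"
    using finite_bounded_int_polys finite_subset by blast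
  then have "\<not> inj R" using finite_imageD infinite_UNIV_nat by blast
  then obtain a b where "R a = R b" "a < b"
    by (metis injI linorder_neqE_nat)
  then have "z ^ a = z ^ b" using R(2) z(1) by (metis S_def)
  then have "z ^ a * z ^ (b - a) = z ^ a * 1"
    using \<open>a < b\<close> power_add[of z a "b - a"] by simp
  then have "z ^ (b - a) = 1" using z(2) by simp
  then show ?thesis using \<open>a < b\<close> by (intro exI[of _ "b - a"]) auto
qed

section \<open>The Frobenius congruence and the irreducibility of cyclotomic polynomials\<close>

lemma prime_dvd_binomial_power_diff:
  fixes x y :: "'a::comm_ring_1"
  assumes "prime (p::nat)"
  shows "of_nat p dvd (x + y) ^ p - x ^ p - y ^ p"
proof -
  have p: "p > 0" using assms prime_gt_0_nat by blast
  have "(x + y) ^ p = (\<Sum>k\<le>p. of_nat (p choose k) * x ^ k * y ^ (p - k))"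
    by (rule binomial_ring)
  also have "{..p} = insert 0 (insert p {0<..<p})" using p by auto
  also have "(\<Sum>k\<in>\<dots>. of_nat (p choose k) * x ^ k * y ^ (p - k)) =
      x ^ p + y ^ p + (\<Sum>k\<in>{0<..<p}. of_nat (p choose k) * x ^ k * y ^ (p - k))"
    using p by (simp add: algebra_simps)
  finally have "(x + y) ^ p - x ^ p - y ^ p =
      (\<Sum>k\<in>{0<..<p}. of_nat (p choose k) * x ^ k * y ^ (p - k))" by simp
  also have "of_nat p dvd \<dots>"
  proof (intro dvd_sum dvd_mult2)
    fix k assume "k \<in> {0<..<p}"
    then have "p dvd (p choose k)" using assms by (intro dvd_choose_prime) auto
    then show "(of_nat p :: 'a) dvd of_nat (p choose k)" by (auto elim!: dvdE)
  qed
  finally show ?thesis .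
qed

lemma fermat_int:
  fixes a :: int
  assumes "prime (p::nat)"
  shows "int p dvd a ^ p - a"
proof (induction a rule: int_induct[of _ 0])
  case base
  then show ?case using assms prime_gt_0_nat by (simp add: power_0_left)
next
  case (step1 i)
  have "int p dvd ((i + 1) ^ p - i ^ p - 1 ^ p) + (i ^ p - i)"
    using prime_dvd_binomial_power_diff[OF assms, of i 1] step1 by (intro dvd_add) auto
  then show ?case by (simp add: algebra_simps)
next
  case (step2 i)
  have "int p dvd (i ^ p - i) - ((i - 1 + 1) ^ p - (i - 1) ^ p - 1 ^ p)"
    using dvd_diff[OF step2(2) prime_dvd_binomial_power_diff[OF assms, of "i - 1" 1, simplified of_nat_id]]
    by simp
  then show ?case by (simp add: algebra_simps)
qed

text \<open>The congruence of \<open>F(X\<^sup>p)\<close> and \<open>F(X)\<^sup>p\<close> modulo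
  \<open>p\<close>, one Horner step at a time: the binomial congruence splits off the constant term,
  and Fermat's little theorem handles it.\<close>

lemma pcompose_prime_power_dvd:
  fixes F :: "int poly"
  assumes p: "prime (p::nat)"
  shows "of_nat p dvd F \<circ>\<^sub>p monom 1 p - F ^ p"
proof (induction F)
  case 0
  then show ?case using p prime_gt_0_nat by (simp add: power_0_left)
next
  case (pCons a F)
  have 1: "of_nat p dvd ([:a:] + monom 1 1 * F) ^ p - [:a:] ^ p - (monom 1 1 * F) ^ p"
    by (rule prime_dvd_binomial_power_diff[OF p])
  have 2: "of_nat p dvd monom 1 p * (F \<circ>\<^sub>p monom 1 p - F ^ p)"
    using pCons.IH by (rule dvd_mult)
  have 3: "of_nat p dvd [:a:] ^ p - [:a:]"
  proof -
    obtain c where "a ^ p - a = int p * c" using fermat_int[OF p] by blast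
    then have "[:a:] ^ p - [:a:] = of_nat p * [:c:]"
      by (simp add: of_nat_poly poly_const_pow)
    then show ?thesis by (rule dvdI)
  qed
  have "pCons a F = [:a:] + monom 1 1 * F" by (simp add: monom_Suc)
  moreover have "(pCons a F) \<circ>\<^sub>p monom 1 p = [:a:] + monom 1 p * (F \<circ>\<^sub>p monom 1 p)"
    by (simp add: pcompose_pCons)
  ultimately have "(pCons a F) \<circ>\<^sub>p monom 1 p - (pCons a F) ^ p =
     monom 1 p * (F \<circ>\<^sub>p monom 1 p - F ^ p)
     - (([:a:] + monom 1 1 * F) ^ p - [:a:] ^ p - (monom 1 1 * F) ^ p) - ([:a:] ^ p - [:a:])"
    by (simp add: power_mult_distrib monom_power algebra_simps)
  then show ?case using dvd_diff[OF dvd_diff[OF 2 1] 3] by simp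
qed

text \<open>If \<open>F(w\<^sup>p) \<noteq> 0\<close>, differentiating \<open>X\<^sup>k - 1 = F G\<close> at \<open>w\<^sup>p\<close> shows that \<open>F(w\<^sup>p)\<close> divides
  \<open>k\<close> in \<open>\<int>[w]\<close>, while \<open>F(w\<^sup>p) \<equiv> F(w)\<^sup>p = 0\<close> modulo \<open>p\<close>; hence \<open>p\<close> divides \<open>k\<close>.\<close>
lemma root_of_unity_prime_power_conj:
  fixes F G :: "int poly"
  assumes F: "lead_coeff F = 1" "irreducible (zrpoly F)"
    and FG: "F * G = monom 1 k - 1" and k: "k > 0"
    and w: "w \<in> roots_Q (zrpoly F)" and p: "prime p" "\<not> p dvd k"
  shows "w ^ p \<in> roots_Q (zrpoly F)"
proof (rule ccontr)
  assume "w ^ p \<notin> roots_Q (zrpoly F)"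
  then have u: "poly (zpoly F) (w ^ p) \<noteq> 0" by (simp add: roots_Q_def)
  have w0: "poly (zpoly F) w = 0" using w by (simp add: roots_Q_def)
  have d: "degree F > 0" using irreducible_rat_degree_pos[OF F(2)] by simp
  have FGz: "zpoly F * zpoly G = monom 1 k - 1"
    using arg_cong[OF FG, of zpoly] by (simp add: map_poly_monom)
  then have ev: "poly (zpoly F) x * poly (zpoly G) x = x ^ k - 1" for x
    by (metis poly_1 poly_diff poly_monom poly_mult mult_1)
  have wk: "w ^ k = 1" using ev[of w] w0 by simp
  then have uk: "(w ^ p) ^ k = 1" by (metis mult.commute power_mult power_one)
  then have G0: "poly (zpoly G) (w ^ p) = 0" using ev[of "w ^ p"] u by simp
  have "pderiv (zpoly F * zpoly G) = monom (of_nat k) (k - 1)"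
    unfolding FGz by (simp add: pderiv_diff pderiv_monom)
  then have "poly (pderiv (zpoly F * zpoly G)) (w ^ p) = of_nat k * (w ^ p) ^ (k - 1)"
    by (simp add: poly_monom)
  then have "poly (zpoly F) (w ^ p) * poly (pderiv (zpoly G)) (w ^ p) = of_nat k * (w ^ p) ^ (k - 1)"
    using G0 by (simp add: pderiv_mult)
  then have "poly (zpoly F) (w ^ p) * poly (pderiv (zpoly G)) (w ^ p) * w ^ p
      = of_nat k * ((w ^ p) ^ (k - 1) * w ^ p)"
    by (simp add: mult.assoc)
  also have "(w ^ p) ^ (k - 1) * w ^ p = 1"
    using uk k by (metis power_minus_mult)
  finally have kk: "poly (zpoly F) (w ^ p) * poly (pderiv (zpoly G)) (w ^ p) * w ^ p = of_nat k"
    by simp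
  have comp: "poly (zpoly (P \<circ>\<^sub>p monom 1 p)) x = poly (zpoly P) (x ^ p)" for P x
    by (induction P) (simp_all add: pcompose_pCons)
  obtain H where H: "F \<circ>\<^sub>p monom 1 p - F ^ p = of_nat p * H"
    using pcompose_prime_power_dvd[OF p(1)] by blast
  have Fp: "poly (zpoly (F ^ p)) w = 0"
    using w0 prime_gt_0_nat[OF p(1)] by (cases p) auto
  have "zpoly (of_nat p) = of_nat p"
    by (simp add: of_nat_poly)
  then have "poly (zpoly F) (w ^ p) = of_nat p * poly (zpoly H) w"
    using arg_cong[OF H, of "\<lambda>P. poly (zpoly P) w"] Fp by (simp add: comp)
  moreover have "pderiv (zpoly G) = zpoly (pderiv G)"
    by (intro poly_eqI) (simp add: coeff_pderiv)
  ultimately have "of_nat k = of_nat p * poly (zpoly (H * (pderiv G \<circ>\<^sub>p monom 1 p) * monom 1 p)) w"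
    using kk by (simp add: comp mult_ac)
  \<comment> \<open>Reducing modulo \<open>F\<close> turns the numerical identity
    \<open>k = p * R(w)\<close> into an identity of polynomials: \<open>k - p * R\<close> vanishes
    at \<open>w\<close> and has degree below that of the minimal polynomial \<open>F\<close> of
    \<open>w\<close>.\<close>
  moreover obtain Q R where QR: "H * (pderiv G \<circ>\<^sub>p monom 1 p) * monom 1 p = F * Q + R" "degree R < degree F"
    using monic_int_poly_reduce[OF F(1) d] by blast
  ultimately have "poly (zpoly ([:int k:] - smult (int p) R)) w = 0"
    using w0 by simp
  then have "poly (rpoly (zrpoly ([:int k:] - smult (int p) R))) w = 0" by (simp only: zrpoly_simps(12))
  moreover have "poly (rpoly (zrpoly F)) w = 0" using w by (simp add: roots_Q_def)
  ultimately have dv: "zrpoly F dvd zrpoly ([:int k:] - smult (int p) R)"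
    using irreducible_rat_root_dvd_iff[OF F(2)] by blast
  have dl: "degree ([:int k:] - smult (int p) R) < degree F"
    using QR(2) d by (intro degree_diff_less) (auto intro: le_less_trans[OF degree_smult_le])
  have "[:int k:] - smult (int p) R = 0"
    using dvd_imp_degree_le[OF dv] dl by (metis leD zrpoly_simps(7,9))
  then have "coeff ([:int k:] - smult (int p) R) 0 = 0" by simp
  then have "int k = int p * coeff R 0" by simp
  then have "int p dvd int k" by simp
  then show False using p(2) by simp
qed

text \<open>Let \<open>k\<close> be the exact order of \<open>z\<close>. The equation
  \<open>w ^ m = 1\<close> passes between conjugates, so all roots are primitive \<open>k\<close>-th
  roots of unity. Conversely the roots are closed under powers coprime to \<open>k\<close>, so every
  primitive root occurs.\<close>

theorem irreducible_root_of_unity_cyclotomic: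
  assumes F: "lead_coeff F = 1" "irreducible (zrpoly F)"
    and z: "z \<in> roots_Q (zrpoly F)" and n: "\<exists>n>0. z ^ n = 1"
  shows "is_cyclotomic (zrpoly F)"
proof -
  define k where "k = (LEAST n. n > 0 \<and> z ^ n = 1)"
  have k: "k > 0" "z ^ k = 1" using LeastI_ex[OF n] unfolding k_def by auto
  have least: "k \<le> m" if "m > 0" "z ^ m = 1" for m
    unfolding k_def by (rule Least_le) (use that in auto)
  have pw: "w ^ m = 1" if "w \<in> roots_Q (zrpoly F)" "v \<in> roots_Q (zrpoly F)" "v ^ m = 1" for v w m
  proof -
    have "poly (rpoly (zrpoly (monom 1 m - 1))) v = 0"
      using that by (subst zrpoly_simps(12)) simp
    then have "poly (rpoly (zrpoly (monom 1 m - 1))) w = 0"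
      using irreducible_rat_conj_root[OF F(2)] that unfolding roots_Q_def by blast
    then show ?thesis by (subst (asm) zrpoly_simps(12)) simp
  qed
  have lk: "lead_coeff (monom 1 k - 1 :: int poly) = 1"
    and dk: "degree (monom 1 k - 1 :: int poly) = k"
  proof -
    have "degree (monom 1 k + (- 1) :: int poly) = degree (monom 1 k :: int poly)"
      using k by (intro degree_add_eq_left) (simp add: degree_monom_eq)
    then show "degree (monom 1 k - 1 :: int poly) = k" by (simp add: degree_monom_eq)
    then show "lead_coeff (monom 1 k - 1 :: int poly) = 1" using k by simp
  qed
  have zz: "poly (rpoly (zrpoly F)) z = 0" using z by (simp add: roots_Q_def)
  have "poly (rpoly (zrpoly (monom 1 k - 1))) z = 0"
    using k by (subst zrpoly_simps(12)) simp
  then obtain g where g: "zrpoly (monom 1 k - 1) = zrpoly F * g"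
    using irreducible_rat_root_dvd_iff[OF F(2) zz] by blast
  have "lead_coeff (zrpoly (monom 1 k - 1)) = 1"
    using lk by (simp only: zrpoly_simps(7,8) of_int_1)
  then have "lead_coeff g = 1" using F(1) unfolding g by (simp add: lead_coeff_mult)
  moreover have "g dvd zrpoly (monom 1 k - 1)" using g by simp
  ultimately obtain G where G: "g = zrpoly G" using monic_rat_factor_integral lk by blast
  have FG: "F * G = monom 1 k - 1" using g unfolding G
    by (metis zrpoly_simps(2,11))
  \<comment> \<open>The exponent is built up one prime factor \<open>p\<close> at a time;
    \<open>p\<close> does not divide \<open>k\<close> since \<open>j\<close> is coprime to
    \<open>k\<close>. The exponent 0 is coprime to \<open>k\<close> only for \<open>k = 1\<close>,
    where all roots equal 1.\<close>
  have powers: "w \<in> roots_Q (zrpoly F) \<Longrightarrow> coprime j k \<Longrightarrow> w ^ j \<in> roots_Q (zrpoly F)" for w j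
  proof (induction j arbitrary: w rule: less_induct)
    case (less j)
    consider "j = 0" | "j = 1" | "j > 1" by linarith
    then show ?case
    proof cases
      case 1
      then have "k = 1" using less.prems by simp
      then show ?thesis using 1 pw[OF less.prems(1) z, of 1] k less.prems by simp
    next
      case 3
      then obtain p where p: "prime p" "p dvd j" by (metis prime_factor_nat less_numeral_extra(4))
      then obtain i where i: "j = p * i" by blast
      have "\<not> p dvd k" using p less.prems(2) by (metis coprime_common_divisor not_prime_unit)
      then have "w ^ p \<in> roots_Q (zrpoly F)"
        using root_of_unity_prime_power_conj[OF F FG k(1) less.prems(1) p(1)] by simp
      moreover have "i < j" using i 3 n_less_m_mult_n[of i p] prime_gt_1_nat[OF p(1)] by (cases "i = 0") auto
      moreover have "coprime i k" using less.prems(2) i by simp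
      ultimately show ?thesis using less.IH i by (simp add: power_mult)
    qed (use less in auto)
  qed
  define e where "e j = cis (2 * pi * real j / real k)" for j
  have bij: "bij_betw e {..<k} {x. x ^ k = 1}"
    unfolding e_def using Complex.bij_betw_roots_unity[OF k(1)] by simp
  have epow: "e j = e 1 ^ j" for j
    unfolding e_def Complex.DeMoivre by (rule arg_cong[where f = cis]) simp
  \<comment> \<open>A non-coprime exponent gives order at most \<open>k div gcd i k\<close>, which
    contradicts the minimality of \<open>k\<close>.\<close>
  have noncop: "\<exists>m. 0 < m \<and> m < k \<and> (e 1 ^ i) ^ m = 1" if "\<not> coprime i k" for i
  proof -
    have "gcd i k \<noteq> 1" using that coprime_iff_gcd_eq_1 by blast
    moreover have "gcd i k \<noteq> 0" using k(1) by simp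
    ultimately have g: "gcd i k > 1" by linarith
    obtain m where m: "k = gcd i k * m" using gcd_dvd2 by blast
    obtain l where l: "i = gcd i k * l" using gcd_dvd1 by blast
    have "m > 0" using m k by (cases m) auto
    moreover have "m < k" using n_less_m_mult_n[OF \<open>m > 0\<close>, of "gcd i k"] g m by simp
    moreover have "(e 1 ^ i) ^ m = 1"
    proof -
      have "i * m = (gcd i k * l) * m" using l by (rule arg_cong)
      also have "\<dots> = (gcd i k * m) * l" by (simp only: mult_ac)
      also have "\<dots> = k * l" using m by (simp only: m[symmetric])
      finally have "i * m = k * l" .
      then have "(e 1 ^ i) ^ m = (e 1 ^ k) ^ l" by (simp only: power_mult[symmetric])
      also have "e 1 ^ k = 1" using k(1) by (simp add: e_def Complex.DeMoivre)
      finally show ?thesis by simp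
    qed
    ultimately show ?thesis by blast
  qed
  have "roots_Q (zrpoly F) = e ` {j. j < k \<and> coprime j k}"
  proof (intro equalityI subsetI)
    fix w assume w: "w \<in> roots_Q (zrpoly F)"
    then have "w ^ k = 1" using pw z k by blast
    then obtain j where j: "j < k" "w = e j" using bij by (auto simp: bij_betw_def image_iff set_eq_iff)
    have "coprime j k"
      using noncop[of j] pw[OF z w] j least epow by (metis leD)
    then show "w \<in> e ` {j. j < k \<and> coprime j k}" using j by blast
  next
    fix w assume "w \<in> e ` {j. j < k \<and> coprime j k}"
    then obtain j where "coprime j k" "w = e j" by auto
    then have j: "coprime j k" "w = e 1 ^ j" using epow[of j] by (simp_all only:)
    obtain i where i: "i < k" "z = e i" using bij k by (auto simp: bij_betw_def image_iff set_eq_iff)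
    have ci: "coprime i k"
      using noncop[of i] i least epow by (metis leD)
    have "e 1 \<in> roots_Q (zrpoly F)"
    proof (cases "i = 0")
      case True
      then have "k = 1" using ci by simp
      then show ?thesis using z i True by (simp add: e_def)
    next
      case False
      \<comment> \<open>As \<open>z\<close> is \<open>e 1 ^ i\<close>, an inverse \<open>x\<close>
        of \<open>i\<close> modulo \<open>k\<close> gives \<open>z ^ x = e 1\<close>, and from
        \<open>e 1\<close> all the other primitive roots are reached.\<close>
      then obtain x y where xy: "i * x = k * y + 1"
        using bezout_nat[of i k] ci by (auto simp: coprime_iff_gcd_eq_1)
      have "coprime x k"
      proof (rule coprimeI)
        fix c assume "c dvd x" "c dvd k"
        then have "c dvd k * y + 1" "c dvd k * y" by (simp_all only: xy[symmetric] dvd_mult dvd_mult2)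
        then show "is_unit c" by (metis dvd_add_right_iff)
      qed
      then have "z ^ x \<in> roots_Q (zrpoly F)" using powers z by blast
      also have "z ^ x = e 1 ^ (i * x)" using i epow[of i] by (simp add: power_mult)
      also have "\<dots> = (e 1 ^ k) ^ y * e 1" by (simp add: xy power_mult power_add)
      also have "e 1 ^ k = 1" using k(1) by (simp add: e_def Complex.DeMoivre)
      finally show ?thesis by simp
    qed
    then show "w \<in> roots_Q (zrpoly F)" using powers j by simp
  qed
  moreover have "inj_on e {j. j < k \<and> coprime j k}"
    using bij by (auto simp: bij_betw_def inj_on_def)
  ultimately have "rpoly (zrpoly F) = (\<Prod>j\<in>{j. j < k \<and> coprime j k}. [:- e j, 1:])"
    using rpoly_irreducible_prod[OF F(2)] F(1) by (simp add: prod.reindex del: zrpoly_simps(12))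
  then show ?thesis unfolding is_cyclotomic_def e_def using k(1) by blast
qed

section \<open>Density of subgroups of Euclidean space\<close>

definition additive_subgroup :: "'a::real_vector set \<Rightarrow> bool" where
  "additive_subgroup H \<longleftrightarrow> 0 \<in> H \<and> (\<forall>x\<in>H. \<forall>y\<in>H. x - y \<in> H)"

lemma additive_subgroup_add:
  assumes "additive_subgroup H" "x \<in> H" "y \<in> H"
  shows "x + y \<in> H"
proof -
  have "0 - y \<in> H" using assms unfolding additive_subgroup_def by blast
  then have "x - (0 - y) \<in> H" using assms unfolding additive_subgroup_def by blast
  then show ?thesis by simp
qed

lemma additive_subgroup_of_nat:
  assumes "additive_subgroup H" "x \<in> H"
  shows "of_nat k *\<^sub>R x \<in> H"
proof (induction k)
  case 0
  then show ?case using assms by (simp add: additive_subgroup_def)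
next
  case (Suc k)
  then show ?case using additive_subgroup_add[OF assms(1) assms(2) Suc]
    by (simp add: scaleR_add_left)
qed

lemma additive_subgroup_of_int:
  assumes "additive_subgroup H" "x \<in> H"
  shows "of_int k *\<^sub>R x \<in> H"
proof (cases "k \<ge> 0")
  case True
  then show ?thesis using additive_subgroup_of_nat[OF assms, of "nat k"] by simp
next
  case False
  have "0 - of_nat (nat (- k)) *\<^sub>R x \<in> H"
    using additive_subgroup_of_nat[OF assms] assms(1) unfolding additive_subgroup_def by blast
  then show ?thesis using False by simp
qed

lemma additive_subgroup_sum:
  assumes "additive_subgroup H" "\<And>b. b \<in> B \<Longrightarrow> g b \<in> H"
  shows "sum g B \<in> H"
  using assms(2)
proof (induction B rule: infinite_finite_induct)
  case (insert x F)
  then show ?case using additive_subgroup_add[OF assms(1)] by simp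
qed (use assms(1) in \<open>auto simp: additive_subgroup_def\<close>)

lemma additive_subgroup_closure:
  fixes H :: "'a::real_normed_vector set"
  assumes "additive_subgroup H"
  shows "additive_subgroup (closure H)"
  unfolding additive_subgroup_def
proof (intro conjI ballI)
  show "0 \<in> closure H"
    using assms closure_subset unfolding additive_subgroup_def by blast
  fix x y assume "x \<in> closure H" "y \<in> closure H"
  then obtain a b where "\<And>n. a n \<in> H" "a \<longlonglongrightarrow> x" "\<And>n. b n \<in> H" "b \<longlonglongrightarrow> y"
    unfolding closure_sequential by blast
  then have "\<And>n. a n - b n \<in> H" "(\<lambda>n. a n - b n) \<longlonglongrightarrow> x - y"
    using assms tendsto_diff unfolding additive_subgroup_def by blast+
  then show "x - y \<in> closure H"
    unfolding closure_sequential by (intro exI[of _ "\<lambda>n. a n - b n"]) auto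
qed

text \<open>Let \<open>u\<close> be a limit of the directions of group elements tending to 0. For
  every \<open>t\<close>, the multiple of such an element \<open>h\<close> by the floor of
  \<open>t / norm h\<close> has length \<open>t\<close> up to an error of at most
  \<open>norm h\<close>, so these multiples converge to \<open>t *\<^sub>R u\<close>.\<close>

lemma additive_subgroup_contains_line:
  fixes H :: "'a::euclidean_space set"
  assumes "additive_subgroup H" "closed H"
    and small: "\<And>e. e > 0 \<Longrightarrow> \<exists>h\<in>H. h \<noteq> 0 \<and> norm h < e"
  shows "\<exists>u. norm u = 1 \<and> (\<forall>t. t *\<^sub>R u \<in> H)"
proof -
  have "\<exists>h\<in>H. h \<noteq> 0 \<and> norm h < inverse (real (Suc n))" for n
    using small by simp
  then obtain h where h: "\<And>n. h n \<in> H" "\<And>n. h n \<noteq> 0"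
    "\<And>n. norm (h n) < inverse (real (Suc n))" by metis
  define v where "v n = h n /\<^sub>R norm (h n)" for n
  have "\<forall>n. v n \<in> sphere 0 1" using h(2) by (simp add: v_def)
  moreover have "compact (sphere (0::'a) 1)" by simp
  ultimately obtain u r where u: "u \<in> sphere (0::'a) 1" "strict_mono r" "(v \<circ> r) \<longlonglongrightarrow> u"
    unfolding compact_def by blast
  have h0: "(\<lambda>n. norm (h n)) \<longlonglongrightarrow> 0"
    using h(3) LIMSEQ_inverse_real_of_nat
    by (intro tendsto_sandwich[OF _ _ tendsto_const LIMSEQ_inverse_real_of_nat])
       (auto intro!: always_eventually less_imp_le)
  have "t *\<^sub>R u \<in> H" for t
  proof -
    define g where "g n = of_int \<lfloor>t / norm (h (r n))\<rfloor> *\<^sub>R h (r n)" for n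
    have "g n - t *\<^sub>R u = (of_int \<lfloor>t / norm (h (r n))\<rfloor> * norm (h (r n)) - t) *\<^sub>R v (r n)
        + t *\<^sub>R (v (r n) - u)" for n
      using h(2) by (simp add: g_def v_def algebra_simps)
    then have 1: "norm (g n - t *\<^sub>R u) \<le> \<bar>of_int \<lfloor>t / norm (h (r n))\<rfloor> * norm (h (r n)) - t\<bar> * norm (v (r n))
        + \<bar>t\<bar> * norm (v (r n) - u)" for n
      by (metis norm_scaleR norm_triangle_ineq)
    have 2: "norm (v n) = 1" for n using h(2) by (simp add: v_def)
    have 3: "\<bar>of_int \<lfloor>t / norm (h (r n))\<rfloor> * norm (h (r n)) - t\<bar> \<le> norm (h (r n))" for n
    proof -
      let ?c = "norm (h (r n))"
      have c: "?c > 0" using h(2) by simp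
      have "of_int \<lfloor>t / ?c\<rfloor> \<le> t / ?c" "t / ?c \<le> of_int \<lfloor>t / ?c\<rfloor> + 1" by linarith+
      then have "of_int \<lfloor>t / ?c\<rfloor> * ?c \<le> t / ?c * ?c" "t / ?c * ?c \<le> (of_int \<lfloor>t / ?c\<rfloor> + 1) * ?c"
        using c by (simp_all only: mult_le_cancel_right_pos)
      moreover have "t / ?c * ?c = t" using c by simp
      ultimately show ?thesis by (simp add: algebra_simps)
    qed
    have 4: "norm (g n - t *\<^sub>R u) \<le> norm (h (r n)) + \<bar>t\<bar> * norm (v (r n) - u)" for n
      using 1[of n] 2[of "r n"] 3[of n] by simp
    have 5: "(\<lambda>n. norm (h (r n)) + \<bar>t\<bar> * norm (v (r n) - u)) \<longlonglongrightarrow> 0 + \<bar>t\<bar> * 0"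
    proof (rule tendsto_add[OF _ tendsto_mult_left])
      show "(\<lambda>n. norm (h (r n))) \<longlonglongrightarrow> 0"
        using LIMSEQ_subseq_LIMSEQ[OF h0 u(2)] by (simp add: o_def)
      show "(\<lambda>n. norm (v (r n) - u)) \<longlonglongrightarrow> 0"
        using u(3) by (simp add: o_def tendsto_norm_zero_iff LIM_zero_iff)
    qed
    have "(\<lambda>n. g n - t *\<^sub>R u) \<longlonglongrightarrow> 0"
      using 5 by (intro Lim_null_comparison[OF always_eventually, OF allI[OF 4]]) simp
    then have "g \<longlonglongrightarrow> t *\<^sub>R u" by (simp add: LIM_zero_iff)
    moreover have "g n \<in> H" for n unfolding g_def
      by (intro additive_subgroup_of_int assms h)
    ultimately show ?thesis using assms(2) closed_sequentially by blast
  qed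
  then show ?thesis using u(1) by auto
qed

text \<open>Take a maximal independent subset \<open>B\<close> of \<open>H\<close> and
  \<open>w\<close> orthogonal to all of \<open>B\<close> except \<open>b0\<close>. The
  \<open>b0\<close>-coordinates of elements of \<open>H\<close> are rational with bounded
  denominators, so a multiple of \<open>w\<close> is integral on \<open>H\<close>; no lattice basis
  of \<open>H\<close> is required. That \<open>w\<close> lies in \<open>span H\<close> keeps it
  inside the subspace of the later induction.\<close>

lemma discrete_subgroup_dual_vector:
  fixes H :: "'a::euclidean_space set"
  assumes H: "additive_subgroup H" "closed H"
    and e: "e > 0" "\<And>h. h \<in> H \<Longrightarrow> norm h < e \<Longrightarrow> h = 0"
    and nz: "\<exists>h\<in>H. h \<noteq> 0"
  shows "\<exists>w\<in>span H. w \<noteq> 0 \<and> (\<forall>h\<in>H. w \<bullet> h \<in> \<int>)"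
proof -
  obtain B where B: "B \<subseteq> H" "independent B" "H \<subseteq> span B"
    using maximal_independent_subset by blast
  have finB: "finite B" using B(2) independent_bound by blast
  obtain b0 where b0: "b0 \<in> B" using nz B(3) by fastforce
  have "b0 \<notin> span (B - {b0})" using B(2) b0 dependent_def by blast
  then have "span (B - {b0}) \<subset> span B" using b0 by (metis Diff_subset psubsetI span_base span_mono)
  then obtain w where w: "w \<noteq> 0" "w \<in> span B" "\<And>y. y \<in> span (B - {b0}) \<Longrightarrow> orthogonal w y"
    using orthogonal_to_subspace_exists_gen by metis
  have wb: "w \<bullet> b = 0" if "b \<in> B" "b \<noteq> b0" for b
    using w(3)[OF span_base] that by (simp add: orthogonal_def)
  have wb0: "w \<bullet> b0 \<noteq> 0"
  proof
    assume "w \<bullet> b0 = 0"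
    then have "orthogonal w b" if "b \<in> B" for b using wb that by (cases "b = b0") (auto simp: orthogonal_def)
    then have "orthogonal w w" using w(2) orthogonal_to_span by blast
    then show False using w(1) by (simp add: orthogonal_def)
  qed
  \<comment> \<open>The radius bounds every combination of \<open>B\<close> with coefficients in
    \<open>[0, 1]\<close>, hence all remainders of \<open>H\<close> modulo the integer span of
    \<open>B\<close>; discreteness makes \<open>F\<close> finite.\<close>
  define F where "F = H \<inter> cball 0 (\<Sum>b\<in>B. norm b)"
  have finF: "finite F"
  proof (rule ccontr)
    assume inf: "infinite F"
    have "compact F" unfolding F_def using H(2) by (simp add: closed_Int_compact)
    then obtain x where "x islimpt F"
      using inf compact_eq_Bolzano_Weierstrass by blast
    then have "infinite (F \<inter> ball x (e / 2))"
      using e(1) by (simp add: islimpt_eq_infinite_ball)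
    then obtain y z where yz: "y \<in> F \<inter> ball x (e / 2)" "z \<in> F \<inter> ball x (e / 2)" "y \<noteq> z"
      by (metis finite.emptyI finite_insert insertCI subsetI finite_subset)
    then have "dist y z < e"
      by (metis Int_iff dist_commute dist_triangle_half_l mem_ball)
    moreover have "y - z \<in> H" using yz H(1) by (auto simp: F_def additive_subgroup_def)
    ultimately show False using e(2)[of "y - z"] yz(3) by (simp add: dist_norm)
  qed
  \<comment> \<open>The denominators are differences of two indices in \<open>{0..card F}\<close>,
    and the factorial clears them all simultaneously.\<close>
  define w' where "w' = (of_nat (fact (card F)) / (w \<bullet> b0)) *\<^sub>R w"
  have "w' \<bullet> h \<in> \<int>" if h: "h \<in> H" for h
  proof -
    obtain c where c: "h = (\<Sum>b\<in>B. c b *\<^sub>R b)"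
      using B(3) h span_finite[OF finB] by auto
    \<comment> \<open>The remainders of the multiples of \<open>h\<close> modulo the integer span of
      \<open>B\<close>. All of them lie in \<open>F\<close>, so two of the \<open>card F + 1\<close>
      many coincide.\<close>
    define g where "g k = of_nat k *\<^sub>R h - (\<Sum>b\<in>B. of_int \<lfloor>of_nat k * c b\<rfloor> *\<^sub>R b)" for k :: nat
    have gH: "g k \<in> H" for k
    proof -
      have "(\<Sum>b\<in>B. of_int \<lfloor>of_nat k * c b\<rfloor> *\<^sub>R b) \<in> H"
        using B(1) by (intro additive_subgroup_sum H additive_subgroup_of_int) auto
      then show ?thesis using additive_subgroup_of_nat[OF H(1) h] H(1)
        unfolding g_def additive_subgroup_def by blast
    qed
    have gF: "g k \<in> F" for k
    proof -
      have "g k = (\<Sum>b\<in>B. (of_nat k * c b - of_int \<lfloor>of_nat k * c b\<rfloor>) *\<^sub>R b)"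
        unfolding g_def by (subst (1) c) (simp add: scaleR_sum_right sum_subtractf[symmetric] algebra_simps)
      moreover have "norm ((of_nat k * c b - of_int \<lfloor>of_nat k * c b\<rfloor>) *\<^sub>R b) \<le> norm b" for b
      proof -
        have "\<bar>of_nat k * c b - of_int \<lfloor>of_nat k * c b\<rfloor>\<bar> \<le> 1" by linarith
        then show ?thesis by (simp add: mult_left_le_one_le)
      qed
      ultimately have "norm (g k) \<le> (\<Sum>b\<in>B. norm b)" by (simp add: sum_norm_le)
      then show ?thesis using gH by (simp add: F_def)
    qed
    have "\<not> inj_on g {0..card F}"
    proof
      assume "inj_on g {0..card F}"
      then have "card (g ` {0..card F}) = Suc (card F)" by (simp add: card_image)
      moreover have "card (g ` {0..card F}) \<le> card F" using gF finF by (intro card_mono) auto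
      ultimately show False by simp
    qed
    then obtain i j where ij: "i < j" "j \<le> card F" "g i = g j"
      unfolding inj_on_def by (metis atLeastAtMost_iff linorder_neqE_nat)
    have wg: "w \<bullet> g k = of_nat k * (w \<bullet> h) - of_int \<lfloor>of_nat k * c b0\<rfloor> * (w \<bullet> b0)" for k
    proof -
      have "w \<bullet> (\<Sum>b\<in>B. of_int \<lfloor>of_nat k * c b\<rfloor> *\<^sub>R b) = (\<Sum>b\<in>B. of_int \<lfloor>of_nat k * c b\<rfloor> * (w \<bullet> b))"
        by (simp add: inner_sum_right)
      also have "\<dots> = (\<Sum>b\<in>B. if b = b0 then of_int \<lfloor>of_nat k * c b0\<rfloor> * (w \<bullet> b0) else 0)"
        using wb by (intro sum.cong) auto
      also have "\<dots> = of_int \<lfloor>of_nat k * c b0\<rfloor> * (w \<bullet> b0)" using b0 finB by simp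
      finally show ?thesis by (simp add: g_def inner_diff_right)
    qed
    have "of_nat (j - i) * ((w \<bullet> h) / (w \<bullet> b0)) = of_int (\<lfloor>of_nat j * c b0\<rfloor> - \<lfloor>of_nat i * c b0\<rfloor>)"
      using wg[of i] wg[of j] ij(1,3) wb0 by (simp add: of_nat_diff field_simps)
    then have *: "of_nat (j - i) * ((w \<bullet> h) / (w \<bullet> b0)) \<in> \<int>" by simp
    have "(j - i) dvd fact (card F)" using ij by (intro dvd_fact) auto
    then obtain q where q: "(fact (card F) :: nat) = (j - i) * q" ..
    have "w' \<bullet> h = of_nat (fact (card F)) * ((w \<bullet> h) / (w \<bullet> b0))" by (simp add: w'_def)
    also have "\<dots> = of_nat q * (of_nat (j - i) * ((w \<bullet> h) / (w \<bullet> b0)))"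
      unfolding q by (simp only: of_nat_mult mult_ac)
    also have "\<dots> \<in> \<int>" by (rule Ints_mult[OF Ints_of_nat *])
    finally show ?thesis .
  qed
  moreover have "w' \<noteq> 0" using w(1) wb0 by (simp add: w'_def)
  moreover have "w' \<in> span H" unfolding w'_def
    using w(2) span_mono[OF B(1)] by (intro span_mul) auto
  ultimately show ?thesis by blast
qed

text \<open>Arbitrarily small elements yield a line in \<open>H\<close> with direction
  \<open>u\<close>. Then \<open>H\<close> is the sum of this line and its part orthogonal to
  \<open>u\<close>, so a dual vector found in the orthogonal complement serves for \<open>H\<close>.
  Otherwise \<open>H\<close> is discrete; for \<open>H = {0}\<close> any nonzero vector of
  \<open>S\<close> will do.\<close>

lemma closed_subgroup_dual_vector_aux:
  fixes S :: "'a::euclidean_space set"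
  assumes "subspace S" "additive_subgroup H" "closed H" "H \<subset> S"
  shows "\<exists>w\<in>S. w \<noteq> 0 \<and> (\<forall>h\<in>H. w \<bullet> h \<in> \<int>)"
  using assms
proof (induction "dim S" arbitrary: S H rule: less_induct)
  case less
  note H = \<open>additive_subgroup H\<close> \<open>closed H\<close>
  show ?case
  proof (cases "\<forall>e>0. \<exists>h\<in>H. h \<noteq> 0 \<and> norm h < e")
    case True
    then obtain u where u: "norm u = 1" "\<And>t. t *\<^sub>R u \<in> H"
      using additive_subgroup_contains_line[OF H] by blast
    have uu: "u \<bullet> u = 1" using u(1) by (simp add: dot_square_norm)
    have uH: "u \<in> H" using u(2)[of 1] by simp
    define S' where "S' = S \<inter> {x. u \<bullet> x = 0}"
    have sS': "subspace S'" unfolding S'_def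
      using less.prems(1) by (intro subspace_inter subspace_hyperplane)
    have "u \<in> S" "u \<notin> S'" using uH less.prems uu by (auto simp: S'_def)
    then have "span S' \<subset> span S" using sS' less.prems(1) S'_def
      by (metis inf_le1 psubsetI span_eq_iff)
    then have dimS': "dim S' < dim S" by (rule dim_psubset)
    have proj: "h - (u \<bullet> h) *\<^sub>R u \<in> H \<inter> S'" if "h \<in> H" for h
    proof -
      have "h - (u \<bullet> h) *\<^sub>R u \<in> H" using that u(2) H(1) by (simp add: additive_subgroup_def)
      then show ?thesis using less.prems(4) uu by (auto simp: S'_def inner_diff_right)
    qed
    have "H \<inter> S' \<noteq> S'"
    proof
      assume eq: "H \<inter> S' = S'"
      have "S \<subseteq> H"
      proof
        fix x assume x: "x \<in> S"
        have "x - (u \<bullet> x) *\<^sub>R u \<in> S'"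
          using x \<open>u \<in> S\<close> less.prems(1) uu
          by (auto simp: S'_def inner_diff_right intro!: subspace_diff subspace_scale)
        then have "x - (u \<bullet> x) *\<^sub>R u \<in> H" using eq by blast
        then show "x \<in> H" using additive_subgroup_add[OF H(1) _ u(2)[of "u \<bullet> x"]] by fastforce
      qed
      then show False using less.prems(4) by blast
    qed
    moreover have "additive_subgroup (H \<inter> S')"
      using H(1) sS' by (auto simp: additive_subgroup_def subspace_0 subspace_diff)
    moreover have "closed (H \<inter> S')" using H(2) sS' by (simp add: closed_Int closed_subspace)
    ultimately obtain w where w: "w \<in> S'" "w \<noteq> 0" "\<forall>h\<in>H \<inter> S'. w \<bullet> h \<in> \<int>"
      using less.hyps[OF dimS' sS', of "H \<inter> S'"] by blast
    have "w \<bullet> h \<in> \<int>" if "h \<in> H" for h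
    proof -
      have "w \<bullet> (h - (u \<bullet> h) *\<^sub>R u) \<in> \<int>" using proj[OF that] w(3) by blast
      then show ?thesis using w(1) by (simp add: S'_def inner_diff_right inner_commute)
    qed
    then show ?thesis using w by (auto simp: S'_def)
  next
    case False
    then obtain e where e: "e > 0" "\<And>h. h \<in> H \<Longrightarrow> norm h < e \<Longrightarrow> h = 0" by blast
    show ?thesis
    proof (cases "\<exists>h\<in>H. h \<noteq> 0")
      case True
      moreover have "span H \<subseteq> S" using less.prems(1,4) by (simp add: span_minimal psubset_imp_subset)
      ultimately show ?thesis using discrete_subgroup_dual_vector[OF H e] by blast
    next
      case False
      then have "H = {0}" using H(1) by (auto simp: additive_subgroup_def)
      moreover obtain w where "w \<in> S" "w \<notin> H" using less.prems(4) by blast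
      ultimately show ?thesis by (intro bexI[of _ w]) auto
    qed
  qed
qed

text \<open>Used contrapositively, as the density criterion: it suffices that no nonzero functional
  is integral on the subgroup.\<close>

theorem closed_subgroup_dual_vector:
  fixes H :: "'a::euclidean_space set"
  assumes "additive_subgroup H" "closed H" "H \<noteq> UNIV"
  shows "\<exists>w. w \<noteq> 0 \<and> (\<forall>h\<in>H. w \<bullet> h \<in> \<int>)"
  using closed_subgroup_dual_vector_aux[of UNIV H] assms by auto

section \<open>Generic orthogonal matrices and dual bases\<close>

text \<open>Countably many polynomials with finitely many roots each cannot exhaust the reals.
  \<open>C\<close> is an arbitrary countable set, so the lemma also provides a real nonroot of one
  given polynomial.\<close>

lemma exists_real_avoiding_roots:
  fixes C :: "complex set"
  assumes "countable C"
  shows "\<exists>t::real. \<forall>p. p \<noteq> 0 \<and> (\<forall>i. coeff p i \<in> C) \<longrightarrow> poly p (of_real t) \<noteq> 0"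
proof -
  define P where "P = {p. p \<noteq> 0 \<and> (\<forall>i. coeff p i \<in> C)}"
  have "P \<subseteq> Poly ` lists C"
  proof
    fix p assume "p \<in> P"
    then have "set (coeffs p) \<subseteq> C" by (auto simp: P_def coeffs_def)
    then show "p \<in> Poly ` lists C"
      by (intro image_eqI[of _ _ "coeffs p"]) auto
  qed
  then have "countable P" using countable_subset[OF _ countable_image[OF countable_lists[OF assms]]] by blast
  moreover have "countable {t::real. poly p (of_real t) = 0}" if "p \<in> P" for p
  proof -
    have "finite {x. poly p x = 0}" using that by (simp add: P_def poly_roots_finite)
    then have "finite (complex_of_real -` {x. poly p x = 0})"
      by (rule finite_vimageI) (simp add: inj_on_def)
    then show ?thesis by (simp add: vimage_def countable_finite)
  qed
  ultimately have "countable (\<Union>p\<in>P. {t::real. poly p (of_real t) = 0})" by blast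
  then have "(\<Union>p\<in>P. {t::real. poly p (of_real t) = 0}) \<noteq> UNIV"
    using uncountable_UNIV_real by metis
  then show ?thesis by (auto simp: P_def)
qed

text \<open>Entry \<open>(j, k)\<close> of \<open>I - 2 v v\<^sup>T / (v\<^sup>T v)\<close> for
  \<open>v = (1, t, ..., t\<^sup>e\<^sup>-\<^sup>1)\<close>; only indices below \<open>e\<close> are
  meant.\<close>

definition householder :: "real \<Rightarrow> nat \<Rightarrow> nat \<Rightarrow> nat \<Rightarrow> real" where
  "householder t e j k = (if j = k then 1 else 0) - 2 * t ^ (j + k) / (\<Sum>l<e. t ^ (2 * l))"

lemma householder_denom_pos:
  assumes "e > 0"
  shows "(\<Sum>l<e. t ^ (2 * l)) > (0::real)"
proof -
  have "(\<Sum>l\<in>{0}. t ^ (2 * l)) \<le> (\<Sum>l<e. t ^ (2 * l))"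
    using assms by (intro sum_mono2) (auto simp: power_mult)
  then show ?thesis by simp
qed

lemma householder_involution:
  assumes "j < e" "l < e"
  shows "(\<Sum>k<e. householder t e j k * householder t e k l) = (if j = l then 1 else 0)"
proof -
  define S where "S = (\<Sum>l<e. t ^ (2 * l))"
  have S: "S \<noteq> 0" using householder_denom_pos[of e t] assms by (simp add: S_def)
  have "(\<Sum>k<e. householder t e j k * householder t e k l) =
     (\<Sum>k<e. (if j = k then (if k = l then 1 else 0) else 0) - (if j = k then 2 * t ^ (j + l) / S else 0)
       - (if k = l then 2 * t ^ (j + l) / S else 0) + 4 * t ^ (j + l) / S\<^sup>2 * t ^ (2 * k))"
    unfolding householder_def S_def[symmetric]
    by (intro sum.cong refl) (use S in \<open>auto simp: field_simps power_add power2_eq_square power_mult\<close>)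
  also have "\<dots> = (if j = l then 1 else 0) - 2 * t ^ (j + l) / S - 2 * t ^ (j + l) / S
      + 4 * t ^ (j + l) / S\<^sup>2 * S"
    using assms by (simp add: sum.distrib sum_subtractf S_def sum_distrib_left)
  also have "\<dots> = (if j = l then 1 else 0)" using S by (simp add: field_simps power2_eq_square)
  finally show ?thesis .
qed

text \<open>Multiplied by the denominator, the relation says that \<open>t\<close> is a root of a
  polynomial \<open>q\<close> with coefficients in \<open>C\<close>, so \<open>q = 0\<close>. Since
  \<open>C\<close> is only an additive group, \<open>2 * y k\<close> appears as
  \<open>y k + y k\<close>.\<close>

lemma householder_generic:
  fixes y :: "nat \<Rightarrow> complex"
  assumes C: "0 \<in> C" "\<And>a b. a \<in> C \<Longrightarrow> b \<in> C \<Longrightarrow> a - b \<in> C"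
    and t: "\<And>p. p \<noteq> 0 \<Longrightarrow> (\<forall>i. coeff p i \<in> C) \<Longrightarrow> poly p (of_real t) \<noteq> 0"
    and y: "\<And>k. k < e \<Longrightarrow> y k \<in> C" and j: "j < e"
    and eq: "(\<Sum>k<e. of_real (householder t e j k) * y k) = 0" and k: "k < e"
  shows "y k = 0"
proof -
  have Cadd: "a + b \<in> C" if "a \<in> C" "b \<in> C" for a b
    using C(2)[OF that(1) C(2)[OF C(1) that(2)]] by simp
  have Csum: "sum g A \<in> C" if "\<And>x. x \<in> A \<Longrightarrow> g x \<in> C" for g and A :: "nat set"
    using that by (induction A rule: infinite_finite_induct) (auto simp: C Cadd)
  define q where "q = (\<Sum>l<e. monom (y j) (2 * l)) - (\<Sum>k<e. monom (y k + y k) (j + k))"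
  have cq: "coeff q i = (\<Sum>l<e. if 2 * l = i then y j else 0) - (\<Sum>k<e. if j + k = i then y k + y k else 0)" for i
    by (simp only: q_def coeff_diff coeff_sum coeff_monom)
  have "2 * y k \<in> C" if "k < e" for k using Cadd[OF y[OF that] y[OF that]] by simp
  then have "coeff q i \<in> C" for i
    unfolding cq using y j by (intro C(2) Csum) (auto simp: C)
  moreover have "poly q (of_real t) = 0"
  proof -
    define S where "S = (\<Sum>l<e. t ^ (2 * l))"
    have S: "S \<noteq> 0" using householder_denom_pos[of e t] j by (simp add: S_def)
    have "poly q (of_real t) = of_real S * y j - (\<Sum>k<e. 2 * of_real t ^ (j + k) * y k)"
      by (simp add: q_def poly_sum poly_monom S_def sum_distrib_left sum_distrib_right mult_ac)
    also have "of_real S * y j = (\<Sum>k<e. if j = k then of_real S * y k else 0)" using j by simp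
    also have "\<dots> - (\<Sum>k<e. 2 * of_real t ^ (j + k) * y k) =
       of_real S * (\<Sum>k<e. of_real (householder t e j k) * y k)"
      unfolding householder_def S_def[symmetric] sum_distrib_left sum_subtractf[symmetric]
      using S by (intro sum.cong) (auto simp: field_simps)
    finally show ?thesis using eq by simp
  qed
  ultimately have "q = 0" using t by blast
  then have c0: "(\<Sum>l<e. if 2 * l = i then y j else 0) = (\<Sum>k<e. if j + k = i then y k + y k else 0)" for i
    using cq[of i] by simp
  have "(\<Sum>l<e. if 2 * l = 2 * j then y j else 0) = y j" using j by simp
  moreover have "(\<Sum>k<e. if j + k = 2 * j then y k + y k else 0) = y j + y j"
  proof -
    have "(j + k = 2 * j) = (k = j)" for k by auto
    then show ?thesis using j by simp
  qed
  \<comment> \<open>The coefficient of \<open>X ^ (2 * j)\<close> yields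
    \<open>y j = 2 * y j\<close>. Once \<open>y j\<close> is gone, the coefficient of
    \<open>X ^ (j + k)\<close> is \<open>- 2 * y k\<close>.\<close>
  ultimately have "y j = 0" using c0[of "2 * j"] by simp
  then have "(\<Sum>l<e. if 2 * l = j + k then y j else 0) = 0" by (intro sum.neutral) auto
  then show ?thesis using c0[of "j + k"] k by simp
qed

section \<open>Euler's dual basis for the powers of a root\<close>

lemma poly_pderiv_altdef:
  fixes f :: "complex poly"
  shows "poly (pderiv f) x = (\<Sum>b\<le>degree f. coeff f b * (of_nat b * x ^ (b - 1)))"
proof -
  have pd: "pderiv (sum g A) = (\<Sum>x\<in>A. pderiv (g x))" for g :: "nat \<Rightarrow> complex poly" and A
    by (induction A rule: infinite_finite_induct) (auto simp: pderiv_add)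
  have "pderiv f = pderiv (\<Sum>b\<le>degree f. monom (coeff f b) b)"
    by (simp add: poly_as_sum_of_monoms)
  also have "\<dots> = (\<Sum>b\<le>degree f. monom (of_nat b * coeff f b) (b - 1))"
    by (simp add: pd pderiv_monom)
  finally show ?thesis by (simp add: poly_sum poly_monom mult_ac)
qed

text \<open>The left side is \<open>(f(m) - f(l)) / (m - l)\<close> written without division, which
  becomes the derivative for \<open>l = m\<close>.\<close>

lemma poly_divided_difference:
  fixes f :: "complex poly"
  assumes "poly f l = 0" "poly f m = 0"
  shows "(\<Sum>b\<le>degree f. coeff f b * (\<Sum>a<b. m ^ a * l ^ (b - 1 - a))) =
    (if l = m then poly (pderiv f) l else 0)"
proof (cases "l = m")
  case True
  have "(\<Sum>a<b. m ^ a * m ^ (b - 1 - a)) = of_nat b * m ^ (b - 1)" for b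
    by (simp flip: power_add)
  then show ?thesis using True by (simp add: poly_pderiv_altdef)
next
  case False
  have *: "(\<Sum>a<b. m ^ a * l ^ (b - 1 - a)) * (m - l) = m ^ b - l ^ b" for b
    by (cases b) (simp_all add: diff_power_eq_sum mult_ac lessThan_Suc_atMost del: sum.lessThan_Suc power_Suc)
  have "(\<Sum>b\<le>degree f. coeff f b * (\<Sum>a<b. m ^ a * l ^ (b - 1 - a))) * (m - l) =
     (\<Sum>b\<le>degree f. coeff f b * (m ^ b - l ^ b))"
    by (subst sum_distrib_right) (simp only: mult.assoc *)
  also have "\<dots> = poly f m - poly f l"
    by (simp add: poly_altdef sum_subtractf right_diff_distrib)
  finally show ?thesis using False assms by simp
qed

text \<open>Inverts the power sums \<open>N a\<close>: the divided differences are orthogonal on the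
  roots. If the \<open>N a\<close> and the coefficients of \<open>f\<close> are integers, the left
  side lies in \<open>\<int>[l]\<close>, so the formula bounds the denominators of
  \<open>y l\<close> by \<open>f'(l)\<close>.\<close>

lemma power_sum_dual_eval:
  fixes f :: "complex poly"
  assumes "finite R" "\<And>m. m \<in> R \<Longrightarrow> poly f m = 0" "l \<in> R"
    and N: "\<And>a. a < degree f \<Longrightarrow> N a = (\<Sum>m\<in>R. m ^ a * y m)"
  shows "(\<Sum>b\<le>degree f. coeff f b * (\<Sum>a<b. N a * l ^ (b - 1 - a))) = y l * poly (pderiv f) l"
proof -
  have "(\<Sum>b\<le>degree f. coeff f b * (\<Sum>a<b. N a * l ^ (b - 1 - a))) =
     (\<Sum>b\<le>degree f. \<Sum>m\<in>R. y m * (coeff f b * (\<Sum>a<b. m ^ a * l ^ (b - 1 - a))))"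
  proof (intro sum.cong refl)
    fix b assume b: "b \<in> {..degree f}"
    have "(\<Sum>a<b. N a * l ^ (b - 1 - a)) = (\<Sum>a<b. \<Sum>m\<in>R. m ^ a * y m * l ^ (b - 1 - a))"
      using b N by (intro sum.cong refl) (simp add: sum_distrib_right)
    also have "\<dots> = (\<Sum>m\<in>R. \<Sum>a<b. m ^ a * y m * l ^ (b - 1 - a))" by (rule sum.swap)
    finally show "coeff f b * (\<Sum>a<b. N a * l ^ (b - 1 - a)) =
        (\<Sum>m\<in>R. y m * (coeff f b * (\<Sum>a<b. m ^ a * l ^ (b - 1 - a))))"
      by (simp add: sum_distrib_left mult_ac)
  qed
  also have "\<dots> = (\<Sum>m\<in>R. y m * (\<Sum>b\<le>degree f. coeff f b * (\<Sum>a<b. m ^ a * l ^ (b - 1 - a))))"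
    by (subst sum.swap) (simp add: sum_distrib_left)
  also have "\<dots> = (\<Sum>m\<in>R. if l = m then y l * poly (pderiv f) l else 0)"
    using assms by (intro sum.cong refl) (subst poly_divided_difference, auto)
  finally show ?thesis using assms by simp
qed

section \<open>Spectrum and rational minimal polynomial\<close>

lemma det_hom:
  fixes h :: "'a::comm_ring_1 \<Rightarrow> 'b::comm_ring_1" and M :: "'a^'n^'n"
  assumes h: "\<And>x y. h (x + y) = h x + h y" "\<And>x y. h (x * y) = h x * h y" "h 1 = 1"
  shows "h (det M) = det (\<chi> i j. h (M $ i $ j))"
proof -
  have h0: "h 0 = 0" using h(1)[of 0 0] by simp
  have "h (- 1) = - 1" using h(1)[of "- 1" 1] h0 h(3) by (simp add: eq_neg_iff_add_eq_0)
  then have sg: "h (of_int (sign p)) = of_int (sign p)" for p :: "'n \<Rightarrow> 'n"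
    by (simp add: sign_def h(3))
  have s: "h (sum g S) = (\<Sum>x\<in>S. h (g x))" for g and S :: "('n \<Rightarrow> 'n) set"
    by (induction S rule: infinite_finite_induct) (auto simp: h h0)
  have p: "h (prod g S) = (\<Prod>x\<in>S. h (g x))" for g and S :: "'n set"
    by (induction S rule: infinite_finite_induct) (auto simp: h)
  show ?thesis by (simp add: det_def s p h(2) sg)
qed

lemma poly_det:
  fixes M :: "'a::comm_ring_1 poly^'n^'n"
  shows "poly (det M) x = det (\<chi> i j. poly (M $ i $ j) x)"
  by (rule det_hom) simp_all

definition char_matrix :: "complex^'n^'n \<Rightarrow> complex poly^'n^'n" where
  "char_matrix M = (\<chi> i j. (if i = j then [:0, 1:] else 0) - [:M $ i $ j:])"

lemma char_poly_c_char_matrix: "char_poly_c A = det (char_matrix (cmat A))"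
  by (simp add: char_poly_c_def char_matrix_def cmat_def)

lemma poly_det_char_matrix: "poly (det (char_matrix M)) z = det (mat z - M)"
  unfolding poly_det by (rule arg_cong[where f = det]) (simp add: vec_eq_iff char_matrix_def mat_def)

lemma det_char_matrix_conjugate:
  fixes P Q M :: "complex^'n^'n"
  assumes "Q ** P = mat 1"
  shows "det (char_matrix (Q ** M ** P)) = det (char_matrix M)"
proof -
  have "poly (det (char_matrix (Q ** M ** P))) z = poly (det (char_matrix M)) z" for z
  proof -
    have "Q ** mat z = (\<chi> i j. z * Q $ i $ j)"
      by (simp add: vec_eq_iff matrix_matrix_mult_def mat_def if_distrib[of "\<lambda>x. _ * x"] cong: if_cong)
    then have "(Q ** mat z ** P) $ i $ j = z * (Q ** P) $ i $ j" for i j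
      by (simp add: matrix_matrix_mult_def sum_distrib_left mult_ac)
    then have "Q ** mat z ** P = mat z" unfolding assms by (simp add: vec_eq_iff mat_def)
    moreover have "Q ** (mat z - M) ** P = Q ** mat z ** P - Q ** M ** P"
      by (simp add: vec_eq_iff matrix_matrix_mult_def algebra_simps sum_subtractf sum_distrib_left)
    ultimately have "mat z - Q ** M ** P = Q ** (mat z - M) ** P" by simp
    moreover have "det Q * det P = 1" using assms by (metis det_I det_mul)
    ultimately show ?thesis by (simp add: poly_det_char_matrix det_mul)
  qed
  then show ?thesis by (simp add: poly_eq_poly_eq_iff[symmetric] fun_eq_iff)
qed

lemma det_char_matrix_diagonal:
  "det (char_matrix (\<chi> i j. if i = j then d i else 0)) = (\<Prod>i\<in>UNIV. [:- d i, 1:])"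
proof -
  have "det (char_matrix (\<chi> i j. if i = j then d i else 0)) =
    (\<Prod>i\<in>UNIV. char_matrix (\<chi> i j. if i = j then d i else 0) $ i $ i)"
    by (rule det_diagonal) (simp add: char_matrix_def)
  then show ?thesis by (simp add: char_matrix_def)
qed

lemma order_prod_linear:
  "order z (\<Prod>i\<in>A. [:- d i, 1:]) = card {i\<in>A. d i = (z::complex)}" if "finite A"
  using that
proof (induction A rule: finite_induct)
  case (insert x A)
  have "order z [:- d x, 1:] = (if d x = z then 1 else 0)"
    using order_power_n_n[of z 1] by (auto simp: order_0I)
  moreover have "{i \<in> insert x A. d i = z} = (if d x = z then insert x {i \<in> A. d i = z} else {i \<in> A. d i = z})"
    by auto
  moreover have "[:- d x, 1:] * (\<Prod>i\<in>A. [:- d i, 1:]) \<noteq> 0"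
    using insert(1) by (simp del: mult_pCons_left)
  ultimately show ?case using insert by (simp add: order_mult del: mult_pCons_left)
qed auto

definition diagonalized_by :: "real^'n^'n \<Rightarrow> complex^'n^'n \<Rightarrow> complex^'n^'n \<Rightarrow> ('n \<Rightarrow> complex) \<Rightarrow> bool" where
  "diagonalized_by A P Q d \<longleftrightarrow> P ** Q = mat 1 \<and> Q ** P = mat 1 \<and>
     Q ** cmat A ** P = (\<chi> i j. if i = j then d i else 0)"

lemma diagonalized_by_char_poly:
  assumes "diagonalized_by A P Q d"
  shows "char_poly_c A = (\<Prod>i\<in>UNIV. [:- d i, 1:])"
  using det_char_matrix_conjugate[of Q P "cmat A"] assms
  by (simp add: diagonalized_by_def char_poly_c_char_matrix det_char_matrix_diagonal)

lemma diagonalized_by_alg_mult: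
  assumes "diagonalized_by A P Q d"
  shows "alg_mult A z = card {i. d i = z}"
  using order_prod_linear[of UNIV z d]
  by (simp add: alg_mult_def diagonalized_by_char_poly[OF assms])

lemma diagonalized_by_eigenvalue:
  assumes "diagonalized_by A P Q d"
  shows "is_eigenvalue A z \<longleftrightarrow> z \<in> range d"
  by (auto simp: is_eigenvalue_def diagonalized_by_char_poly[OF assms] poly_prod)

text \<open>The characteristic polynomial has real coefficients, so conjugating coefficients fixes
  it and carries powers of \<open>X - w\<close> dividing it to powers of
  \<open>X - cnj w\<close>.\<close>

lemma alg_mult_cnj:
  fixes A :: "real^'n^'n"
  shows "alg_mult A (cnj z) = alg_mult A z"
proof -
  define p where "p = det (\<chi> i j. (if i = j then [:0, 1:] else 0) - [:A $ i $ j:] :: real poly^'n^'n)"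
  have c: "char_poly_c A = map_poly of_real p"
  proof -
    have "map_poly complex_of_real p = det (\<chi> i j. map_poly of_real
        ((\<chi> i j. (if i = j then [:0, 1:] else 0) - [:A $ i $ j:]) $ i $ j))"
      unfolding p_def by (rule det_hom) (auto intro: map_poly_hom_add map_poly_hom_mult)
    also have "\<dots> = char_poly_c A"
      unfolding char_poly_c_def
      by (rule arg_cong[where f = det])
         (auto simp: vec_eq_iff poly_eq_iff coeff_map_poly coeff_pCons split: nat.splits)
    finally show ?thesis by simp
  qed
  have cj: "map_poly cnj (char_poly_c A) = char_poly_c A"
    unfolding c by (intro poly_eqI) (simp add: coeff_map_poly)
  have m: "map_poly cnj (x * y) = map_poly cnj x * map_poly cnj y" for x y
    by (rule map_poly_hom_mult) auto
  have pw: "map_poly cnj (x ^ n) = map_poly cnj x ^ n" for x n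
    by (induction n) (simp_all add: m)
  have dv: "[:- cnj w, 1:] ^ n dvd char_poly_c A" if dv: "[:- w, 1:] ^ n dvd char_poly_c A" for w n
  proof -
    obtain h where "char_poly_c A = [:- w, 1:] ^ n * h" using dv by (rule dvdE)
    then have "map_poly cnj (char_poly_c A) = map_poly cnj ([:- w, 1:] ^ n * h)" by simp
    then have "char_poly_c A = [:- cnj w, 1:] ^ n * map_poly cnj h"
      by (simp add: cj m pw map_poly_pCons)
    then show ?thesis by simp
  qed
  have "[:- cnj w, 1:] ^ n dvd char_poly_c A \<longleftrightarrow> [:- w, 1:] ^ n dvd char_poly_c A" for w n
    using dv[of w n] dv[of "cnj w" n] by auto
  then show ?thesis unfolding alg_mult_def order_def by (simp only:)
qed

lemma cmat_mult: "cmat (A ** B) = cmat A ** cmat B"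
  by (simp add: cmat_def matrix_matrix_mult_def vec_eq_iff)

lemma cmat_mat_pow:
  fixes A :: "real^'n^'n"
  assumes "diagonalized_by A P Q d"
  shows "cmat (mat_pow A k) = P ** (\<chi> i j. if i = j then d i ^ k else 0) ** Q"
proof (induction k)
  case 0
  have "cmat (mat_pow A 0) = mat 1" by (simp add: mat_pow_def cmat_def mat_def vec_eq_iff)
  moreover have "(\<chi> i j. if i = j then d i ^ 0 else 0) = (mat 1 :: complex^'n^'n)"
    by (simp add: mat_def vec_eq_iff)
  ultimately show ?case using assms by (simp add: diagonalized_by_def)
next
  case (Suc k)
  let ?D = "\<lambda>k. (\<chi> i j. if i = j then d i ^ k else 0) :: complex^'n^'n"
  have D: "(\<chi> i j. if i = j then d i else 0) ** ?D k = ?D (Suc k)"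
    by (simp add: matrix_matrix_mult_def vec_eq_iff if_distrib[of "\<lambda>x. x * _"] cong: if_cong)
  have "cmat A = (P ** Q) ** cmat A ** (P ** Q)"
    using assms by (simp add: diagonalized_by_def)
  also have "\<dots> = P ** (Q ** cmat A ** P) ** Q" by (simp only: matrix_mul_assoc)
  finally have A: "cmat A = P ** (\<chi> i j. if i = j then d i else 0) ** Q"
    using assms by (simp add: diagonalized_by_def)
  have "cmat (mat_pow A (Suc k)) = cmat A ** cmat (mat_pow A k)"
    by (simp add: mat_pow_def cmat_mult)
  also have "\<dots> = P ** (\<chi> i j. if i = j then d i else 0) ** (Q ** P) ** ?D k ** Q"
    unfolding Suc by (subst A) (simp only: matrix_mul_assoc)
  also have "\<dots> = P ** ((\<chi> i j. if i = j then d i else 0) ** ?D k) ** Q"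
    using assms by (simp add: diagonalized_by_def matrix_mul_assoc)
  finally show ?case unfolding D .
qed

lemma of_real_of_rat: "complex_of_real (of_rat r) = of_rat r"
  by (induction r) (simp add: of_rat_rat)

text \<open>\<open>p(A)\<close> is \<open>P diag(p(d\<^sub>i)) Q\<close> with \<open>P\<close> and
  \<open>Q\<close> invertible. Annihilating \<open>A\<close> thus becomes vanishing at all
  eigenvalues.\<close>

lemma poly_mat_rat_eq_0_iff:
  fixes A :: "real^'n^'n"
  assumes "diagonalized_by A P Q d"
  shows "poly_mat_rat p A = 0 \<longleftrightarrow> (\<forall>i. poly (rpoly p) (d i) = 0)"
proof -
  let ?D = "\<lambda>g. (\<chi> i j. if i = j then g i else 0) :: complex^'n^'n"
  have entry: "(P ** ?D g ** Q) $ a $ b = (\<Sum>i\<in>UNIV. P $ a $ i * g i * Q $ i $ b)" for g a b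
    by (simp add: matrix_matrix_mult_def if_distrib[of "\<lambda>x. _ * x"] cong: if_cong)
  have c: "cmat (poly_mat_rat p A) = P ** ?D (\<lambda>i. poly (rpoly p) (d i)) ** Q"
  proof -
    have "cmat (poly_mat_rat p A) $ a $ b = (\<Sum>k\<le>degree p. of_rat (coeff p k) * cmat (mat_pow A k) $ a $ b)" for a b
      by (simp add: poly_mat_rat_def cmat_def of_real_of_rat)
    also have "\<dots> a b = (\<Sum>k\<le>degree p. \<Sum>i\<in>UNIV. of_rat (coeff p k) * (P $ a $ i * d i ^ k * Q $ i $ b))" for a b
      unfolding cmat_mat_pow[OF assms] entry by (simp add: sum_distrib_left)
    also have "\<dots> a b = (\<Sum>i\<in>UNIV. P $ a $ i * poly (rpoly p) (d i) * Q $ i $ b)" for a b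
      by (subst sum.swap) (simp add: poly_altdef sum_distrib_left sum_distrib_right mult_ac)
    finally show ?thesis unfolding vec_eq_iff entry by simp
  qed
  have "poly_mat_rat p A = 0 \<longleftrightarrow> cmat (poly_mat_rat p A) = 0"
    by (simp add: cmat_def vec_eq_iff)
  also have "\<dots> \<longleftrightarrow> ?D (\<lambda>i. poly (rpoly p) (d i)) = 0"
  proof
    assume "cmat (poly_mat_rat p A) = 0"
    then have "Q ** (P ** ?D (\<lambda>i. poly (rpoly p) (d i)) ** Q) ** P = Q ** 0 ** P" using c by simp
    also have "Q ** 0 ** P = 0" by (simp add: matrix_matrix_mult_def vec_eq_iff)
    also have "Q ** (P ** ?D (\<lambda>i. poly (rpoly p) (d i)) ** Q) ** P =
       (Q ** P) ** ?D (\<lambda>i. poly (rpoly p) (d i)) ** (Q ** P)" by (simp only: matrix_mul_assoc)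
    finally show "?D (\<lambda>i. poly (rpoly p) (d i)) = 0"
      using assms by (simp add: diagonalized_by_def)
  next
    assume "?D (\<lambda>i. poly (rpoly p) (d i)) = 0"
    then show "cmat (poly_mat_rat p A) = 0"
      unfolding c by (simp add: matrix_matrix_mult_def vec_eq_iff)
  qed
  also have "\<dots> \<longleftrightarrow> (\<forall>i. poly (rpoly p) (d i) = 0)"
    by (auto simp: vec_eq_iff)
  finally show ?thesis .
qed

text \<open>The definite description has to be shown well defined. Monic integer polynomials for the
  single eigenvalues multiply to an annihilating polynomial, so one of least degree exists.\<close>

lemma min_poly_Q_spec:
  fixes A :: "real^'n^'n"
  assumes D: "diagonalized_by A P Q d" and int: "\<And>i. algebraic_integer (d i)"
  shows "lead_coeff (min_poly_Q A) = 1"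
    and "\<And>i. poly (rpoly (min_poly_Q A)) (d i) = 0"
    and "\<And>q. lead_coeff q = 1 \<Longrightarrow> (\<forall>i. poly (rpoly q) (d i) = 0) \<Longrightarrow> degree (min_poly_Q A) \<le> degree q"
    and "\<exists>Z. lead_coeff Z = 1 \<and> (\<forall>i. poly (zpoly Z) (d i) = 0)"
proof -
  have "\<forall>i. \<exists>p. lead_coeff p = 1 \<and> poly (zpoly p) (d i) = 0"
    using int unfolding algebraic_integer_def by blast
  then obtain z where z: "\<And>i. lead_coeff (z i) = 1" "\<And>i. poly (zpoly (z i)) (d i) = 0" by metis
  define Z where "Z = (\<Prod>i\<in>UNIV. z i)"
  have lZ: "lead_coeff Z = 1" unfolding Z_def lead_coeff_prod by (simp add: z)
  have rZ: "poly (zpoly Z) (d i) = 0" for i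
  proof -
    have "Z = z i * (\<Prod>i\<in>UNIV - {i}. z i)" unfolding Z_def by (rule prod.remove) auto
    then show ?thesis using z(2) by simp
  qed
  show "\<exists>Z. lead_coeff Z = 1 \<and> (\<forall>i. poly (zpoly Z) (d i) = 0)" using lZ rZ by blast
  define ann where "ann p \<longleftrightarrow> lead_coeff p = 1 \<and> (\<forall>i. poly (rpoly p) (d i) = 0)" for p
  have "ann (zrpoly Z)" using lZ rZ by (simp add: ann_def)
  define p where "p = arg_min degree ann"
  have p: "ann p" "\<And>q. ann q \<Longrightarrow> degree p \<le> degree q"
    using arg_min_nat_lemma[of ann "zrpoly Z" degree] \<open>ann (zrpoly Z)\<close> unfolding p_def by auto
  have uniq: "q = p" if q: "ann q" "\<And>q'. ann q' \<Longrightarrow> degree q \<le> degree q'" for q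
  proof (rule ccontr)
    assume "q \<noteq> p"
    \<comment> \<open>Two different monic polynomials of least degree would differ by an
      annihilating polynomial of smaller degree; \<open>r\<close> is its monic multiple.\<close>
    define r where "r = smult (inverse (lead_coeff (q - p))) (q - p)"
    have deg: "degree q = degree p" using p q by (simp add: antisym)
    have "coeff (q - p) (degree p) = 0" using p(1) q(1) deg by (simp add: ann_def)
    moreover have "degree (q - p) \<le> degree p" using deg by (simp add: degree_diff_le)
    ultimately have "degree (q - p) < degree p"
      using \<open>q \<noteq> p\<close> by (metis eq_zero_or_degree_less right_minus_eq leading_coeff_0_iff le_neq_implies_less)
    moreover have "q - p \<noteq> 0" using \<open>q \<noteq> p\<close> by simp
    then have "lead_coeff (q - p) \<noteq> 0" by (simp only: leading_coeff_0_iff not_False_eq_True)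
    then have "ann r" using p(1) q(1) by (simp add: ann_def r_def del: coeff_diff)
    then have "degree p \<le> degree r" using p(2) by blast
    ultimately show False by (simp add: r_def split: if_splits)
  qed
  have "min_poly_Q A = (THE p. ann p \<and> (\<forall>q. ann q \<longrightarrow> degree p \<le> degree q))"
    unfolding min_poly_Q_def poly_mat_rat_eq_0_iff[OF D] ann_def by (simp only: conj_assoc)
  also have "\<dots> = p"
  proof (rule the_equality)
    show "ann p \<and> (\<forall>q. ann q \<longrightarrow> degree p \<le> degree q)" using p by blast
    show "q = p" if "ann q \<and> (\<forall>q'. ann q' \<longrightarrow> degree q \<le> degree q')" for q
      using uniq[of q] that by blast
  qed
  finally have "min_poly_Q A = p" .
  then show "lead_coeff (min_poly_Q A) = 1" "\<And>i. poly (rpoly (min_poly_Q A)) (d i) = 0"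
     "\<And>q. lead_coeff q = 1 \<Longrightarrow> (\<forall>i. poly (rpoly q) (d i) = 0) \<Longrightarrow> degree (min_poly_Q A) \<le> degree q"
    using p by (auto simp: ann_def)
qed

lemma monic_prime_factor:
  fixes f m :: "rat poly"
  assumes "f \<in> prime_factors m"
  shows "irreducible f" "lead_coeff f = 1"
proof -
  have pf: "prime f" using assms by auto
  then show irr: "irreducible f" by (simp add: prime_elem_imp_irreducible)
  have "f \<noteq> 0" using irr by auto
  have "lead_coeff f = coeff (normalize f) (degree f)" using pf by simp
  also have "\<dots> = lead_coeff f div unit_factor (lead_coeff f)" by (rule coeff_normalize)
  also have "\<dots> = 1" using \<open>f \<noteq> 0\<close> by simp
  finally show "lead_coeff f = 1" .
qed

text \<open>A factor without eigenvalues among its roots could be cancelled, leaving an annihilating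
  polynomial of smaller degree. Integrality follows since \<open>f\<close> divides the monic integer
  polynomial killing one of its roots.\<close>

lemma min_poly_Q_prime_factor:
  fixes A :: "real^'n^'n"
  assumes D: "diagonalized_by A P Q d" and int: "\<And>i. algebraic_integer (d i)"
    and f: "f \<in> prime_factors (min_poly_Q A)"
  shows "\<exists>i. d i \<in> roots_Q f"
    and "\<exists>F. f = zrpoly F \<and> lead_coeff F = 1"
proof -
  note mp = min_poly_Q_spec[OF D int]
  note ff = monic_prime_factor[OF f]
  obtain h where h: "min_poly_Q A = f * h" using f by (auto elim: dvdE)
  have h0: "h \<noteq> 0" "f \<noteq> 0" using mp(1) h by auto
  have lh: "lead_coeff h = 1" using mp(1) ff(2) unfolding h by (simp add: lead_coeff_mult)
  show ex: "\<exists>i. d i \<in> roots_Q f"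
  proof (rule ccontr)
    assume "\<nexists>i. d i \<in> roots_Q f"
    then have "\<forall>i. poly (rpoly h) (d i) = 0" using mp(2) unfolding h by (auto simp: roots_Q_def)
    then have "degree (min_poly_Q A) \<le> degree h" using mp(3) lh by blast
    then show False using h h0 irreducible_rat_degree_pos[OF ff(1)] by (simp add: degree_mult_eq)
  qed
  then obtain i where i: "poly (rpoly f) (d i) = 0" by (auto simp: roots_Q_def)
  obtain Z where Z: "lead_coeff Z = 1" "poly (zpoly Z) (d i) = 0" using mp(4) by blast
  then have "f dvd zrpoly Z"
    using irreducible_rat_root_dvd_iff[OF ff(1) i, of "zrpoly Z"] by simp
  then show "\<exists>F. f = zrpoly F \<and> lead_coeff F = 1"
    using monic_rat_factor_integral[OF ff(2) _ Z(1)] by metis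
qed

lemma eigenvalue_root_of_prime_factor:
  fixes A :: "real^'n^'n"
  assumes D: "diagonalized_by A P Q d" and int: "\<And>i. algebraic_integer (d i)"
  shows "\<exists>f\<in>prime_factors (min_poly_Q A). d i \<in> roots_Q f"
proof -
  note mp = min_poly_Q_spec[OF D int]
  define m where "m = min_poly_Q A"
  have m0: "m \<noteq> 0" using mp(1) unfolding m_def by auto
  have "\<exists>f\<in>prime_factors m. poly (rpoly f) z = 0" if "poly (rpoly (prod_mset M)) z = 0" "set_mset M \<subseteq> prime_factors m" for M z
    using that by (induction M) auto
  moreover have "poly (rpoly (prod_mset (prime_factorization m))) (d i) = 0"
  proof -
    have "normalize (prod_mset (prime_factorization m)) = normalize m"
      using m0 by (rule prod_mset_prime_factorization_weak)
    then have "m dvd prod_mset (prime_factorization m)" by (metis associatedD1)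
    then obtain k where "prod_mset (prime_factorization m) = m * k" ..
    then show ?thesis using mp(2)[of i] by (simp add: m_def)
  qed
  ultimately show ?thesis unfolding m_def roots_Q_def by blast
qed

section \<open>Multiplicities on the factors of the minimal polynomial\<close>

text \<open>The quotient \<open>s\<^sub>i / d\<^sub>i\<close>: the number of copies of
  \<open>\<int>[X]/(f)\<close> in the lattice.\<close>

definition factor_mult :: "real^'n^'n \<Rightarrow> rat poly \<Rightarrow> nat" where
  "factor_mult A f = (if is_cyclotomic f \<and> \<not> M_max A f > M_min A f then M_max A f + 1 else M_max A f)"

lemma s_factor_eq: "s_factor A f = factor_mult A f * degree f"
  by (simp add: s_factor_def factor_mult_def)

locale eigen_setup =
  fixes A :: "real^'n^'n" and P Q :: "complex^'n^'n" and d :: "'n \<Rightarrow> complex"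
  assumes diag: "diagonalized_by A P Q d"
    and nonsing: "invertible A"
    and int: "algebraic_integer (d i)"
    and P2: "\<forall>\<mu> lam. is_eigenvalue A lam \<and> alg_conjugate \<mu> lam \<and> cmod \<mu> > 1 \<longrightarrow>
               is_eigenvalue A \<mu> \<and>
               (\<forall>\<nu>. alg_conjugate \<mu> \<nu> \<longrightarrow> alg_mult A \<mu> \<ge> alg_mult A \<nu>) \<and>
               (\<exists>\<nu>. alg_conjugate \<mu> \<nu> \<and> alg_mult A \<mu> > alg_mult A \<nu>)"
begin

abbreviation factors :: "rat poly set" where
  "factors \<equiv> prime_factors (min_poly_Q A)"

abbreviation mult :: "complex \<Rightarrow> nat" where
  "mult \<equiv> alg_mult A"

lemma mult_eq: "mult z = card {i. d i = z}"
  by (rule diagonalized_by_alg_mult[OF diag])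

lemma d_nonzero: "d i \<noteq> 0"
proof -
  obtain B where "A ** B = mat 1" using nonsing unfolding invertible_def by blast
  then have "cmat A ** cmat B = mat 1"
    unfolding cmat_mult[symmetric] by (simp add: cmat_def mat_def vec_eq_iff)
  moreover have PQ: "P ** Q = mat 1" "Q ** P = mat 1"
    and D: "Q ** cmat A ** P = (\<chi> i j. if i = j then d i else 0)"
    using diag by (simp_all add: diagonalized_by_def)
  have "(Q ** cmat A ** P) ** (Q ** cmat B ** P) = Q ** (cmat A ** (P ** Q) ** cmat B) ** P"
    by (simp only: matrix_mul_assoc)
  ultimately have "(Q ** cmat A ** P) ** (Q ** cmat B ** P) = mat 1"
    by (simp add: PQ)
  then have "((\<chi> i j. if i = j then d i else 0) ** (Q ** cmat B ** P)) $ i $ i = 1"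
    unfolding D by (simp add: mat_def)
  then show ?thesis by (auto simp: matrix_matrix_mult_def if_distrib[of "\<lambda>x. x * _"] cong: if_cong)
qed

lemma factor_irreducible: "f \<in> factors \<Longrightarrow> irreducible f"
  and factor_monic: "f \<in> factors \<Longrightarrow> lead_coeff f = 1"
  using monic_prime_factor by blast+

lemma factor_integral: "f \<in> factors \<Longrightarrow> \<exists>F. f = zrpoly F \<and> lead_coeff F = 1"
  and factor_eigenvalue: "f \<in> factors \<Longrightarrow> \<exists>i. d i \<in> roots_Q f"
  using min_poly_Q_prime_factor[OF diag int, of f] by metis+

lemma factor_unique:
  "f \<in> factors \<Longrightarrow> g \<in> factors \<Longrightarrow> z \<in> roots_Q f \<Longrightarrow> z \<in> roots_Q g \<Longrightarrow> f = g"
  by (rule irreducible_monic_roots_disjoint[of f g z]) (auto intro: factor_irreducible factor_monic)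

lemma factor_roots_finite: "f \<in> factors \<Longrightarrow> finite (roots_Q f)"
  by (rule roots_Q_finite) (metis factor_irreducible not_irreducible_zero)

lemma factor_roots_nonzero:
  assumes "f \<in> factors" "z \<in> roots_Q f"
  shows "z \<noteq> 0"
proof
  assume "z = 0"
  obtain i where i: "d i \<in> roots_Q f" using factor_eigenvalue assms(1) by blast
  have "poly (rpoly [:0, 1:]) (d i) = 0"
    using irreducible_rat_conj_root[OF factor_irreducible[OF assms(1)], of z "d i" "[:0, 1:]"]
      assms(2) i \<open>z = 0\<close> by (simp add: roots_Q_def)
  then show False using d_nonzero by simp
qed

lemma roots_Q_cnj: "z \<in> roots_Q f \<Longrightarrow> cnj z \<in> roots_Q f"
proof -
  assume "z \<in> roots_Q f"
  moreover have "coeff (rpoly f) n \<in> \<real>" for n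
    by (simp flip: of_real_of_rat)
  ultimately show "cnj z \<in> roots_Q f"
    unfolding roots_Q_def mem_Collect_eq by (subst real_poly_cnj_root_iff) auto
qed

lemma mult_le_M_max: "f \<in> factors \<Longrightarrow> z \<in> roots_Q f \<Longrightarrow> mult z \<le> M_max A f"
  unfolding M_max_def using factor_roots_finite by (intro Max_ge) auto

lemma M_min_le_mult: "f \<in> factors \<Longrightarrow> z \<in> roots_Q f \<Longrightarrow> M_min A f \<le> mult z"
  unfolding M_min_def using factor_roots_finite by (intro Min_le) auto

lemma mult_le_factor_mult: "f \<in> factors \<Longrightarrow> z \<in> roots_Q f \<Longrightarrow> mult z \<le> factor_mult A f"
  using mult_le_M_max unfolding factor_mult_def by fastforce

lemma factor_eigenvalue_root:
  assumes "f \<in> factors"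
  shows "\<exists>z\<in>roots_Q f. mult z > 0"
proof -
  obtain i where "d i \<in> roots_Q f" using factor_eigenvalue assms by blast
  moreover have "mult (d i) > 0" unfolding mult_eq by (auto simp: card_gt_0_iff)
  ultimately show ?thesis by blast
qed

lemma alg_conjugate_factor_root:
  assumes "f \<in> factors" "z \<in> roots_Q f"
  shows "alg_conjugate z w \<longleftrightarrow> w \<in> roots_Q f"
proof
  assume "alg_conjugate z w"
  then show "w \<in> roots_Q f"
    using irreducible_rat_conj_root assms unfolding alg_conjugate_def roots_Q_def by blast
next
  assume "w \<in> roots_Q f"
  then show "alg_conjugate z w"
    using assms factor_irreducible unfolding alg_conjugate_def roots_Q_def by blast
qed

lemma expanding_root:
  assumes f: "f \<in> factors" and z: "z \<in> roots_Q f" "cmod z > 1"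
  shows "mult z = M_max A f" "M_min A f < M_max A f"
proof -
  obtain i where i: "d i \<in> roots_Q f" using factor_eigenvalue f by blast
  have "is_eigenvalue A (d i)" by (simp add: diagonalized_by_eigenvalue[OF diag])
  moreover have "alg_conjugate z (d i)" using alg_conjugate_factor_root[OF f z(1)] i by blast
  ultimately have *: "\<forall>\<nu>. alg_conjugate z \<nu> \<longrightarrow> mult z \<ge> mult \<nu>"
    "\<exists>\<nu>. alg_conjugate z \<nu> \<and> mult z > mult \<nu>"
    using P2 z(2) by blast+
  have "M_max A f \<in> mult ` roots_Q f"
    unfolding M_max_def using factor_roots_finite[OF f] z(1) by (intro Max_in) auto
  then show mx: "mult z = M_max A f"
    using *(1) mult_le_M_max[OF f z(1)] alg_conjugate_factor_root[OF f z(1)] by (auto intro: antisym)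
  obtain w where "w \<in> roots_Q f" "mult w < mult z"
    using *(2) alg_conjugate_factor_root[OF f z(1)] by blast
  then show "M_min A f < M_max A f" using M_min_le_mult[OF f] mx by fastforce
qed

lemma expanding_root_factor_mult:
  assumes f: "f \<in> factors" and z: "z \<in> roots_Q f" "cmod z > 1"
  shows "mult z = factor_mult A f"
  using expanding_root[OF assms] by (simp add: factor_mult_def)

text \<open>Every factor must leave at least one eigencoordinate to the window space: injectivity of
  \<open>pi_perp\<close> on the lattice and \<open>n < s\<close> both rest on it.\<close>

lemma deficient_root:
  assumes f: "f \<in> factors"
  shows "\<exists>z\<in>roots_Q f. mult z < factor_mult A f"
proof (rule ccontr)
  assume "\<not> ?thesis"
  then have eq: "mult z = factor_mult A f" if "z \<in> roots_Q f" for z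
    using mult_le_factor_mult[OF f that] that by (simp add: not_less antisym)
  obtain z where z: "z \<in> roots_Q f" using factor_eigenvalue f by blast
  have fm: "factor_mult A f = M_max A f"
    using eq[OF z] mult_le_M_max[OF f z] unfolding factor_mult_def by (auto split: if_splits)
  have "mult ` roots_Q f = {M_max A f}" using eq fm z by auto
  then have mm: "M_min A f = M_max A f" by (simp add: M_min_def)
  then have nc: "\<not> is_cyclotomic f" using fm by (auto simp: factor_mult_def)
  obtain F where F: "f = zrpoly F" "lead_coeff F = 1" using factor_integral f by blast
  have "\<exists>w\<in>roots_Q f. cmod w > 1"
  proof (rule ccontr)
    assume "\<not> ?thesis"
    then have "cmod w \<le> 1" if "w \<in> roots_Q f" for w using that by force
    then have "\<exists>n>0. z ^ n = 1"
      using kronecker_root_of_unity[OF F(2)] F factor_irreducible[OF f] z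
        factor_roots_nonzero[OF f z] by blast
    then show False
      using irreducible_root_of_unity_cyclotomic[OF F(2)] F factor_irreducible[OF f] z nc by blast
  qed
  then show False using expanding_root(2)[OF f] mm by auto
qed

definition all_roots :: "complex set" where
  "all_roots = (\<Union>f\<in>factors. roots_Q f)"

definition root_mult :: "complex \<Rightarrow> nat" where
  "root_mult z = factor_mult A (THE f. f \<in> factors \<and> z \<in> roots_Q f)"

lemma root_mult_eq:
  assumes "f \<in> factors" "z \<in> roots_Q f"
  shows "root_mult z = factor_mult A f"
proof -
  have "(THE f. f \<in> factors \<and> z \<in> roots_Q f) = f"
    using assms factor_unique by blast
  then show ?thesis by (simp add: root_mult_def)
qed

lemma all_roots_finite: "finite all_roots"
  unfolding all_roots_def using factor_roots_finite by auto

lemma d_in_all_roots: "d i \<in> all_roots"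
  using eigenvalue_root_of_prime_factor[OF diag int] unfolding all_roots_def by blast

lemma all_roots_cnj: "z \<in> all_roots \<Longrightarrow> cnj z \<in> all_roots"
  using roots_Q_cnj unfolding all_roots_def by blast

lemma root_mult_cnj: "z \<in> all_roots \<Longrightarrow> root_mult (cnj z) = root_mult z"
  using roots_Q_cnj root_mult_eq unfolding all_roots_def by fastforce

lemma mult_le_root_mult: "z \<in> all_roots \<Longrightarrow> mult z \<le> root_mult z"
  using mult_le_factor_mult root_mult_eq unfolding all_roots_def by fastforce

text \<open>The index set of the \<open>s\<close> eigenvalues (with multiplicity) of the integer matrix
  containing \<open>A\<close>, and the part of it belonging to \<open>A\<close> itself.\<close>
definition total_index :: "(complex \<times> nat) set" where
  "total_index = (SIGMA z:all_roots. {..<root_mult z})"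

definition par_index :: "(complex \<times> nat) set" where
  "par_index = (SIGMA z:all_roots. {..<mult z})"

lemma finite_total_index: "finite total_index"
  unfolding total_index_def using all_roots_finite by auto

lemma par_subset_total: "par_index \<subseteq> total_index"
  unfolding par_index_def total_index_def using mult_le_root_mult by fastforce

lemma sum_all_roots: "(\<Sum>z\<in>all_roots. g z) = (\<Sum>f\<in>factors. \<Sum>z\<in>roots_Q f. g z)"
  unfolding all_roots_def
  using factor_roots_finite factor_unique by (intro sum.UNION_disjoint) auto

lemma card_total_index: "card total_index = s_dim A"
proof -
  have "card total_index = (\<Sum>z\<in>all_roots. root_mult z)"
    unfolding total_index_def using all_roots_finite by (subst card_SigmaI) auto
  also have "\<dots> = (\<Sum>f\<in>factors. \<Sum>z\<in>roots_Q f. factor_mult A f)"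
    unfolding sum_all_roots using root_mult_eq by (intro sum.cong) auto
  also have "\<dots> = s_dim A"
    unfolding s_dim_def s_factor_eq using card_roots_Q factor_irreducible
    by (intro sum.cong) (auto simp: mult.commute)
  finally show ?thesis .
qed

text \<open>Numbering equal diagonal entries makes complex conjugation the involution
  \<open>(z, k)\<close> to \<open>(cnj z, k)\<close> on the coordinates of
  \<open>\<real>\<^sup>n\<close>.\<close>

lemma par_index_bij:
  "\<exists>\<alpha>. bij_betw \<alpha> (UNIV :: 'n set) par_index \<and> (\<forall>i. fst (\<alpha> i) = d i)"
proof -
  have "\<forall>z. \<exists>h. bij_betw h {i. d i = z} {..<mult z}"
    using ex_bij_betw_finite_nat unfolding mult_eq by (metis atLeast0LessThan finite)
  then obtain h where h: "\<And>z. bij_betw (h z) {i. d i = z} {..<mult z}" by metis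
  define \<alpha> where "\<alpha> i = (d i, h (d i) i)" for i
  have "inj \<alpha>"
  proof (rule injI)
    fix i j assume "\<alpha> i = \<alpha> j"
    then have "d i = d j" "h (d i) i = h (d i) j" by (auto simp: \<alpha>_def)
    then show "i = j" using h[of "d i"] by (auto simp: bij_betw_def inj_on_def)
  qed
  moreover have "range \<alpha> = par_index"
  proof (intro equalityI subsetI)
    fix x assume "x \<in> range \<alpha>"
    then obtain i where "x = \<alpha> i" by blast
    moreover have "h (d i) i \<in> {..<mult (d i)}" using h[of "d i"] by (auto simp: bij_betw_def)
    ultimately show "x \<in> par_index" using d_in_all_roots by (simp add: \<alpha>_def par_index_def)
  next
    fix x assume "x \<in> par_index"
    then obtain z k where x: "x = (z, k)" "k < mult z" unfolding par_index_def by auto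
    then have "k \<in> h z ` {i. d i = z}" using h[of z] by (auto simp: bij_betw_def)
    then show "x \<in> range \<alpha>" using x by (auto simp: \<alpha>_def)
  qed
  ultimately show ?thesis by (intro exI[of _ \<alpha>]) (auto simp: bij_betw_def \<alpha>_def)
qed

lemma card_par_index: "card par_index = CARD('n)"
  using par_index_bij bij_betw_same_card by metis

lemma par_psubset_total: "par_index \<subset> total_index"
proof -
  fix i :: 'n
  obtain f where f: "f \<in> factors" using d_in_all_roots[of i] unfolding all_roots_def by blast
  then obtain z where z: "z \<in> roots_Q f" "mult z < root_mult z"
    using deficient_root root_mult_eq by metis
  then have "(z, mult z) \<in> total_index - par_index"
    using f by (auto simp: total_index_def par_index_def all_roots_def)
  then show ?thesis using par_subset_total by blast
qed

lemma card_less_s_dim: "CARD('n) < s_dim A"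
  using psubset_card_mono[OF finite_total_index par_psubset_total]
  by (simp add: card_par_index card_total_index)

end

section \<open>Real similarity\<close>

text \<open>Real matrices that are similar over \<open>\<complex>\<close> are similar over \<open>\<real>\<close>: if \<open>X + \<i>Y\<close> intertwines
  them, so does \<open>X + tY\<close> for every real \<open>t\<close>, and its determinant is a nonzero polynomial in \<open>t\<close>.\<close>
lemma real_similar_of_complex_similar:
  fixes A D :: "real^'n^'n" and Z :: "complex^'n^'n"
  assumes Z: "det Z \<noteq> 0" and AZ: "cmat A ** Z = Z ** cmat D"
  shows "\<exists>S. invertible S \<and> A ** S = S ** D"
proof -
  define X where "X = (\<chi> i j. Re (Z $ i $ j))"
  define Y where "Y = (\<chi> i j. Im (Z $ i $ j))"
  have e: "(cmat A ** Z) $ i $ j = (Z ** cmat D) $ i $ j" for i j using AZ by simp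
  have AX: "A ** X = X ** D" and AY: "A ** Y = Y ** D"
    unfolding vec_eq_iff
    using arg_cong[OF e, of Re] arg_cong[OF e, of Im]
    by (simp_all add: matrix_matrix_mult_def cmat_def X_def Y_def)
  define p where "p = det (\<chi> i j. [:complex_of_real (Re (Z $ i $ j)), of_real (Im (Z $ i $ j)):])"
  have "poly p \<i> = det Z"
    unfolding p_def poly_det by (rule arg_cong[where f = det]) (simp add: vec_eq_iff complex_eq_iff)
  then have "p \<noteq> 0" using Z by auto
  then obtain t where t: "poly p (complex_of_real t) \<noteq> 0"
    using exists_real_avoiding_roots[of "range (coeff p)"] by auto
  define S where "S = (\<chi> i j. X $ i $ j + t * Y $ i $ j)"
  have "poly p (of_real t) = det (cmat S)"
    unfolding p_def poly_det
    by (rule arg_cong[where f = det]) (simp add: vec_eq_iff cmat_def S_def X_def Y_def)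
  also have "\<dots> = of_real (det S)" by (simp add: det_def cmat_def)
  finally have "det S \<noteq> 0" using t by auto
  then have "invertible S" by (simp add: invertible_det_nz)
  moreover have "A ** S = S ** D"
    unfolding vec_eq_iff
  proof (intro allI)
    fix i j
    have "(A ** S) $ i $ j = (A ** X) $ i $ j + t * (A ** Y) $ i $ j"
      by (simp add: matrix_matrix_mult_def S_def sum.distrib sum_distrib_left algebra_simps)
    also have "\<dots> = (S ** D) $ i $ j"
      unfolding AX AY
      by (simp add: matrix_matrix_mult_def S_def sum.distrib sum_distrib_left algebra_simps)
    finally show "(A ** S) $ i $ j = (S ** D) $ i $ j" .
  qed
  ultimately show ?thesis by blast
qed

text \<open>The diagonal matrix \<open>diag(d)\<close> in the real coordinates \<open>Re v + Im v\<close> on the real space of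
  vectors with \<open>v(\<sigma> i) = cnj (v i)\<close>.\<close>
definition conj_block :: "('m \<Rightarrow> 'm) \<Rightarrow> ('m \<Rightarrow> complex) \<Rightarrow> real^'m^'m" where
  "conj_block \<sigma> d = (\<chi> i j. (if j = i then Re (d i) else 0) + (if j = \<sigma> i then Im (d i) else 0))"

lemma conj_block_mult_vec:
  "(conj_block \<sigma> d *v x) $ i = Re (d i) * x $ i + Im (d i) * x $ (\<sigma> i)"
  by (simp add: conj_block_def matrix_vector_mult_def distrib_right sum.distrib
      if_distrib[of "\<lambda>x. x * _"] cong: if_cong)

lemma sum_if_mult:
  fixes g :: "'m::finite \<Rightarrow> 'b::comm_semiring_1"
  shows "(\<Sum>j\<in>UNIV. (if j = i then a else 0) * g j) = a * g i"
  by (simp add: if_distrib[of "\<lambda>x. x * _"] cong: if_cong)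

lemma diagonalized_real_similar_conj_block:
  fixes A :: "real^'n^'n"
  assumes diag: "diagonalized_by A P Q d"
    and \<sigma>: "\<And>i. \<sigma> (\<sigma> i) = i" "\<And>i. d (\<sigma> i) = cnj (d i)"
  shows "\<exists>S. invertible S \<and> A ** S = S ** conj_block \<sigma> d"
proof -
  \<comment> \<open>\<open>W\<close> recovers \<open>v\<close> from the real coordinates
    \<open>x i = Re (v i) + Im (v i)\<close>: since
    \<open>x (\<sigma> i) = Re (v i) - Im (v i)\<close>, one has
    \<open>v i = ((1 + \<i>) * x i + (1 - \<i>) * x (\<sigma> i)) / 2\<close>. \<open>W'\<close> is
    its inverse.\<close>
  define W where "W = (\<chi> i j. (if j = i then (1 + \<i>) / 2 else 0) + (if j = \<sigma> i then (1 - \<i>) / 2 else 0))"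
  define W' where "W' = (\<chi> i j. (if j = i then (1 - \<i>) / 2 else 0) + (if j = \<sigma> i then (1 + \<i>) / 2 else 0))"
  define Dd where "Dd = (\<chi> i j. if i = j then d i else 0)"
  have \<sigma>eq: "(l = \<sigma> (\<sigma> i)) = (l = i)" for l i using \<sigma>(1) by auto
  have "(W ** W') $ i $ l = mat 1 $ i $ l" for i l
  proof -
    have "(W ** W') $ i $ l = (1 + \<i>) / 2 * W' $ i $ l + (1 - \<i>) / 2 * W' $ (\<sigma> i) $ l"
      unfolding matrix_matrix_mult_def by (simp add: W_def distrib_right sum.distrib sum_if_mult)
    also have "\<dots> = mat 1 $ i $ l"
      by (auto simp: W'_def \<sigma>eq mat_def complex_eq_iff)
    finally show ?thesis .
  qed
  then have "W ** W' = mat 1" by (simp add: vec_eq_iff)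
  then have "det W \<noteq> 0" by (metis det_I det_mul mult_zero_left zero_neq_one)
  moreover have PQ: "P ** Q = mat 1" "Q ** cmat A ** P = Dd"
    using diag by (simp_all add: diagonalized_by_def Dd_def)
  moreover have "det P \<noteq> 0" using PQ(1) by (metis det_I det_mul mult_zero_left zero_neq_one)
  ultimately have "det (P ** W) \<noteq> 0" by (simp add: det_mul)
  moreover have "cmat A ** (P ** W) = (P ** W) ** cmat (conj_block \<sigma> d)"
  proof -
    have DW: "(Dd ** W) $ i $ l = (W ** cmat (conj_block \<sigma> d)) $ i $ l" for i l
    proof -
      have "(Dd ** W) $ i $ l = (\<Sum>j\<in>UNIV. (if j = i then d i else 0) * W $ j $ l)"
        unfolding matrix_matrix_mult_def by (simp add: Dd_def eq_commute)
      also have "\<dots> = d i * W $ i $ l" by (rule sum_if_mult)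
      finally have L: "(Dd ** W) $ i $ l = d i * W $ i $ l" .
      have "(W ** cmat (conj_block \<sigma> d)) $ i $ l =
          (1 + \<i>) / 2 * cmat (conj_block \<sigma> d) $ i $ l + (1 - \<i>) / 2 * cmat (conj_block \<sigma> d) $ (\<sigma> i) $ l"
        unfolding matrix_matrix_mult_def by (simp add: W_def distrib_right sum.distrib sum_if_mult)
      also have "\<dots> = d i * W $ i $ l"
        by (auto simp: W_def cmat_def conj_block_def \<sigma> \<sigma>eq complex_eq_iff field_simps)
      finally show ?thesis using L by simp
    qed
    have "cmat A ** P = (P ** Q) ** cmat A ** P" using PQ by simp
    also have "\<dots> = P ** Dd" unfolding PQ(2)[symmetric] by (simp only: matrix_mul_assoc)
    finally have "cmat A ** (P ** W) = P ** (Dd ** W)" by (simp only: matrix_mul_assoc)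
    also have "Dd ** W = W ** cmat (conj_block \<sigma> d)" using DW by (simp add: vec_eq_iff)
    finally show ?thesis by (simp only: matrix_mul_assoc)
  qed
  ultimately show ?thesis by (rule real_similar_of_complex_similar)
qed

text \<open>Reindexing by \<open>\<sigma>\<close> flips the sign of \<open>Im (d i)\<close>, so the
  cross terms cancel and the squared norm is the sum of
  \<open>(cmod (d i))\<^sup>2 * (x $ i)\<^sup>2\<close>. No adapted norm is required, and a
  Euclidean ball is an invariant window.\<close>

lemma conj_block_norm_le:
  fixes d :: "'m::finite \<Rightarrow> complex"
  assumes \<sigma>: "\<And>i. \<sigma> (\<sigma> i) = i" "\<And>i. d (\<sigma> i) = cnj (d i)" and bd: "\<And>i. cmod (d i) \<le> 1"
  shows "norm (conj_block \<sigma> d *v x) \<le> norm x"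
proof -
  have bij: "bij \<sigma>" by (metis \<sigma>(1) bij_betw_byWitness UNIV_I subsetI)
  let ?a = "\<lambda>i. Re (d i)" and ?b = "\<lambda>i. Im (d i)"
  have re: "(\<Sum>i\<in>UNIV. g (\<sigma> i)) = (\<Sum>i\<in>UNIV. g i)" for g :: "'m \<Rightarrow> real"
    using bij by (rule sum.reindex_bij_betw)
  have "(\<Sum>i\<in>UNIV. ?a i * ?b i * x $ i * x $ \<sigma> i) = (\<Sum>i\<in>UNIV. ?a (\<sigma> i) * ?b (\<sigma> i) * x $ \<sigma> i * x $ \<sigma> (\<sigma> i))"
    by (rule re[symmetric])
  also have "\<dots> = - (\<Sum>i\<in>UNIV. ?a i * ?b i * x $ i * x $ \<sigma> i)"
    by (simp add: \<sigma> sum_negf mult_ac)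
  finally have cross: "(\<Sum>i\<in>UNIV. ?a i * ?b i * x $ i * x $ \<sigma> i) = 0" by simp
  have "(\<Sum>i\<in>UNIV. (?b i)\<^sup>2 * (x $ \<sigma> i)\<^sup>2) = (\<Sum>i\<in>UNIV. (?b (\<sigma> i))\<^sup>2 * (x $ \<sigma> i)\<^sup>2)" by (simp add: \<sigma>)
  also have "\<dots> = (\<Sum>i\<in>UNIV. (?b i)\<^sup>2 * (x $ i)\<^sup>2)" by (rule re)
  finally have sq: "(\<Sum>i\<in>UNIV. (?b i)\<^sup>2 * (x $ \<sigma> i)\<^sup>2) = (\<Sum>i\<in>UNIV. (?b i)\<^sup>2 * (x $ i)\<^sup>2)" .
  have "(norm (conj_block \<sigma> d *v x))\<^sup>2 = (\<Sum>i\<in>UNIV. (?a i * x $ i + ?b i * x $ \<sigma> i)\<^sup>2)"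
    by (simp add: norm_vec_def L2_set_def sum_nonneg conj_block_mult_vec)
  also have "\<dots> = (\<Sum>i\<in>UNIV. (?a i)\<^sup>2 * (x $ i)\<^sup>2) + (\<Sum>i\<in>UNIV. (?b i)\<^sup>2 * (x $ \<sigma> i)\<^sup>2)
      + 2 * (\<Sum>i\<in>UNIV. ?a i * ?b i * x $ i * x $ \<sigma> i)"
    by (simp add: power2_sum power_mult_distrib sum.distrib sum_distrib_left mult_ac)
  also have "\<dots> = (\<Sum>i\<in>UNIV. (cmod (d i))\<^sup>2 * (x $ i)\<^sup>2)"
    unfolding cross sq by (simp add: cmod_power2 distrib_right sum.distrib)
  also have "\<dots> \<le> (\<Sum>i\<in>UNIV. (x $ i)\<^sup>2)"
    using bd by (intro sum_mono mult_left_le_one_le) (auto simp: power_le_one)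
  also have "\<dots> = (norm x)\<^sup>2"
    by (simp add: norm_vec_def L2_set_def sum_nonneg)
  finally show ?thesis by (simp add: power2_le_iff_abs_le)
qed

section \<open>Block matrices and polynomials acting on vectors\<close>

lemma map_sum_transpose_comp:
  "map_sum (Transposition.transpose a b \<circ> p) id = Transposition.transpose (Inl a) (Inl b) \<circ> map_sum p id"
  "map_sum id (Transposition.transpose a' b' \<circ> p') = Transposition.transpose (Inr a') (Inr b') \<circ> map_sum id p'"
  unfolding fun_eq_iff
  by (auto simp: Transposition.transpose_def map_sum_def split: sum.splits)

lemma permutation_map_sum:
  fixes p :: "'n::finite \<Rightarrow> 'n" and q :: "'p::finite \<Rightarrow> 'p"
  assumes "p permutes UNIV" "q permutes UNIV"
  shows "map_sum p q permutes UNIV"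
proof -
  have "bij p" "bij q" using assms by (auto intro: permutes_bij)
  have "inj (map_sum p q)"
  proof (rule injI)
    fix x y assume "map_sum p q x = map_sum p q y"
    then show "x = y" using \<open>bij p\<close> \<open>bij q\<close>
      by (cases x; cases y) (auto dest!: bij_is_inj simp: inj_eq)
  qed
  then have "bij (map_sum p q)" by (simp add: bij_def finite_UNIV_inj_surj)
  then show ?thesis by (rule bij_imp_permutes) simp
qed

text \<open>Induction on a product of transpositions, since the embedding \<open>h\<close> carries
  transpositions to transpositions.\<close>

lemma sign_embedded_permutation:
  fixes h :: "('m::finite \<Rightarrow> 'm) \<Rightarrow> 'k::finite \<Rightarrow> 'k"
  assumes h: "h id = id" "\<And>p. p permutes UNIV \<Longrightarrow> h p permutes UNIV"
    and tr: "\<And>a b p. h (Transposition.transpose a b \<circ> p) = Transposition.transpose (g a) (g b) \<circ> h p"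
    and g: "inj g" and p: "p permutes UNIV"
  shows "sign (h p) = sign p"
  using p finite
proof (induction p rule: permutes_induct)
  case id
  then show ?case by (simp only: h(1) sign_id)
next
  case (swap a b p)
  have pp: "permutation p" "permutation (h p)"
    using \<open>p permutes UNIV\<close> h(2) unfolding permutation_permutes by (meson finite)+
  then show ?case
    unfolding tr sign_compose[OF permutation_swap_id pp(1)] sign_compose[OF permutation_swap_id pp(2)]
    using swap g by (simp add: sign_swap_id inj_eq)
qed

lemma sign_map_sum_id:
  fixes p :: "'n::finite \<Rightarrow> 'n" and q :: "'p::finite \<Rightarrow> 'p"
  shows "p permutes UNIV \<Longrightarrow> sign (map_sum p (id :: 'p \<Rightarrow> 'p)) = sign p"
    and "q permutes UNIV \<Longrightarrow> sign (map_sum (id :: 'n \<Rightarrow> 'n) q) = sign q"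
proof -
  show "sign (map_sum p (id :: 'p \<Rightarrow> 'p)) = sign p" if "p permutes UNIV"
    by (rule sign_embedded_permutation[where h = "\<lambda>p. map_sum p id" and g = Inl, OF _ _ _ _ that])
       (simp_all only: sum.map_id0 permutation_map_sum permutes_id map_sum_transpose_comp inj_Inl)
  show "sign (map_sum (id :: 'n \<Rightarrow> 'n) q) = sign q" if "q permutes UNIV"
    by (rule sign_embedded_permutation[where h = "\<lambda>p. map_sum id p" and g = Inr, OF _ _ _ _ that])
       (simp_all only: sum.map_id0 permutation_map_sum permutes_id map_sum_transpose_comp inj_Inr)
qed

lemma sign_map_sum:
  fixes p :: "'n::finite \<Rightarrow> 'n" and q :: "'p::finite \<Rightarrow> 'p"
  assumes "p permutes UNIV" "q permutes UNIV"
  shows "sign (map_sum p q) = sign p * sign q"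
proof -
  have "map_sum p q = map_sum p id \<circ> map_sum id q" by (simp add: map_sum.comp)
  moreover have "permutation (map_sum p (id :: 'p \<Rightarrow> 'p))" "permutation (map_sum (id :: 'n \<Rightarrow> 'n) q)"
    using permutation_map_sum[OF assms(1) permutes_id] permutation_map_sum[OF permutes_id assms(2)]
    by (auto simp: permutation_permutes)
  ultimately show ?thesis using assms by (simp add: sign_compose sign_map_sum_id)
qed

definition block_diag :: "'a::zero^'n^'n \<Rightarrow> 'a^'p^'p \<Rightarrow> 'a^('n::finite + 'p::finite)^('n + 'p)" where
  "block_diag X Y = (\<chi> r c. case (r, c) of (Inl i, Inl j) \<Rightarrow> X $ i $ j
     | (Inr i, Inr j) \<Rightarrow> Y $ i $ j | _ \<Rightarrow> 0)"

text \<open>In the Leibniz formula only the permutations \<open>map_sum p q\<close> survive, because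
  a nonzero product forces every index to stay in its block.\<close>

lemma det_block_diag:
  fixes X :: "'a::comm_ring_1^'n^'n" and Y :: "'a^'p^'p"
  shows "det (block_diag X Y) = det X * det Y"
proof -
  let ?M = "block_diag X Y"
  let ?U = "{g. g permutes (UNIV :: ('n + 'p) set)}"
  let ?S = "(\<lambda>(p, q). map_sum p q) ` ({p. p permutes (UNIV :: 'n set)} \<times> {q. q permutes (UNIV :: 'p set)})"
  have split: "(\<Prod>r\<in>UNIV. h r) = (\<Prod>i\<in>UNIV. h (Inl i)) * (\<Prod>j\<in>UNIV. h (Inr j))" for h :: "'n + 'p \<Rightarrow> 'a"
    using prod.Plus[of UNIV UNIV h] by (simp add: UNIV_Plus_UNIV)
  have zero: "of_int (sign g) * (\<Prod>r\<in>UNIV. ?M $ r $ g r) = 0" if g: "g \<in> ?U - ?S" for g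
  proof -
    have "\<exists>r. ?M $ r $ g r = 0"
    proof (rule ccontr)
      assume "\<not> ?thesis"
      then have nz: "?M $ r $ g r \<noteq> 0" for r by simp
      have "\<exists>j. g (Inl i) = Inl j" for i
        using nz[of "Inl i"] by (cases "g (Inl i)") (auto simp: block_diag_def)
      then obtain p where p: "\<And>i. g (Inl i) = Inl (p i)" by metis
      have "\<exists>j. g (Inr i) = Inr j" for i
        using nz[of "Inr i"] by (cases "g (Inr i)") (auto simp: block_diag_def)
      then obtain q where q: "\<And>i. g (Inr i) = Inr (q i)" by metis
      have gpq: "g = map_sum p q"
      proof
        show "g x = map_sum p q x" for x by (cases x) (auto simp: p q)
      qed
      have "inj g" using g by (auto dest: permutes_inj)
      then have "inj p" "inj q" using p q by (metis injI inj_eq Inl_inject Inr_inject)+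
      then have "p permutes UNIV" "q permutes UNIV"
        by (auto intro!: bij_imp_permutes[of _ UNIV] simp: bij_def finite_UNIV_inj_surj)
      then show False using g gpq by auto
    qed
    then have "(\<Prod>r\<in>UNIV. ?M $ r $ g r) = 0" by (auto intro!: prod_zero)
    then show ?thesis by simp
  qed
  have inj: "inj_on (\<lambda>(p, q). map_sum p q) ({p. p permutes (UNIV :: 'n set)} \<times> {q. q permutes (UNIV :: 'p set)})"
  proof (rule inj_onI, clarify)
    fix p p' :: "'n \<Rightarrow> 'n" and q q' :: "'p \<Rightarrow> 'p"
    assume eq: "map_sum p q = map_sum p' q'"
    have "p x = p' x" for x using fun_cong[OF eq, of "Inl x"] by simp
    moreover have "q x = q' x" for x using fun_cong[OF eq, of "Inr x"] by simp
    ultimately show "p = p' \<and> q = q'" by auto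
  qed
  have "det ?M = (\<Sum>g\<in>?S. of_int (sign g) * (\<Prod>r\<in>UNIV. ?M $ r $ g r))"
    unfolding det_def
    by (rule sum.mono_neutral_right) (use zero permutation_map_sum in \<open>auto simp: finite_permutations\<close>)
  also have "\<dots> = (\<Sum>(p, q)\<in>{p. p permutes UNIV} \<times> {q. q permutes UNIV}.
     of_int (sign (map_sum p q)) * (\<Prod>r\<in>UNIV. ?M $ r $ map_sum p q r))"
    by (subst sum.reindex[OF inj]) (simp add: case_prod_unfold)
  also have "\<dots> = (\<Sum>(p, q)\<in>{p. p permutes UNIV} \<times> {q. q permutes UNIV}.
     (of_int (sign p) * (\<Prod>i\<in>UNIV. X $ i $ p i)) * (of_int (sign q) * (\<Prod>j\<in>UNIV. Y $ j $ q j)))"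
    by (intro sum.cong refl) (auto simp: split sign_map_sum block_diag_def mult_ac)
  also have "\<dots> = det X * det Y"
    unfolding det_def by (simp add: sum_product sum.cartesian_product)
  finally show ?thesis .
qed

lemma char_matrix_block_diag:
  fixes A :: "real^'n^'n" and B :: "real^'p^'p"
  shows "char_poly_c (block_diag A B) = char_poly_c A * char_poly_c B"
proof -
  have "char_matrix (cmat (block_diag A B)) = block_diag (char_matrix (cmat A)) (char_matrix (cmat B))"
    by (auto simp: vec_eq_iff char_matrix_def cmat_def block_diag_def split: sum.splits)
  then show ?thesis by (simp add: char_poly_c_char_matrix det_block_diag)
qed

lemma degree_det_char_matrix_le:
  fixes M :: "complex^'n^'n"
  shows "degree (det (char_matrix M)) \<le> CARD('n)"
  unfolding det_def
proof (intro degree_sum_le)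
  fix p :: "'n \<Rightarrow> 'n"
  have "degree (char_matrix M $ i $ p i) \<le> 1" for i
    by (simp add: char_matrix_def degree_pCons_eq_if)
  then have "(\<Sum>i\<in>UNIV. degree (char_matrix M $ i $ p i)) \<le> (\<Sum>i\<in>(UNIV :: 'n set). 1)"
    by (rule sum_mono)
  moreover have "degree (\<Prod>i\<in>UNIV. char_matrix M $ i $ p i) \<le> (\<Sum>i\<in>UNIV. degree (char_matrix M $ i $ p i))"
    using degree_prod_sum_le[of UNIV "\<lambda>i. char_matrix M $ i $ p i"] by (simp add: o_def)
  moreover have "of_int (sign p) = [:of_int (sign p) :: complex:]" by (simp add: of_int_poly)
  ultimately show "degree (of_int (sign p) * (\<Prod>i\<in>UNIV. char_matrix M $ i $ p i)) \<le> CARD('n)"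
    by (simp add: order_trans[OF degree_smult_le])
qed (auto simp: finite_permutations)

text \<open>\<open>det(I - yM)\<close> equals \<open>1\<close> at \<open>y = 0\<close>, so \<open>det(xI - M) \<noteq> 0\<close> for some \<open>x = 1/y\<close>.\<close>
lemma det_char_matrix_nonzero:
  fixes M :: "complex^'n^'n"
  shows "det (char_matrix M) \<noteq> 0"
proof
  assume 0: "det (char_matrix M) = 0"
  define q where "q = det (\<chi> i j. [:if i = j then 1 else 0, - (M $ i $ j):])"
  have "poly q 0 = det (mat 1 :: complex^'n^'n)"
    unfolding q_def poly_det by (rule arg_cong[where f = det]) (simp add: mat_def vec_eq_iff)
  then have "q \<noteq> 0" by auto
  \<comment> \<open>The extra factor \<open>[:0, 1:]\<close> makes the chosen \<open>t\<close>
    nonzero as well.\<close>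
  then have r0: "q * [:0, 1:] \<noteq> 0" by simp
  have "countable (range (coeff (q * [:0, 1:])))" by blast
  from exists_real_avoiding_roots[OF this] obtain t where
    t: "\<And>p. p \<noteq> 0 \<Longrightarrow> \<forall>i. coeff p i \<in> range (coeff (q * [:0, 1:])) \<Longrightarrow>
      poly p (complex_of_real t) \<noteq> 0"
    by metis
  have "poly (q * [:0, 1:]) (complex_of_real t) \<noteq> 0" by (rule t[OF r0]) blast
  then have t: "poly q (of_real t) \<noteq> 0" "t \<noteq> 0" by auto
  have "0 = of_real t ^ CARD('n) * poly (det (char_matrix M)) (1 / of_real t)" using 0 by simp
  also have "\<dots> = det (\<chi> i. of_real t *s (\<chi> j. poly (char_matrix M $ i $ j) (1 / of_real t)))"
    unfolding poly_det by (subst det_rows_mul) simp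
  also have "\<dots> = poly q (of_real t)"
    unfolding q_def poly_det
    by (rule arg_cong[where f = det]) (use t in \<open>simp add: vec_eq_iff char_matrix_def field_simps\<close>)
  finally show False using t by simp
qed

text \<open>\<open>p(M) v\<close> by Horner's scheme, without powers of \<open>M\<close>. The ring
  is left open since one and the same polynomial acts over the rationals, the reals and the complex
  numbers, and \<open>poly_act_hom\<close> compares these actions.\<close>

definition poly_act :: "'a::comm_ring_1 poly \<Rightarrow> 'a^'m^'m \<Rightarrow> 'a^'m \<Rightarrow> 'a^'m" where
  "poly_act p M v = fold_coeffs (\<lambda>a w. a *s v + M *v w) p 0"

lemma poly_act_0 [simp]: "poly_act 0 M v = 0"
  by (simp add: poly_act_def)

lemma poly_act_pCons [simp]: "poly_act (pCons a p) M v = a *s v + M *v poly_act p M v"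
  by (cases "a = 0 \<and> p = 0") (auto simp: poly_act_def fold_coeffs_pCons_coeff_not_0_eq
      fold_coeffs_pCons_not_0_0_eq)

lemma matrix_vector_mult_scalar:
  fixes M :: "'a::comm_ring_1^'n^'m"
  shows "M *v (c *s v) = c *s (M *v v)"
  by (simp add: vec_eq_iff matrix_vector_mult_def sum_distrib_left mult_ac)

lemma poly_act_add_poly: "poly_act (p + q) M v = poly_act p M v + poly_act q M v"
  by (induction p q rule: poly_induct2)
     (simp_all add: matrix_vector_right_distrib vector_sadd_rdistrib)

lemma poly_act_smult_poly: "poly_act (smult c p) M v = c *s poly_act p M v"
  by (induction p) (simp_all add: matrix_vector_mult_scalar vector_add_ldistrib)

lemma poly_act_linear_factor: "poly_act ([:- z, 1:] * p) M v = M *v poly_act p M v - z *s poly_act p M v"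
proof -
  have "[:- z, 1:] * p = smult (- z) p + pCons 0 p" by simp
  then show ?thesis by (simp only: poly_act_add_poly poly_act_smult_poly poly_act_pCons) (simp add: vec_eq_iff)
qed

lemma poly_act_add: "poly_act p M (v + w) = poly_act p M v + poly_act p M w"
  by (induction p) (simp_all add: matrix_vector_right_distrib vector_add_ldistrib)

lemma poly_act_scale: "poly_act p M (c *s v) = c *s poly_act p M v"
  by (induction p) (simp_all add: matrix_vector_mult_scalar vector_add_ldistrib mult_ac)

lemma poly_act_eigenvector:
  assumes "M *v v = z *s v"
  shows "poly_act p M v = poly p z *s v"
  by (induction p)
     (simp_all add: assms matrix_vector_mult_scalar vector_sadd_rdistrib mult_ac)

lemma poly_act_intertwine:
  assumes "\<And>x. \<phi> (M *v x) = B *v \<phi> x" "\<And>x y. \<phi> (x + y) = \<phi> x + \<phi> y" "\<And>c x. \<phi> (c *s x) = c *s \<phi> x"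
  shows "\<phi> (poly_act p M v) = poly_act p B (\<phi> v)"
proof (induction p)
  case 0
  then show ?case using assms(3)[of 0 0] by simp
next
  case (pCons a p)
  then show ?case by (simp add: assms)
qed

lemma poly_act_hom:
  fixes h :: "'a::comm_ring_1 \<Rightarrow> 'b::comm_ring_1"
  assumes h: "h 0 = 0" "\<And>x y. h (x + y) = h x + h y" "\<And>x y. h (x * y) = h x * h y"
  shows "(\<chi> i. h (poly_act p M v $ i)) = poly_act (map_poly h p) (\<chi> i j. h (M $ i $ j)) (\<chi> i. h (v $ i))"
proof (induction p)
  case 0
  then show ?case by (simp add: vec_eq_iff h)
next
  case (pCons a p)
  have s: "h (sum g A) = (\<Sum>x\<in>A. h (g x))" for g :: "'c \<Rightarrow> 'a" and A
    by (induction A rule: infinite_finite_induct) (auto simp: h)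
  have "poly_act (map_poly h p) (\<chi> i j. h (M $ i $ j)) (\<chi> i. h (v $ i)) $ i = h (poly_act p M v $ i)" for i
    using pCons.IH by (simp add: vec_eq_iff)
  then show ?case
    by (simp add: vec_eq_iff h map_poly_pCons matrix_vector_mult_def s)
qed

text \<open>The operator is a product of the maps \<open>M - z\<close>, each injective because no
  \<open>z\<close> in \<open>R\<close> is an eigenvalue.\<close>

lemma poly_act_prod_roots_injective:
  fixes M :: "complex^'m^'m"
  assumes "finite R" "\<And>z w. z \<in> R \<Longrightarrow> M *v w = z *s w \<Longrightarrow> w = 0"
    "poly_act (\<Prod>z\<in>R. [:- z, 1:]) M v = 0"
  shows "v = 0"
  using assms
proof (induction R rule: finite_induct)
  case empty
  have "poly_act 1 M v = v" by (simp add: one_pCons)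
  then show ?case using empty by simp
next
  case (insert z R)
  have "poly_act ([:- z, 1:] * (\<Prod>z\<in>R. [:- z, 1:])) M v = 0" using insert by simp
  then have "poly_act (\<Prod>z\<in>R. [:- z, 1:]) M v = 0"
    using insert.prems(1)[of z "poly_act (\<Prod>z\<in>R. [:- z, 1:]) M v"] unfolding poly_act_linear_factor by simp
  then show ?case using insert by blast
qed

lemma not_inj_matrix_iff:
  fixes N :: "'a::comm_ring_1^'m^'n"
  shows "\<not> inj ((*v) N) \<longleftrightarrow> (\<exists>w. w \<noteq> 0 \<and> N *v w = 0)"
proof -
  have "N *v (x - y) = N *v x - N *v y" for x y
    by (simp add: matrix_vector_mult_def vec_eq_iff right_diff_distrib sum_subtractf)
  moreover have "N *v 0 = 0" by simp
  ultimately show ?thesis unfolding inj_def by (metis eq_iff_diff_eq_0)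
qed

lemma det_nz_iff_inj_mult:
  fixes N :: "'a::field^'n^'n"
  shows "det N \<noteq> 0 \<longleftrightarrow> inj ((*v) N)"
  using det_nz_iff_inj_gen[OF matrix_vector_mul_linear_gen[of N]] by simp

lemma char_poly_root_eigenvector:
  fixes M :: "complex^'m^'m"
  shows "poly (det (char_matrix M)) z = 0 \<longleftrightarrow> (\<exists>w. w \<noteq> 0 \<and> M *v w = z *s w)"
proof -
  define N where "N = (\<chi> i j. poly (char_matrix M $ i $ j) z)"
  have N: "N *v w = z *s w - M *v w" for w
    by (simp add: N_def vec_eq_iff char_matrix_def matrix_vector_mult_def left_diff_distrib
        sum_subtractf if_distrib[of "\<lambda>x. poly x z"] if_distrib[of "\<lambda>x. x * _"] cong: if_cong)
  have "poly (det (char_matrix M)) z = 0 \<longleftrightarrow> \<not> inj ((*v) N)"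
    using det_nz_iff_inj_mult[of N] by (auto simp: poly_det N_def)
  also have "\<dots> \<longleftrightarrow> (\<exists>w. w \<noteq> 0 \<and> N *v w = 0)"
    by (rule not_inj_matrix_iff)
  finally show ?thesis unfolding N by (metis eq_iff_diff_eq_0)
qed

lemma common_denominator_vec:
  fixes v :: "rat^'m"
  shows "\<exists>D::int. D > 0 \<and> (\<forall>i. of_int D * v $ i \<in> \<int>)"
proof -
  define D where "D = (\<Prod>i\<in>UNIV. snd (quotient_of (v $ i)))"
  have pos: "snd (quotient_of x) > 0" for x
    using quotient_of_denom_pos[of x] by (cases "quotient_of x") auto
  have "of_int D * v $ i \<in> \<int>" for i
  proof -
    define b where "b = snd (quotient_of (v $ i))"
    define r where "r = (\<Prod>j\<in>UNIV - {i}. snd (quotient_of (v $ j)))"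
    have D: "D = b * r"
      unfolding D_def b_def r_def by (rule prod.remove) auto
    have "v $ i = of_int (fst (quotient_of (v $ i))) / of_int b"
      unfolding b_def by (rule quotient_of_div) simp
    then have "of_int b * v $ i = of_int (fst (quotient_of (v $ i)))"
      using pos[of "v $ i"] unfolding b_def[symmetric] by (simp add: field_simps)
    then have "of_int r * (of_int b * v $ i) = of_int (r * fst (quotient_of (v $ i)))" by simp
    moreover have "of_int D * v $ i = of_int r * (of_int b * v $ i)" by (simp add: D)
    ultimately show ?thesis by (metis Ints_of_int)
  qed
  moreover have "D > 0" unfolding D_def by (rule prod_pos) (simp add: pos)
  ultimately show ?thesis by blast
qed

text \<open>Singularity of \<open>f(N)\<close> over \<open>\<complex>\<close> descends to \<open>\<rat>\<close> because it is the vanishing of a rational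
  determinant.\<close>
lemma rational_kernel_vector:
  fixes N :: "rat^'m^'m"
  assumes "poly (det (char_matrix (\<chi> i j. of_rat (N $ i $ j)))) z = 0" "poly (rpoly f) z = 0"
  shows "\<exists>v. v \<noteq> 0 \<and> (\<forall>i. v $ i \<in> \<int>) \<and> poly_act f N v = 0"
proof -
  let ?c = "\<lambda>v :: rat^'m. (\<chi> i. of_rat (v $ i)) :: complex^'m"
  let ?N = "(\<chi> i j. of_rat (N $ i $ j)) :: complex^'m^'m"
  obtain w where w: "w \<noteq> 0" "?N *v w = z *s w" using assms(1) char_poly_root_eigenvector by blast
  define K where "K = matrix (poly_act f N)"
  have K: "K *v v = poly_act f N v" for v
    unfolding K_def by (rule matrix_works) (unfold_locales, auto simp: poly_act_add poly_act_scale)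
  let ?K = "(\<chi> i j. of_rat (K $ i $ j)) :: complex^'m^'m"
  have Kc: "?K *v u = poly_act (rpoly f) ?N u" for u
  proof -
    have col: "?c (poly_act f N v) = poly_act (rpoly f) ?N (?c v)" for v
      by (rule poly_act_hom) (auto simp: of_rat_add of_rat_mult)
    define K' where "K' = matrix (poly_act (rpoly f) ?N)"
    have K': "K' *v u = poly_act (rpoly f) ?N u" for u
      unfolding K'_def by (rule matrix_works) (unfold_locales, auto simp: poly_act_add poly_act_scale)
    have "K' $ i $ j = ?K $ i $ j" for i j
    proof -
      have "?c (axis j 1) = axis j 1" by (simp add: vec_eq_iff axis_def)
      then show ?thesis using col[of "axis j 1"]
        by (simp add: K'_def K_def matrix_def vec_eq_iff)
    qed
    then have "?K = K'" by (simp add: vec_eq_iff)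
    then show ?thesis using K' by simp
  qed
  have "?K *v w = 0" unfolding Kc poly_act_eigenvector[OF w(2)] using assms(2) by simp
  then have "\<not> inj ((*v) ?K)" using w(1) by (metis injD matrix_vector_mult_0_right)
  then have "det ?K = 0" using det_nz_iff_inj_mult by blast
  moreover have "det ?K = of_rat (det K)"
    by (rule det_hom[symmetric]) (auto simp: of_rat_add of_rat_mult)
  ultimately have "det K = 0" by simp
  then have "\<not> inj ((*v) K)" using det_nz_iff_inj_mult by blast
  then obtain v where v: "v \<noteq> 0" "K *v v = 0"
    using not_inj_matrix_iff by blast
  \<comment> \<open>Clearing denominators makes the kernel vector integral, hence the coordinate
    vector of a lattice point.\<close>
  obtain D where D: "D > 0" "\<forall>i. of_int D * v $ i \<in> \<int>" using common_denominator_vec by blast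
  have "poly_act f N (of_int D *s v) = 0" unfolding poly_act_scale using v(2) K by simp
  moreover have "of_int D *s v \<noteq> 0" using v(1) D(1) by (simp add: vec_eq_iff)
  ultimately show ?thesis using D(2) by (intro exI[of _ "of_int D *s v"]) simp
qed

section \<open>Expansions of cut-and-project sets act on the lattice\<close>

lemma pi_par_linear: "pi_par (x + y) = pi_par x + pi_par y" "pi_par (x - y) = pi_par x - pi_par y"
    "pi_par (c *\<^sub>R x) = c *\<^sub>R pi_par x" "linear pi_par"
  by (auto simp: pi_par_def vec_eq_iff intro!: linearI)

lemma pi_perp_linear: "pi_perp (x + y) = pi_perp x + pi_perp y" "pi_perp (x - y) = pi_perp x - pi_perp y"
    "pi_perp (c *\<^sub>R x) = c *\<^sub>R pi_perp x" "linear pi_perp"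
  by (auto simp: pi_perp_def vec_eq_iff intro!: linearI)

lemma pi_eqI:
  assumes "pi_par x = pi_par y" "pi_perp x = pi_perp y"
  shows "x = y"
  unfolding vec_eq_iff
proof
  fix i
  show "x $ i = y $ i"
    using assms by (cases i) (auto simp: pi_par_def pi_perp_def vec_eq_iff)
qed

lemma additive_subgroup_lattice_of: "additive_subgroup (lattice_of L)"
  unfolding additive_subgroup_def lattice_of_def
proof (intro conjI ballI)
  show "0 \<in> {L *v r |r. \<forall>i. r $ i \<in> \<int>}" by (auto intro!: exI[of _ 0])
  fix x y assume "x \<in> {L *v r |r. \<forall>i. r $ i \<in> \<int>}" "y \<in> {L *v r |r. \<forall>i. r $ i \<in> \<int>}"
  then obtain r r' where "x = L *v r" "y = L *v r'" "\<forall>i. r $ i \<in> \<int>" "\<forall>i. r' $ i \<in> \<int>" by blast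
  then show "x - y \<in> {L *v r |r. \<forall>i. r $ i \<in> \<int>}"
    by (auto intro!: exI[of _ "r - r'"] simp: matrix_vector_mult_diff_distrib)
qed

text \<open>Approximate \<open>h x / N\<close> by \<open>h y\<close> with \<open>y\<close> in
  \<open>H\<close>. Then \<open>y\<close> and \<open>x - N y\<close> are both small under
  \<open>h\<close>, hence both in \<open>G\<close>. The accuracy \<open>e / (2 * N)\<close> survives
  the multiplication by \<open>N\<close>.\<close>

lemma dense_subgroup_small_generate:
  fixes h :: "'a::real_vector \<Rightarrow> 'b::real_normed_vector"
  assumes H: "additive_subgroup H" and h: "linear h"
    and dense: "closure (h ` H) = UNIV" and G: "additive_subgroup G"
    and e: "e > 0" "\<And>x. x \<in> H \<Longrightarrow> norm (h x) < e \<Longrightarrow> x \<in> G" and x: "x \<in> H"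
  shows "x \<in> G"
proof -
  obtain N :: nat where N1: "norm (h x) * 2 / e < real N" using reals_Archimedean2 by blast
  moreover have "0 \<le> norm (h x) * 2 / e" using e(1) by simp
  ultimately have "0 < real N" by linarith
  with N1 have N: "norm (h x) * 2 / e < real N" "N > 0" by simp_all
  have "h x /\<^sub>R N \<in> closure (h ` H)" using dense by simp
  then obtain y where y: "y \<in> H" "dist (h y) (h x /\<^sub>R N) < e / (2 * N)"
    unfolding closure_approachable using e(1) N(2) by (metis divide_pos_pos imageE mult_pos_pos of_nat_0_less_iff zero_less_numeral)
  have "norm (h x /\<^sub>R N) < e / 2" using N e(1) by (simp add: field_simps)
  moreover have "e / (2 * N) \<le> e / 2" using N(2) e(1) by (simp add: field_simps)
  ultimately have "norm (h y) < e"
    using y(2) norm_triangle_ineq[of "h y - h x /\<^sub>R N" "h x /\<^sub>R N"] by (simp add: dist_norm)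
  then have "y \<in> G" using e(2) y(1) by blast
  then have Ny: "of_nat N *\<^sub>R y \<in> G" by (rule additive_subgroup_of_nat[OF G])
  have "h (x - of_nat N *\<^sub>R y) = of_nat N *\<^sub>R (h x /\<^sub>R N - h y)"
    using N(2) by (simp add: linear_diff[OF h] linear_cmul[OF h] scaleR_diff_right)
  then have "norm (h (x - of_nat N *\<^sub>R y)) = N * dist (h y) (h x /\<^sub>R N)"
    by (simp add: dist_norm norm_minus_commute)
  also have "\<dots> < N * (e / (2 * N))" using y(2) N(2) by (intro mult_strict_left_mono) auto
  also have "\<dots> \<le> e" using N(2) e(1) by simp
  finally have "norm (h (x - of_nat N *\<^sub>R y)) < e" .
  moreover have "x - of_nat N *\<^sub>R y \<in> H"
    using x additive_subgroup_of_nat[OF H y(1)] H by (simp add: additive_subgroup_def)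
  ultimately have "x - of_nat N *\<^sub>R y \<in> G" using e(2) by blast
  then show ?thesis using additive_subgroup_add[OF G _ Ny] by force
qed

lemma linear_eq_on_axes:
  fixes f g :: "real^'m \<Rightarrow> 'b::real_vector"
  assumes "linear f" "linear g" "\<And>j. f (axis j 1) = g (axis j 1)"
  shows "f = g"
  by (rule linear_eq_stdbasis[OF assms(1,2)]) (use assms(3) in \<open>auto simp: Basis_vec_def\<close>)

text \<open>Boundedness of \<open>g\<close> on integer vectors that are small under \<open>h\<close> makes \<open>g\<close> vanish on
  \<open>ker h\<close>: compare the roundings of \<open>t x\<close> for \<open>t \<in> \<nat>\<close>.\<close>
lemma linear_vanishes_on_kernel:
  fixes g :: "real^'m \<Rightarrow> 'b::euclidean_space" and h :: "real^'m \<Rightarrow> 'c::euclidean_space"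
  assumes g: "linear g" and h: "linear h" and e: "e > 0"
    and bd: "\<And>z. (\<forall>i. z $ i \<in> \<int>) \<Longrightarrow> norm (h z) < e \<Longrightarrow> norm (g z) \<le> K"
    and x: "h x = 0"
  shows "g x = 0"
proof (rule ccontr)
  assume gx: "g x \<noteq> 0"
  define z where "z t = (\<chi> i. real_of_int \<lfloor>of_nat t * x $ i\<rfloor>)" for t :: nat
  define r where "r t = z t - of_nat t *\<^sub>R x" for t :: nat
  have rn: "norm (r t) \<le> CARD('m)" for t
  proof -
    have "norm (r t) \<le> (\<Sum>i\<in>UNIV. norm (r t $ i))" by (simp add: norm_vec_def L2_set_le_sum)
    also have "\<dots> \<le> (\<Sum>i\<in>(UNIV :: 'm set). 1)"
    proof (rule sum_mono)
      fix i
      show "norm (r t $ i) \<le> 1" unfolding r_def z_def by simp linarith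
    qed
    finally show ?thesis by simp
  qed
  then have "bounded (range r)" unfolding bounded_iff by blast
  then obtain l s where s: "strict_mono s" "(r \<circ> s) \<longlonglongrightarrow> l"
    using bounded_imp_convergent_subsequence by blast
  have "(\<lambda>m. h (r (s m))) \<longlonglongrightarrow> h l"
    using linear_continuous_at[of h l] s(2) h isCont_tendsto_compose[of l h "r \<circ> s" sequentially]
    by (simp add: linear_conv_bounded_linear o_def)
  then have "Cauchy (\<lambda>m. h (r (s m)))" using LIMSEQ_imp_Cauchy by blast
  \<comment> \<open>From index \<open>M\<close> on, \<open>h\<close> of the rounding errors varies
    by less than \<open>e\<close>. So \<open>z (s m) - z (s M)\<close> is an integer vector small
    under \<open>h\<close>, although it stays within bounded distance of a growing multiple of
    \<open>x\<close>.\<close>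
  then obtain M where M: "\<And>m. m \<ge> M \<Longrightarrow> dist (h (r (s m))) (h (r (s M))) < e"
    unfolding Cauchy_def using e by blast
  obtain C where C: "\<And>v. norm (g v) \<le> norm v * C"
    using g linear_conv_bounded_linear[of g] bounded_linear.bounded by blast
  have "C \<ge> 0" using C[of x] gx by (metis norm_ge_zero norm_le_zero_iff not_le mult_nonneg_nonpos order_trans less_imp_le)
  have bound: "real (s m - s M) * norm (g x) \<le> K + 2 * CARD('m) * C" if "m \<ge> M" for m
  proof -
    have le: "s M \<le> s m" using that s(1) by (simp add: strict_mono_less_eq)
    have zd: "z (s m) - z (s M) = of_nat (s m - s M) *\<^sub>R x + (r (s m) - r (s M))"
      using le by (simp add: r_def of_nat_diff algebra_simps)
    have "h (z (s m) - z (s M)) = h (r (s m)) - h (r (s M))"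
      unfolding zd by (simp add: linear_add[OF h] linear_cmul[OF h] linear_diff[OF h] x)
    then have "norm (h (z (s m) - z (s M))) < e" using M[OF that] by (simp add: dist_norm)
    then have "norm (g (z (s m) - z (s M))) \<le> K" by (intro bd) (auto simp: z_def)
    moreover have "of_nat (s m - s M) *\<^sub>R g x = g (z (s m) - z (s M)) - g (r (s m) - r (s M))"
      unfolding zd by (simp add: linear_add[OF g] linear_cmul[OF g])
    then have "norm (of_nat (s m - s M) *\<^sub>R g x) \<le> norm (g (z (s m) - z (s M))) + norm (g (r (s m) - r (s M)))"
      by (metis norm_triangle_ineq4)
    moreover have "norm (g (r (s m) - r (s M))) \<le> 2 * CARD('m) * C"
    proof -
      have "norm (r (s m) - r (s M)) \<le> 2 * CARD('m)"
        using norm_triangle_ineq4[of "r (s m)" "r (s M)"] rn[of "s m"] rn[of "s M"] by simp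
      then show ?thesis using C[of "r (s m) - r (s M)"] \<open>C \<ge> 0\<close> by (meson mult_right_mono order_trans)
    qed
    ultimately show ?thesis by simp
  qed
  obtain k :: nat where k: "(K + 2 * CARD('m) * C) / norm (g x) < real k" using reals_Archimedean2 by blast
  have "s M + k \<le> s (M + k)"
  proof (induction k)
    case (Suc k)
    then show ?case using s(1) by (metis Suc_leI add_Suc_right le_less_trans lessI strict_mono_less)
  qed simp
  then have "k \<le> s (M + k) - s M" by simp
  then have "real k * norm (g x) \<le> K + 2 * CARD('m) * C"
    using bound[of "M + k"] by (meson le_add1 mult_right_mono norm_ge_zero of_nat_mono order_trans)
  then show False using k gx by (simp add: field_simps)
qed

theorem invariant_cps_integer_matrix:
  fixes A :: "real^'n^'n" and L :: "real^('n + 'p::finite)^('n + 'p)" and \<Omega> :: "(real^'p) set"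
  assumes L: "generic_cps L" and W: "window \<Omega>"
    and inv: "(\<lambda>x. A *v x) ` cps_set L \<Omega> \<subseteq> cps_set L \<Omega>"
  shows "\<exists>(N :: rat^('n + 'p)^('n + 'p)) B. (\<forall>i j. N $ i $ j \<in> \<int>) \<and>
    (\<forall>x. pi_par (L *v ((\<chi> i j. of_rat (N $ i $ j)) *v x)) = A *v pi_par (L *v x) \<and>
         pi_perp (L *v ((\<chi> i j. of_rat (N $ i $ j)) *v x)) = B *v pi_perp (L *v x))"
proof -
  define \<Lambda> where "\<Lambda> = lattice_of L"
  have sub: "additive_subgroup \<Lambda>" by (simp add: \<Lambda>_def additive_subgroup_lattice_of)
  have invL: "invertible L" and inj: "inj_on (pi_par :: real^('n + 'p) \<Rightarrow> real^'n) \<Lambda>"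
    and dense: "closure (pi_perp ` \<Lambda>) = (UNIV :: (real^'p) set)"
    using L by (auto simp: generic_cps_def \<Lambda>_def)
  \<comment> \<open>Lattice points whose image under \<open>A\<close> lifts back to the lattice.
    \<open>G\<close> is a subgroup, so it suffices that it contains all lattice points with small
    \<open>pi_perp\<close>.\<close>
  define G where "G = {l \<in> \<Lambda>. A *v pi_par l \<in> pi_par ` \<Lambda>}"
  have subG: "additive_subgroup G"
    unfolding additive_subgroup_def
  proof (intro conjI ballI)
    have "0 \<in> \<Lambda>" using sub by (simp add: additive_subgroup_def)
    moreover have "A *v pi_par (0 :: real^('n + 'p)) = pi_par (0 :: real^('n + 'p))"
      by (simp add: linear_0[OF pi_par_linear(4)])
    ultimately show "0 \<in> G" unfolding G_def by blast
  next
    fix x y assume "x \<in> G" "y \<in> G"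
    then obtain x' y' where "x \<in> \<Lambda>" "y \<in> \<Lambda>" "x' \<in> \<Lambda>" "y' \<in> \<Lambda>"
      "A *v pi_par x = pi_par x'" "A *v pi_par y = pi_par y'" unfolding G_def by blast
    moreover from this have "A *v pi_par (x - y) = pi_par (x' - y')"
      by (simp add: pi_par_linear matrix_vector_mult_diff_distrib)
    ultimately show "x - y \<in> G"
      using sub unfolding G_def additive_subgroup_def by blast
  qed
  have winG: "\<exists>l'\<in>\<Lambda>. A *v pi_par l = pi_par l' \<and> pi_perp l' \<in> \<Omega>" if "l \<in> \<Lambda>" "pi_perp l \<in> \<Omega>" for l
  proof -
    have "pi_par l \<in> cps_set L \<Omega>" using that by (auto simp: cps_set_def \<Lambda>_def)
    then have "A *v pi_par l \<in> cps_set L \<Omega>" using inv by blast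
    then show ?thesis by (auto simp: cps_set_def \<Lambda>_def)
  qed
  have "interior \<Omega> \<noteq> {}" using W by (metis closure_empty window_def)
  then obtain c where "c \<in> interior \<Omega>" by blast
  then obtain e' where e': "e' > 0" "ball c e' \<subseteq> \<Omega>" by (auto simp: mem_interior)
  \<comment> \<open>Half of the radius is spent on the distance of \<open>pi_perp l0\<close> from
    \<open>c\<close>, the other half on the shift by \<open>l\<close>. So \<open>l\<close> is a
    difference of two lattice points over the window.\<close>
  define e where "e = e' / 2"
  have e: "e > 0" using e' by (simp add: e_def)
  have "c \<in> closure (pi_perp ` \<Lambda>)" using dense by simp
  then obtain l0 where l0: "l0 \<in> \<Lambda>" "dist (pi_perp l0) c < e"
    using e unfolding closure_approachable by blast
  have shift: "pi_perp (l0 + l) \<in> \<Omega>" if "norm (pi_perp l) < e" for l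
  proof -
    have "dist c (pi_perp (l0 + l)) \<le> dist c (pi_perp l0) + dist (pi_perp l0) (pi_perp l0 + pi_perp l)"
      unfolding pi_perp_linear by (rule dist_triangle)
    also have "\<dots> < e'" using l0(2) that by (simp add: e_def dist_commute dist_norm)
    finally show ?thesis using e'(2) by auto
  qed
  have l0W: "pi_perp l0 \<in> \<Omega>" using shift[of 0] e by (simp add: linear_0[OF pi_perp_linear(4)])
  have l0G: "l0 \<in> G" using winG[OF l0(1) l0W] l0(1) by (auto simp: G_def)
  have small: "l \<in> G" if "l \<in> \<Lambda>" "norm (pi_perp l) < e" for l
  proof -
    have "l0 + l \<in> \<Lambda>" using additive_subgroup_add[OF sub l0(1) that(1)] .
    then have "l0 + l \<in> G" using winG shift[OF that(2)] by (auto simp: G_def)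
    then have "(l0 + l) - l0 \<in> G" using l0G subG unfolding additive_subgroup_def by blast
    then show ?thesis by simp
  qed
  have all: "l \<in> G" if "l \<in> \<Lambda>" for l
    using dense_subgroup_small_generate[OF sub pi_perp_linear(4) dense subG e small that] .
  have "\<exists>t. (\<forall>i. t $ i \<in> \<int>) \<and> A *v pi_par (L *v axis j 1) = pi_par (L *v t)" for j
  proof -
    have "L *v axis j 1 \<in> \<Lambda>" unfolding \<Lambda>_def lattice_of_def by (auto simp: axis_def)
    then have "L *v axis j 1 \<in> G" by (rule all)
    then show ?thesis unfolding G_def \<Lambda>_def lattice_of_def by blast
  qed
  then obtain t where t: "\<And>j i. t j $ i \<in> \<int>" "\<And>j. A *v pi_par (L *v axis j 1) = pi_par (L *v t j)"
    by metis
  \<comment> \<open>The floor changes nothing, as the entries are integers; rational entries let the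
    theory of polynomials over \<open>\<rat>\<close> apply to \<open>N\<close>.\<close>
  define N where "N = (\<chi> i j. rat_of_int \<lfloor>t j $ i\<rfloor>)"
  define R where "R = (\<chi> i j. real_of_rat (N $ i $ j))"
  have R: "R $ i $ j = t j $ i" for i j using t(1)[of j i] by (simp add: R_def N_def)
  have Rax: "R *v axis j 1 = t j" for j
    by (simp add: vec_eq_iff matrix_vector_mult_basis column_def R)
  have par: "pi_par (L *v (R *v x)) = A *v pi_par (L *v x)" for x
  proof -
    have "(\<lambda>x. pi_par (L *v (R *v x))) = (\<lambda>x. A *v pi_par (L *v x))"
      by (rule linear_eq_on_axes)
         (auto simp: Rax t(2) pi_par_linear matrix_vector_right_distrib matrix_vector_mult_scaleR intro!: linearI)
    then show ?thesis by metis
  qed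
  have Rint: "\<forall>i. (R *v z) $ i \<in> \<int>" if "\<forall>i. z $ i \<in> \<int>" for z
    using that t(1) by (auto simp: matrix_vector_mult_def R intro!: Ints_sum Ints_mult)
  have win: "pi_perp (L *v (R *v z)) \<in> \<Omega>" if z: "\<forall>i. z $ i \<in> \<int>" "pi_perp (L *v z) \<in> \<Omega>" for z
  proof -
    have "L *v z \<in> \<Lambda>" using z by (auto simp: \<Lambda>_def lattice_of_def)
    then obtain l' where l': "l' \<in> \<Lambda>" "A *v pi_par (L *v z) = pi_par l'" "pi_perp l' \<in> \<Omega>"
      using winG z(2) by blast
    have "L *v (R *v z) \<in> \<Lambda>" using Rint[OF z(1)] by (auto simp: \<Lambda>_def lattice_of_def)
    then have "L *v (R *v z) = l'" using inj l'(1,2) par by (auto simp: inj_on_def)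
    then show ?thesis using l'(3) by simp
  qed
  obtain K where K: "\<And>w. w \<in> \<Omega> \<Longrightarrow> norm w \<le> K" using W by (auto simp: window_def bounded_iff)
  obtain z0 where z0: "l0 = L *v z0" "\<forall>i. z0 $ i \<in> \<int>" using l0(1) by (auto simp: \<Lambda>_def lattice_of_def)
  \<comment> \<open>\<open>z\<close> is the difference of \<open>z0 + z\<close> and
    \<open>z0\<close>, whose images both stay in the window; hence twice the bound
    \<open>K\<close>.\<close>
  have bd: "norm (pi_perp (L *v (R *v z))) \<le> 2 * K" if z: "\<forall>i. z $ i \<in> \<int>" "norm (pi_perp (L *v z)) < e" for z
  proof -
    have "pi_perp (L *v (z0 + z)) \<in> \<Omega>" using shift[OF z(2)] by (simp add: z0(1) matrix_vector_right_distrib)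
    then have "norm (pi_perp (L *v (R *v (z0 + z)))) \<le> K" using K win[of "z0 + z"] z0(2) z(1) by simp
    moreover have "norm (pi_perp (L *v (R *v z0))) \<le> K" using K win[OF z0(2)] l0W z0(1) by simp
    moreover have "pi_perp (L *v (R *v z)) = pi_perp (L *v (R *v (z0 + z))) - pi_perp (L *v (R *v z0))"
      by (simp add: matrix_vector_right_distrib pi_perp_linear)
    ultimately show ?thesis
      using norm_triangle_ineq4[of "pi_perp (L *v (R *v (z0 + z)))" "pi_perp (L *v (R *v z0))"] by simp
  qed
  have lin1: "linear (\<lambda>x. pi_perp (L *v (R *v x)) :: real^'p)"
    and lin2: "linear (\<lambda>x. pi_perp (L *v x) :: real^'p)"
    by (auto simp: pi_perp_linear matrix_vector_right_distrib matrix_vector_mult_scaleR intro!: linearI)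
  have ker: "pi_perp (L *v (R *v x)) = 0" if "pi_perp (L *v x) = 0" for x
    by (rule linear_vanishes_on_kernel[OF lin1 lin2 e bd that])
  obtain L' where L': "L ** L' = mat 1" using invL unfolding invertible_def by blast
  define lift where "lift y = ((\<chi> r. case r of Inl i \<Rightarrow> 0 | Inr j \<Rightarrow> y $ j) :: real^('n + 'p))" for y :: "real^'p"
  have lift: "pi_perp (lift y) = y" "linear lift" for y :: "real^'p"
    by (auto simp: lift_def pi_perp_def vec_eq_iff split: sum.splits intro!: linearI)
  have LL: "L *v (L' *v x) = x" for x using L' by (simp add: matrix_vector_mul_assoc)
  \<comment> \<open>The map induced on the second factor: lift \<open>y\<close> in some way, apply
    \<open>R\<close>, project. By \<open>ker\<close> the result does not depend on the lift.\<close>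
  define B where "B = matrix (\<lambda>y. pi_perp (L *v (R *v (L' *v lift y))) :: real^'p)"
  have B: "B *v y = pi_perp (L *v (R *v (L' *v lift y)))" for y
    unfolding B_def
    by (rule matrix_works)
       (auto simp: linear_matrix_vector_mul_eq linear_add[OF lift(2)] linear_cmul[OF lift(2)]
         pi_perp_linear matrix_vector_right_distrib matrix_vector_mult_scaleR intro!: linearI)
  have perp: "pi_perp (L *v (R *v x)) = B *v pi_perp (L *v x)" for x
  proof -
    have "pi_perp (L *v (x - L' *v lift (pi_perp (L *v x)))) = 0"
      by (simp add: matrix_vector_mult_diff_distrib LL pi_perp_linear lift)
    then have "pi_perp (L *v (R *v (x - L' *v lift (pi_perp (L *v x))))) = 0" by (rule ker)
    then show ?thesis unfolding B by (simp add: matrix_vector_mult_diff_distrib pi_perp_linear)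
  qed
  have "\<forall>i j. N $ i $ j \<in> \<int>" by (simp add: N_def)
  then show ?thesis using par perp unfolding R_def by blast
qed

section \<open>The lower bound\<close>

lemma char_poly_rational_matrix:
  fixes N :: "rat^'m^'m"
  shows "det (char_matrix (\<chi> i j. of_rat (N $ i $ j))) =
    rpoly (det (\<chi> i j. (if i = j then [:0, 1:] else 0) - [:N $ i $ j:]))"
  by (subst det_hom[where h = rpoly])
     (auto intro!: arg_cong[where f = det] simp: vec_eq_iff char_matrix_def)

lemma block_diag_mult_vec:
  fixes A :: "real^'n^'n" and B :: "real^'p^'p"
  shows "pi_par (block_diag A B *v y) = A *v pi_par y"
    and "pi_perp (block_diag A B *v y) = B *v pi_perp y"
proof -
  have split: "(\<Sum>r\<in>UNIV. h r) = (\<Sum>i\<in>UNIV. h (Inl i)) + (\<Sum>j\<in>UNIV. h (Inr j))" for h :: "'n + 'p \<Rightarrow> real"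
    using sum.Plus[of UNIV UNIV h] by (simp add: UNIV_Plus_UNIV)
  show "pi_par (block_diag A B *v y) = A *v pi_par y" "pi_perp (block_diag A B *v y) = B *v pi_perp y"
    by (auto simp: block_diag_def pi_par_def pi_perp_def vec_eq_iff matrix_vector_mult_def split)
qed

context eigen_setup
begin

lemma order_ge_factor_mult_imp_s_dim_le:
  assumes p: "p \<noteq> 0"
    and ord: "\<And>f z. f \<in> factors \<Longrightarrow> z \<in> roots_Q f \<Longrightarrow> factor_mult A f \<le> order z p"
  shows "s_dim A \<le> degree p"
proof -
  have "s_dim A = (\<Sum>z\<in>all_roots. root_mult z)"
    unfolding card_total_index[symmetric] total_index_def
    using all_roots_finite by (subst card_SigmaI) auto
  also have "\<dots> \<le> (\<Sum>z\<in>all_roots. order z p)"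
    using ord root_mult_eq by (intro sum_mono) (auto simp: all_roots_def)
  also have "\<dots> = (\<Sum>z\<in>all_roots \<inter> {z. poly p z = 0}. order z p)"
    using all_roots_finite by (intro sum.mono_neutral_right) (auto simp: order_0I)
  also have "\<dots> \<le> (\<Sum>z | poly p z = 0. order z p)"
    using poly_roots_finite[OF p] by (intro sum_mono2) auto
  also have "\<dots> \<le> degree p" using sum_order_le_degree[OF p] .
  finally show ?thesis .
qed

theorem invariant_cps_dimension_ge:
  assumes "invariant_cps_exists A TYPE('p::finite)"
  shows "s_dim A \<le> CARD('n) + CARD('p)"
proof -
  obtain L :: "real^('n + 'p)^('n + 'p)" and \<Omega> :: "(real^'p) set" where
    L: "generic_cps L" "window \<Omega>" "(\<lambda>x. A *v x) ` cps_set L \<Omega> \<subseteq> cps_set L \<Omega>"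
    using assms unfolding invariant_cps_exists_def by blast
  obtain N :: "rat^('n + 'p)^('n + 'p)" and B where
    par: "\<And>x. pi_par (L *v ((\<chi> i j. of_rat (N $ i $ j)) *v x)) = A *v pi_par (L *v x)" and
    perp: "\<And>x. pi_perp (L *v ((\<chi> i j. of_rat (N $ i $ j)) *v x)) = B *v pi_perp (L *v x)"
    using invariant_cps_integer_matrix[OF L] by metis
  define R where "R = (\<chi> i j. real_of_rat (N $ i $ j))"
  define T where "T = block_diag A B"
  have "T *v (L *v x) = L *v (R *v x)" for x
    by (rule pi_eqI) (simp_all add: T_def R_def block_diag_mult_vec par perp)
  then have TL: "T ** L = L ** R" by (simp add: matrix_eq flip: matrix_vector_mul_assoc)
  obtain L' where L': "L ** L' = mat 1" "L' ** L = mat 1"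
    using L(1) unfolding generic_cps_def invertible_def by blast
  have "L' ** T ** L = L' ** (T ** L)" by (simp only: matrix_mul_assoc)
  also have "\<dots> = R" unfolding TL by (simp add: matrix_mul_assoc L')
  finally have R: "R = L' ** T ** L" by simp
  have one: "cmat L' ** cmat L = mat 1"
    unfolding cmat_mult[symmetric] L' by (simp add: cmat_def mat_def vec_eq_iff)
  have "char_poly_c R = char_poly_c T"
    unfolding char_poly_c_char_matrix R cmat_mult by (rule det_char_matrix_conjugate[OF one])
  then have chR: "char_poly_c R = char_poly_c A * char_poly_c B"
    unfolding T_def char_matrix_block_diag .
  have cR: "cmat R = (\<chi> i j. of_rat (N $ i $ j))"
    by (simp add: cmat_def R_def of_real_of_rat)
  define p where "p = char_poly_c R"
  have p0: "p \<noteq> 0" unfolding p_def char_poly_c_char_matrix by (rule det_char_matrix_nonzero)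
  obtain g where g: "p = rpoly g"
    unfolding p_def char_poly_c_char_matrix cR char_poly_rational_matrix by blast
  have ordp: "order z p = mult z + order z (char_poly_c B)" for z
    using p0 unfolding p_def chR alg_mult_def by (subst order_mult) auto
  have "factor_mult A f \<le> order z p" if f: "f \<in> factors" and z: "z \<in> roots_Q f" for f z
  proof (rule ccontr)
    assume less: "\<not> factor_mult A f \<le> order z p"
    have const: "order w p = order z p" if "w \<in> roots_Q f" for w
      using order_rpoly_conj[OF factor_irreducible[OF f] that z] p0 unfolding g by simp
    have ge: "mult w \<le> order z p" if "w \<in> roots_Q f" for w
      using ordp[of w] const[OF that] by simp
    have "finite (mult ` roots_Q f)" "mult ` roots_Q f \<noteq> {}" using factor_roots_finite[OF f] z by auto
    \<comment> \<open>The common order on the roots of \<open>f\<close> is at least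
      \<open>M_max A f\<close>. If it is below \<open>factor_mult A f\<close>, only the cyclotomic
      branch with constant multiplicity is left, and the order is exactly that constant.\<close>
    then have Mo: "M_max A f \<le> order z p" unfolding M_max_def using ge by (subst Max_le_iff) auto
    then have eq: "M_max A f \<le> M_min A f" "order z p = M_max A f"
      using less unfolding factor_mult_def by (auto split: if_splits)
    \<comment> \<open>At the roots of \<open>f\<close> the order in the product is already exhausted
      by \<open>A\<close>, so \<open>B\<close> has no eigenvalue there.\<close>
    have B0: "order w (char_poly_c B) = 0" if "w \<in> roots_Q f" for w
      using ordp[of w] const[OF that] eq M_min_le_mult[OF f that] by linarith
    have cB0: "char_poly_c B \<noteq> 0" unfolding char_poly_c_char_matrix by (rule det_char_matrix_nonzero)
    have Binj: "v = 0" if w: "w \<in> roots_Q f" and v: "cmat B *v v = w *s v" for w v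
    proof (rule ccontr)
      assume "v \<noteq> 0"
      then have "poly (char_poly_c B) w = 0"
        unfolding char_poly_c_char_matrix char_poly_root_eigenvector using v by blast
      then show False using B0[OF w] cB0 by (simp add: order_root)
    qed
    obtain i where i: "d i \<in> roots_Q f" using factor_eigenvalue[OF f] by blast
    have "poly (char_poly_c A) (d i) = 0"
      using diagonalized_by_eigenvalue[OF diag] by (simp add: is_eigenvalue_def)
    then have "poly (det (char_matrix (\<chi> i j. of_rat (N $ i $ j)))) (d i) = 0"
      using chR by (simp add: char_poly_c_char_matrix cR)
    then obtain v where v: "v \<noteq> 0" "\<And>i. v $ i \<in> \<int>" "poly_act f N v = 0"
      using rational_kernel_vector i unfolding roots_Q_def by blast
    define u where "u = (\<chi> i. real_of_rat (v $ i))"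
    define c where "c y = (\<chi> j. complex_of_real (y $ j))" for y :: "real^'p"
    have Ru: "poly_act (map_poly of_rat f) R u = 0"
    proof -
      have "(\<chi> i. real_of_rat (poly_act f N v $ i)) = poly_act (map_poly of_rat f) R u"
        unfolding R_def u_def by (rule poly_act_hom) (auto simp: of_rat_add of_rat_mult)
      then show ?thesis using v(3) by (simp add: vec_eq_iff)
    qed
    have "pi_perp (L *v poly_act (map_poly of_rat f) R u) = poly_act (map_poly of_rat f) B (pi_perp (L *v u))"
      by (rule poly_act_intertwine[where \<phi> = "\<lambda>x. pi_perp (L *v x)"])
         (auto simp: R_def perp pi_perp_linear matrix_vector_right_distrib
           scalar_mult_eq_scaleR matrix_vector_mult_scaleR)
    then have Bu: "poly_act (map_poly of_rat f) B (pi_perp (L *v u)) = 0"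
      unfolding Ru by (simp add: linear_0[OF pi_perp_linear(4)])
    have "c (poly_act (map_poly of_rat f) B (pi_perp (L *v u))) =
        poly_act (map_poly of_real (map_poly of_rat f)) (cmat B) (c (pi_perp (L *v u)))"
      unfolding c_def cmat_def by (rule poly_act_hom) auto
    also have "map_poly of_real (map_poly real_of_rat f) = rpoly f"
      by (simp add: map_poly_map_poly o_def of_real_of_rat)
    finally have "poly_act (rpoly f) (cmat B) (c (pi_perp (L *v u))) = 0"
      unfolding Bu by (simp add: c_def vec_eq_iff)
    then have act0: "poly_act (\<Prod>z\<in>roots_Q f. [:- z, 1:]) (cmat B) (c (pi_perp (L *v u))) = 0"
      unfolding rpoly_irreducible_prod[OF factor_irreducible[OF f] factor_monic[OF f]] .
    have "c (pi_perp (L *v u)) = 0"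
    proof (rule poly_act_prod_roots_injective[OF _ _ act0])
      show "finite (roots_Q f)" by (rule factor_roots_finite[OF f])
      show "v = 0" if "w \<in> roots_Q f" "cmat B *v v = w *s v" for w v
        using that by (rule Binj)
    qed
    then have "pi_perp (L *v u) = 0" by (simp add: c_def vec_eq_iff)
    moreover have "L *v u \<in> lattice_of L"
    proof -
      have "u $ i \<in> \<int>" for i
        using v(2)[of i] by (auto simp: u_def elim!: Ints_cases)
      then show ?thesis by (auto simp: lattice_of_def)
    qed
    moreover have "0 \<in> lattice_of L" "pi_perp (0 :: real^('n + 'p)) = (0 :: real^'p)"
      using additive_subgroup_lattice_of[of L]
      by (auto simp: additive_subgroup_def linear_0[OF pi_perp_linear(4)])
    ultimately have "L *v u = 0"
      using L(1) unfolding generic_cps_def inj_on_def by metis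
    then have "L' *v (L *v u) = 0" by simp
    then have "u = 0" by (simp add: matrix_vector_mul_assoc L')
    then show False using v(1) by (simp add: u_def vec_eq_iff)
  qed
  then have "s_dim A \<le> degree p" by (rule order_ge_factor_mult_imp_s_dim_le[OF p0])
  also have "\<dots> \<le> CARD('n + 'p)"
    unfolding p_def char_poly_c_char_matrix by (rule degree_det_char_matrix_le)
  finally show ?thesis by simp
qed

end

section \<open>The lattice\<close>

lemma householder_sym: "householder t e j k = householder t e k j"
  by (simp add: householder_def add.commute)

text \<open>On the unit circle this is cosine plus sine. The values at \<open>z\<close> and
  \<open>cnj z\<close> together determine \<open>z\<close>, so a conjugation-symmetric family of
  complex numbers is encoded by one real number per index.\<close>

definition cas :: "complex \<Rightarrow> real" where
  "cas z = Re z + Im z"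

lemma cas_simps [simp]:
  "cas 0 = 0" "cas (x + y) = cas x + cas y" "cas (of_real r * x) = r * cas x"
  by (simp_all add: cas_def algebra_simps)

lemma cas_sum: "cas (sum g S) = (\<Sum>x\<in>S. cas (g x))"
  by (simp add: cas_def sum.distrib)

lemma cas_eq_0: "cas z = 0 \<Longrightarrow> cas (cnj z) = 0 \<Longrightarrow> z = 0"
  by (simp add: cas_def complex_eq_iff)

lemma cas_mult: "cas (z * v) = Re z * cas v + Im z * cas (cnj v)"
  by (simp add: cas_def algebra_simps)

lemma cas_complex: "complex_of_real (cas z) = ((1 - \<i>) * z + (1 + \<i>) * cnj z) / 2"
  by (simp add: cas_def complex_eq_iff)

context eigen_setup
begin

definition coeff_index :: "(rat poly \<times> nat \<times> nat) set" where
  "coeff_index = (SIGMA f:factors. {..<degree f} \<times> {..<factor_mult A f})"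

lemma finite_coeff_index: "finite coeff_index"
  unfolding coeff_index_def by auto

lemma card_coeff_index: "card coeff_index = s_dim A"
  unfolding coeff_index_def s_dim_def s_factor_eq
  by (subst card_SigmaI) (auto simp: card_cartesian_product mult.commute)

text \<open>The union of the rings \<open>\<int>[z]\<close>, not itself a ring: \<open>t\<close> has
  to avoid the polynomials over each \<open>\<int>[z]\<close>, and for this countability of the
  union is enough.\<close>

definition eigen_rings :: "complex set" where
  "eigen_rings = (\<Union>z\<in>all_roots. range (\<lambda>g. poly (zpoly g) z))"

lemma countable_eigen_rings: "countable eigen_rings"
proof -
  have "(UNIV :: int poly set) = range Poly" by (metis Poly_coeffs surjI)
  moreover have "countable (range (Poly :: int list \<Rightarrow> int poly))" by blast
  ultimately have "countable (UNIV :: int poly set)" by simp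
  then have "countable (range (\<lambda>g. poly (zpoly g) z))" for z by (rule countable_image)
  then show ?thesis unfolding eigen_rings_def
    using countable_finite[OF all_roots_finite] by (intro countable_UN) auto
qed

end

text \<open>\<open>\<alpha>\<close> and \<open>\<beta>\<close> label the coordinates of the two
  factors by eigenvalues with a running number, and \<open>\<psi>\<close> labels the standard basis
  of the integer vectors by monomials in the copies of \<open>\<int>[X]/(f)\<close>. The bijections
  fix the size of \<open>'p\<close>.\<close>

locale cps_construction = eigen_setup A P Q d
  for A :: "real^'n^'n" and P Q d +
  fixes \<alpha> :: "'n \<Rightarrow> complex \<times> nat" and \<beta> :: "'p::finite \<Rightarrow> complex \<times> nat"
    and \<psi> :: "'n + 'p \<Rightarrow> rat poly \<times> nat \<times> nat" and t :: real
  assumes \<alpha>: "bij_betw \<alpha> UNIV par_index" "fst (\<alpha> i) = d i"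
    and \<beta>: "bij_betw \<beta> UNIV (total_index - par_index)"
    and \<psi>: "bij_betw \<psi> UNIV coeff_index"
    and t: "\<And>p. p \<noteq> 0 \<Longrightarrow> \<forall>i. coeff p i \<in> eigen_rings \<Longrightarrow> poly p (of_real t) \<noteq> 0"
begin

definition \<phi> :: "'n + 'p \<Rightarrow> complex \<times> nat" where
  "\<phi> = case_sum \<alpha> \<beta>"

lemma \<phi>_total: "\<phi> r \<in> total_index"
  using \<alpha>(1) \<beta> par_subset_total
  by (cases r) (auto simp: \<phi>_def bij_betw_def)

lemma \<phi>_surj:
  assumes "x \<in> total_index"
  shows "\<exists>r. \<phi> r = x"
proof (cases "x \<in> par_index")
  case True
  then obtain i where "\<alpha> i = x" using \<alpha>(1) by (metis bij_betw_def imageE)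
  then show ?thesis by (intro exI[of _ "Inl i"]) (simp add: \<phi>_def)
next
  case False
  then have "x \<in> range \<beta>" using \<beta> assms by (auto simp: bij_betw_def)
  then obtain j where "\<beta> j = x" by blast
  then show ?thesis by (intro exI[of _ "Inr j"]) (simp add: \<phi>_def)
qed

abbreviation \<Theta> :: "rat poly \<Rightarrow> nat \<Rightarrow> nat \<Rightarrow> real" where
  "\<Theta> f \<equiv> householder t (factor_mult A f)"

definition pos :: "rat poly \<Rightarrow> nat \<Rightarrow> nat \<Rightarrow> 'n + 'p" where
  "pos f a k = inv \<psi> (f, a, k)"

lemma \<psi>_pos: "f \<in> factors \<Longrightarrow> a < degree f \<Longrightarrow> k < factor_mult A f \<Longrightarrow> \<psi> (pos f a k) = (f, a, k)"
  unfolding pos_def using \<psi> by (intro f_inv_into_f) (auto simp: bij_betw_def coeff_index_def)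

lemma pos_cases:
  obtains f a k where "f \<in> factors" "a < degree f" "k < factor_mult A f" "c = pos f a k"
proof -
  have "\<psi> c \<in> coeff_index" using \<psi> by (auto simp: bij_betw_def)
  then obtain f a k where "f \<in> factors" "a < degree f" "k < factor_mult A f" "\<psi> c = (f, a, k)"
    unfolding coeff_index_def by auto
  moreover from this have "c = pos f a k"
    using \<psi> unfolding pos_def by (metis bij_betw_def inv_f_f)
  ultimately show ?thesis using that by blast
qed

lemma sum_pos:
  "(\<Sum>c\<in>UNIV. g (\<psi> c) c) = (\<Sum>f\<in>factors. \<Sum>a<degree f. \<Sum>k<factor_mult A f. g (f, a, k) (pos f a k))"
proof -
  have "(\<Sum>c\<in>UNIV. g (\<psi> c) c) = (\<Sum>x\<in>coeff_index. g x (inv \<psi> x))"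
    using \<psi> by (subst sum.reindex_bij_betw[OF \<psi>, symmetric]) (simp add: bij_betw_def)
  also have "\<dots> = (\<Sum>f\<in>factors. \<Sum>(a, k)\<in>{..<degree f} \<times> {..<factor_mult A f}. g (f, a, k) (pos f a k))"
    unfolding coeff_index_def by (subst sum.Sigma) (auto simp: pos_def case_prod_unfold)
  also have "\<dots> = (\<Sum>f\<in>factors. \<Sum>a<degree f. \<Sum>k<factor_mult A f. g (f, a, k) (pos f a k))"
    by (simp add: sum.cartesian_product)
  finally show ?thesis .
qed

text \<open>Column \<open>(f, a, l)\<close> of \<open>X\<close> stands for \<open>X\<^sup>a\<close> in the \<open>l\<close>-th copy of \<open>\<int>[X]/(f)\<close>. For a coefficient
  vector \<open>x\<close>, \<open>G x f l z\<close> is the value at \<open>z\<close> of the polynomial in the \<open>l\<close>-th copy, \<open>V x f k z\<close> the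
  \<open>k\<close>-th rotated eigencoordinate, and \<open>X x\<close> collects the real numbers \<open>Re V + Im V\<close>.\<close>
definition X :: "real^('n + 'p)^('n + 'p)" where
  "X = (\<chi> r c. if fst (\<phi> r) \<in> roots_Q (fst (\<psi> c))
     then \<Theta> (fst (\<psi> c)) (snd (\<phi> r)) (snd (snd (\<psi> c))) * cas (fst (\<phi> r) ^ fst (snd (\<psi> c))) else 0)"

definition G :: "real^('n + 'p) \<Rightarrow> rat poly \<Rightarrow> nat \<Rightarrow> complex \<Rightarrow> complex" where
  "G x f k z = (\<Sum>a<degree f. of_real (x $ pos f a k) * z ^ a)"

definition V :: "real^('n + 'p) \<Rightarrow> rat poly \<Rightarrow> nat \<Rightarrow> complex \<Rightarrow> complex" where
  "V x f k z = (\<Sum>l<factor_mult A f. of_real (\<Theta> f k l) * G x f l z)"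

lemma V_cnj: "V x f k (cnj z) = cnj (V x f k z)"
  by (simp add: V_def G_def)

lemma X_mult:
  assumes f: "f \<in> factors" "z \<in> roots_Q f" and r: "\<phi> r = (z, k)"
  shows "(X *v x) $ r = cas (V x f k z)"
proof -
  have "(X *v x) $ r = (\<Sum>c\<in>UNIV. (if z \<in> roots_Q (fst (\<psi> c))
     then \<Theta> (fst (\<psi> c)) k (snd (snd (\<psi> c))) * cas (z ^ fst (snd (\<psi> c))) else 0) * x $ c)"
    unfolding X_def matrix_vector_mult_def vec_lambda_beta r fst_conv snd_conv ..
  also have "\<dots> = (\<Sum>g\<in>factors. \<Sum>a<degree g. \<Sum>l<factor_mult A g.
      (if z \<in> roots_Q g then \<Theta> g k l * cas (z ^ a) else 0) * x $ pos g a l)"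
    using sum_pos[of "\<lambda>y c. (if z \<in> roots_Q (fst y)
     then \<Theta> (fst y) k (snd (snd y)) * cas (z ^ fst (snd y)) else 0) * x $ c"]
    unfolding fst_conv snd_conv .
  also have "\<dots> = (\<Sum>g\<in>factors. if g = f then
      (\<Sum>a<degree f. \<Sum>l<factor_mult A f. \<Theta> f k l * cas (z ^ a) * x $ pos f a l) else 0)"
  proof (intro sum.cong refl)
    fix g assume "g \<in> factors"
    then have "z \<in> roots_Q g \<longleftrightarrow> g = f" using factor_unique[OF f(1) _ f(2)] f by blast
    then show "(\<Sum>a<degree g. \<Sum>l<factor_mult A g.
        (if z \<in> roots_Q g then \<Theta> g k l * cas (z ^ a) else 0) * x $ pos g a l) =
      (if g = f then \<Sum>a<degree f. \<Sum>l<factor_mult A f. \<Theta> f k l * cas (z ^ a) * x $ pos f a l else 0)"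
      by (cases "g = f") simp_all
  qed
  also have "\<dots> = (\<Sum>a<degree f. \<Sum>l<factor_mult A f. \<Theta> f k l * cas (z ^ a) * x $ pos f a l)"
    using f(1) by (subst sum.delta) auto
  also have "\<dots> = cas (V x f k z)"
    unfolding V_def G_def cas_sum cas_simps
    by (subst sum.swap) (simp add: sum_distrib_left mult_ac)
  finally show ?thesis .
qed

lemma G_from_V:
  assumes "l < factor_mult A f"
  shows "G x f l z = (\<Sum>k<factor_mult A f. of_real (\<Theta> f l k) * V x f k z)"
proof -
  let ?e = "factor_mult A f"
  have "(\<Sum>k<?e. of_real (\<Theta> f l k) * V x f k z) =
     (\<Sum>m<?e. \<Sum>k<?e. of_real (\<Theta> f l k * \<Theta> f k m) * G x f m z)"
    unfolding V_def by (subst sum.swap) (simp add: sum_distrib_left mult_ac)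
  also have "\<dots> = (\<Sum>m<?e. of_real (\<Sum>k<?e. \<Theta> f l k * \<Theta> f k m) * G x f m z)"
    by (simp add: sum_distrib_right)
  also have "\<dots> = (\<Sum>m<?e. if l = m then G x f m z else 0)"
    using assms by (intro sum.cong refl) (simp add: householder_involution)
  also have "\<dots> = G x f l z" using assms by simp
  finally show ?thesis by simp
qed

text \<open>In each copy the entries of \<open>x\<close> are the coefficients of a polynomial of
  degree below \<open>degree f\<close>, which cannot vanish at \<open>degree f\<close> distinct
  roots.\<close>

lemma G_zero_imp_zero:
  assumes "\<And>f k z. f \<in> factors \<Longrightarrow> k < factor_mult A f \<Longrightarrow> z \<in> roots_Q f \<Longrightarrow> G x f k z = 0"
  shows "x = 0"
  unfolding vec_eq_iff
proof
  fix c
  obtain f a k where fak: "f \<in> factors" "a < degree f" "k < factor_mult A f" "c = pos f a k"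
    using pos_cases .
  define q where "q = (\<Sum>a<degree f. monom (complex_of_real (x $ pos f a k)) a)"
  have ev: "poly q z = G x f k z" for z by (simp add: q_def G_def poly_sum poly_monom)
  have "q = 0"
  proof (rule ccontr)
    assume "q \<noteq> 0"
    have "degree q < degree f"
      unfolding q_def using fak(2) by (intro degree_sum_less) (auto intro: le_less_trans[OF degree_monom_le])
    moreover have "roots_Q f \<subseteq> {z. poly q z = 0}" using assms fak ev by auto
    then have "card (roots_Q f) \<le> card {z. poly q z = 0}"
      by (rule card_mono[OF poly_roots_finite[OF \<open>q \<noteq> 0\<close>]])
    then have "degree f \<le> degree q"
      using card_poly_roots_bound[OF \<open>q \<noteq> 0\<close>] card_roots_Q[OF factor_irreducible[OF fak(1)]] by simp
    ultimately show False by simp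
  qed
  then have "coeff q a = 0" by simp
  then have "complex_of_real (x $ pos f a k) = 0" using fak(2) by (simp add: q_def coeff_sum)
  then show "x $ c = 0 $ c" using fak(4) by simp
qed

lemma total_index_iff:
  assumes "f \<in> factors" "z \<in> roots_Q f"
  shows "(z, k) \<in> total_index \<longleftrightarrow> k < factor_mult A f"
  using assms root_mult_eq[OF assms] by (auto simp: total_index_def all_roots_def)

lemma V_zero:
  assumes "f \<in> factors" "z \<in> roots_Q f" "\<phi> r = (z, k)" "\<phi> r' = (cnj z, k)"
    "(X *v x) $ r = 0" "(X *v x) $ r' = 0"
  shows "V x f k z = 0"
  using assms X_mult[of f z r k x] X_mult[of f "cnj z" r' k x] roots_Q_cnj
  by (intro cas_eq_0) (auto simp: V_cnj)

lemma X_injective: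
  assumes "X *v x = 0"
  shows "x = 0"
proof (rule G_zero_imp_zero)
  fix f l z assume f: "f \<in> factors" "l < factor_mult A f" "z \<in> roots_Q f"
  have "V x f k z = 0" if "k < factor_mult A f" for k
  proof -
    have "(z, k) \<in> total_index" "(cnj z, k) \<in> total_index"
      using f that roots_Q_cnj total_index_iff by auto
    then obtain r r' where "\<phi> r = (z, k)" "\<phi> r' = (cnj z, k)" using \<phi>_surj by metis
    then show ?thesis using V_zero f assms by simp
  qed
  then show "G x f l z = 0" by (simp add: G_from_V[OF f(2)])
qed

section \<open>Injectivity of the two projections on integer vectors\<close>

lemma G_integral:
  assumes "\<forall>i. x $ i \<in> \<int>"
  shows "\<exists>g. \<forall>z. G x f k z = poly (zpoly g) z"
proof -
  define g where "g = (\<Sum>a<degree f. monom \<lfloor>x $ pos f a k\<rfloor> a)"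
  have i: "real_of_int \<lfloor>x $ c\<rfloor> = x $ c" for c using assms by (auto elim: Ints_cases)
  have zs: "zpoly (sum h S) = (\<Sum>x\<in>S. zpoly (h x))" for h :: "nat \<Rightarrow> int poly" and S
    by (induction S rule: infinite_finite_induct) auto
  have "G x f k z = poly (zpoly g) z" for z
  proof -
    have "G x f k z = (\<Sum>a<degree f. of_real (of_int \<lfloor>x $ pos f a k\<rfloor>) * z ^ a)"
      by (simp only: G_def i)
    then show ?thesis by (simp add: g_def zs map_poly_monom poly_sum poly_monom)
  qed
  then show ?thesis by blast
qed

text \<open>Genericity of \<open>t\<close> over \<open>\<int>[z]\<close> kills every
  \<open>h l\<close> at \<open>z\<close>, and irreducibility of \<open>f\<close> carries the zero to
  each conjugate \<open>w\<close>. Both injectivity and density reduce to this.\<close>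

lemma generic_combination_zero:
  assumes f: "f \<in> factors" "z \<in> roots_Q f" and k: "k < factor_mult A f"
    and h: "(\<Sum>l<factor_mult A f. of_real (\<Theta> f k l) * poly (zpoly (h l)) z) = 0"
    and l: "l < factor_mult A f" and w: "w \<in> roots_Q f"
  shows "poly (zpoly (h l)) w = 0"
proof -
  let ?C = "range (\<lambda>g. poly (zpoly g) z)"
  have "poly (zpoly (h l)) z = 0"
  proof (rule householder_generic[where C = ?C and y = "\<lambda>l. poly (zpoly (h l)) z", OF _ _ _ _ k h l])
    show "0 \<in> ?C" by (auto intro!: range_eqI[of _ _ 0])
    show "a - b \<in> ?C" if ab: "a \<in> ?C" "b \<in> ?C" for a b
    proof -
      obtain u v where "a = poly (zpoly u) z" "b = poly (zpoly v) z" using ab by blast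
      then have "a - b = poly (zpoly (u - v)) z" by simp
      then show ?thesis by blast
    qed
    have sub: "?C \<subseteq> eigen_rings" using f by (auto simp: eigen_rings_def all_roots_def)
    show "poly p (of_real t) \<noteq> 0" if "p \<noteq> 0" "\<forall>i. coeff p i \<in> ?C" for p
    proof (rule t[OF that(1)])
      show "\<forall>i. coeff p i \<in> eigen_rings" using that(2) sub by (meson subsetD)
    qed
  qed blast
  then have "poly (rpoly (zrpoly (h l))) z = 0" by simp
  then have "poly (rpoly (zrpoly (h l))) w = 0"
    using irreducible_rat_conj_root[OF factor_irreducible[OF f(1)]] f(2) w unfolding roots_Q_def by blast
  then show ?thesis by simp
qed

text \<open>One eigencoordinate per factor suffices. The coordinate at \<open>cnj z\<close> is
  included because \<open>cas\<close> has to vanish at a number and at its conjugate before the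
  number is known to be 0.\<close>

lemma integral_vanishing:
  assumes x: "\<forall>i. x $ i \<in> \<int>"
    and S: "\<And>f. f \<in> factors \<Longrightarrow> \<exists>z\<in>roots_Q f. \<exists>k<factor_mult A f.
        \<forall>r. \<phi> r = (z, k) \<or> \<phi> r = (cnj z, k) \<longrightarrow> (X *v x) $ r = 0"
  shows "x = 0"
proof (rule G_zero_imp_zero)
  fix f l w assume f: "f \<in> factors" "l < factor_mult A f" "w \<in> roots_Q f"
  obtain z k where z: "z \<in> roots_Q f" "k < factor_mult A f"
    and 0: "\<And>r. \<phi> r = (z, k) \<or> \<phi> r = (cnj z, k) \<Longrightarrow> (X *v x) $ r = 0" using S[OF f(1)] by blast
  obtain r r' where r: "\<phi> r = (z, k)" "\<phi> r' = (cnj z, k)"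
    using \<phi>_surj z f(1) roots_Q_cnj total_index_iff by metis
  have V0: "V x f k z = 0" using V_zero[OF f(1) z(1) r] 0 r by blast
  obtain h where h: "\<And>l z. G x f l z = poly (zpoly (h l)) z" using G_integral[OF x] by metis
  show "G x f l w = 0"
    using generic_combination_zero[OF f(1) z(1,2) _ f(2,3), of h] V0 unfolding V_def h by blast
qed

lemma pi_par_X_injective:
  assumes "\<forall>i. x $ i \<in> \<int>" "pi_par (X *v x) = 0"
  shows "x = 0"
proof (rule integral_vanishing[OF assms(1)])
  fix f assume f: "f \<in> factors"
  \<comment> \<open>A root that is an eigenvalue of \<open>A\<close> owns the index
    \<open>(z, 0)\<close> of the first factor.\<close>
  obtain z where z: "z \<in> roots_Q f" "mult z > 0" using factor_eigenvalue_root[OF f] by blast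
  have "(z, 0) \<in> par_index" "(cnj z, 0) \<in> par_index"
    using z roots_Q_cnj f by (auto simp: par_index_def all_roots_def alg_mult_cnj)
  moreover have "(X *v x) $ r = 0" if "\<phi> r \<in> par_index" for r
    using assms(2) \<beta> that by (cases r) (auto simp: pi_par_def vec_eq_iff \<phi>_def bij_betw_def)
  moreover have "0 < factor_mult A f" using mult_le_factor_mult[OF f z(1)] z(2) by simp
  ultimately show "\<exists>z\<in>roots_Q f. \<exists>k<factor_mult A f.
      \<forall>r. \<phi> r = (z, k) \<or> \<phi> r = (cnj z, k) \<longrightarrow> (X *v x) $ r = 0"
    using z(1) by metis
qed

lemma pi_perp_X_injective:
  assumes "\<forall>i. x $ i \<in> \<int>" "pi_perp (X *v x) = 0"
  shows "x = 0"
proof (rule integral_vanishing[OF assms(1)])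
  fix f assume f: "f \<in> factors"
  \<comment> \<open>At a deficient root, \<open>(z, mult z)\<close> is the first index not given to
    \<open>A\<close>.\<close>
  obtain z where z: "z \<in> roots_Q f" "mult z < factor_mult A f" using deficient_root[OF f] by blast
  have "(z, mult z) \<notin> par_index" "(cnj z, mult z) \<notin> par_index"
    by (simp_all add: par_index_def alg_mult_cnj)
  moreover have "(X *v x) $ r = 0" if "\<phi> r \<notin> par_index" for r
    using assms(2) \<alpha>(1) that by (cases r) (auto simp: pi_perp_def vec_eq_iff \<phi>_def bij_betw_def)
  ultimately show "\<exists>z\<in>roots_Q f. \<exists>k<factor_mult A f.
      \<forall>r. \<phi> r = (z, k) \<or> \<phi> r = (cnj z, k) \<longrightarrow> (X *v x) $ r = 0"
    using z by metis
qed

text \<open>The witness is multiplication by the indeterminate modulo each \<open>f\<close>.\<close>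
lemma integral_shift:
  assumes x: "\<forall>i. x $ i \<in> \<int>"
  shows "\<exists>x'. (\<forall>i. x' $ i \<in> \<int>) \<and>
    (\<forall>f\<in>factors. \<forall>z\<in>roots_Q f. \<forall>k. V x' f k z = z * V x f k z)"
proof -
  \<comment> \<open>Coefficients of \<open>X g\<close> minus the top coefficient of \<open>g\<close>
    times \<open>f\<close>. The case \<open>a = 0\<close> guards against the truncated
    \<open>a - 1\<close>; the result is integral because \<open>f\<close> has integer
    coefficients.\<close>
  define y where "y = (\<lambda>(f, a, k). (if a = 0 then 0 else x $ pos f (a - 1) k)
      - real_of_rat (coeff f a) * x $ pos f (degree f - 1) k)"
  define x' where "x' = (\<chi> c. y (\<psi> c))"
  have "x' $ c \<in> \<int>" for c
  proof -
    obtain f a k where c: "f \<in> factors" "a < degree f" "k < factor_mult A f" "c = pos f a k"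
      using pos_cases .
    obtain F where F: "f = zrpoly F" using factor_integral[OF c(1)] by blast
    have "real_of_rat (coeff f a) \<in> \<int>" by (simp add: F)
    then show ?thesis using x c \<psi>_pos by (auto simp: x'_def y_def intro!: Ints_diff Ints_mult)
  qed
  moreover have "V x' f k z = z * V x f k z" if f: "f \<in> factors" and z: "z \<in> roots_Q f" for f k z
  proof -
    have "G x' f l z = z * G x f l z" if l: "l < factor_mult A f" for l
    proof -
      obtain m where m: "degree f = Suc m"
        using irreducible_rat_degree_pos[OF factor_irreducible[OF f]] by (metis Suc_pred)
      have x': "x' $ pos f a l = (if a = 0 then 0 else x $ pos f (a - 1) l)
          - real_of_rat (coeff f a) * x $ pos f m l" if "a < Suc m" for a
        using \<psi>_pos[OF f _ l] that m by (simp add: x'_def y_def)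
      have "poly (rpoly f) z = 0" using z by (simp add: roots_Q_def)
      then have "(\<Sum>a<Suc m. of_rat (coeff f a) * z ^ a) + z ^ Suc m = 0"
        using factor_monic[OF f] by (simp add: poly_altdef m lessThan_Suc_atMost[symmetric] add.commute)
      then have zd: "(\<Sum>a<Suc m. of_rat (coeff f a) * z ^ a) = - (z ^ Suc m)"
        by (simp add: add_eq_0_iff del: sum.lessThan_Suc)
      have "G x' f l z = (\<Sum>a<Suc m. of_real (if a = 0 then 0 else x $ pos f (a - 1) l) * z ^ a
           - of_real (x $ pos f m l) * (of_rat (coeff f a) * z ^ a))"
        unfolding G_def m by (intro sum.cong refl) (simp add: x' algebra_simps of_real_of_rat del: sum.lessThan_Suc)
      also have "\<dots> = (\<Sum>a<Suc m. of_real (if a = 0 then 0 else x $ pos f (a - 1) l) * z ^ a)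
          + of_real (x $ pos f m l) * z ^ Suc m"
        by (simp add: sum_subtractf sum_distrib_left[symmetric] zd del: sum.lessThan_Suc)
      also have "(\<Sum>a<Suc m. of_real (if a = 0 then 0 else x $ pos f (a - 1) l) * z ^ a)
          = (\<Sum>a<m. of_real (x $ pos f a l) * z ^ Suc a)"
        by (subst sum.lessThan_Suc_shift) simp
      also have "\<dots> + of_real (x $ pos f m l) * z ^ Suc m = z * G x f l z"
        unfolding G_def m by (simp add: sum_distrib_left algebra_simps)
      finally show ?thesis .
    qed
    then show ?thesis unfolding V_def by (simp add: sum_distrib_left mult_ac)
  qed
  ultimately show ?thesis by blast
qed

end

section \<open>Density and invariance\<close>

context cps_construction
begin

section \<open>Density of the second projection of the lattice\<close>

lemma pderiv_factor_nonzero: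
  assumes "f \<in> factors" "z \<in> roots_Q f"
  shows "poly (pderiv (rpoly f)) z \<noteq> 0"
  using irreducible_rat_rsquarefree[OF factor_irreducible[OF assms(1)]] assms(2)
  by (auto simp: rsquarefree_roots roots_Q_def)

text \<open>Extension by zero to all indices, so that sums run over full sets of roots and full rows
  of the rotation.\<close>

definition perp_weight :: "real^'p \<Rightarrow> complex \<times> nat \<Rightarrow> real" where
  "perp_weight w x = (if x \<in> range \<beta> then w $ inv \<beta> x else 0)"

lemma perp_weight_\<beta>: "perp_weight w (\<beta> j) = w $ j"
  unfolding perp_weight_def using bij_betw_imp_inj_on[OF \<beta>] by simp

lemma perp_weight_par: "x \<in> par_index \<Longrightarrow> perp_weight w x = 0"
  using \<beta> by (auto simp: perp_weight_def bij_betw_def)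

lemma inner_pi_perp_X_axis:
  assumes f: "f \<in> factors" and a: "a < degree f" and l: "l < factor_mult A f"
  shows "w \<bullet> pi_perp (X *v axis (pos f a l) 1) =
    (\<Sum>z\<in>roots_Q f. \<Sum>k<factor_mult A f. \<Theta> f k l * cas (z ^ a) * perp_weight w (z, k))"
proof -
  define g where "g x = (if fst x \<in> roots_Q f then \<Theta> f (snd x) l * cas (fst x ^ a) else 0) * perp_weight w x" for x
  have "w \<bullet> pi_perp (X *v axis (pos f a l) 1) = (\<Sum>j\<in>UNIV. w $ j * X $ Inr j $ pos f a l)"
    by (simp add: inner_vec_def pi_perp_def matrix_vector_mult_basis column_def)
  also have "\<dots> = (\<Sum>j\<in>UNIV. g (\<beta> j))"
    by (intro sum.cong refl) (simp add: X_def \<psi>_pos[OF assms] \<phi>_def g_def perp_weight_\<beta>)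
  also have "\<dots> = (\<Sum>x\<in>total_index - par_index. g x)"
    by (rule sum.reindex_bij_betw[OF \<beta>])
  also have "\<dots> = (\<Sum>x\<in>total_index. g x)"
    using finite_total_index by (intro sum.mono_neutral_left) (auto simp: g_def perp_weight_par)
  also have "\<dots> = (\<Sum>x\<in>roots_Q f \<times> {..<factor_mult A f}. g x)"
  proof (rule sum.mono_neutral_right[OF finite_total_index])
    show "roots_Q f \<times> {..<factor_mult A f} \<subseteq> total_index"
      using total_index_iff[OF f] by auto
    show "\<forall>x\<in>total_index - roots_Q f \<times> {..<factor_mult A f}. g x = 0"
    proof
      fix x assume x: "x \<in> total_index - roots_Q f \<times> {..<factor_mult A f}"
      obtain z k where zk: "x = (z, k)" by (cases x)
      have "z \<notin> roots_Q f" using x zk total_index_iff[OF f, of z k] by auto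
      then show "g x = 0" by (simp add: g_def zk)
    qed
  qed
  also have "\<dots> = (\<Sum>z\<in>roots_Q f. \<Sum>k<factor_mult A f. g (z, k))"
    by (simp add: sum.cartesian_product)
  also have "\<dots> = (\<Sum>z\<in>roots_Q f. \<Sum>k<factor_mult A f. \<Theta> f k l * cas (z ^ a) * perp_weight w (z, k))"
    by (intro sum.cong refl) (simp add: g_def)
  finally show ?thesis .
qed

text \<open>A functional on the second factor that is integral on the lattice is, on each factor \<open>f\<close>,
  a trace-type form \<open>X\<^sup>a \<mapsto> \<Sum> z\<^sup>a y(z)\<close> whose density satisfies \<open>f'(z) y(z) \<in> \<int>[z]\<close>. The form does
  not see the coordinates in \<open>par_index\<close>, so genericity of \<open>t\<close> forces \<open>y = 0\<close>.\<close>
lemma integral_functional_zero: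
  assumes w: "\<And>x. (\<forall>i. x $ i \<in> \<int>) \<Longrightarrow> w \<bullet> pi_perp (X *v x) \<in> \<int>"
  shows "w = 0"
proof -
  define W where "W = perp_weight w"
  \<comment> \<open>Complex weights replacing the real \<open>W\<close>: by
    \<open>cas_complex\<close> and reindexing along \<open>cnj\<close>, summing
    \<open>cas (z ^ a)\<close> against \<open>W\<close> equals summing \<open>z ^ a\<close> against
    \<open>C\<close>.\<close>
  define C where "C z k = ((1 - \<i>) * of_real (W (z, k)) + (1 + \<i>) * of_real (W (cnj z, k))) / 2" for z k
  have C0: "W (z, k) = 0" if "C z k = 0" for z k
    using that by (simp add: C_def complex_eq_iff)
  have main: "W (z, k) = 0" if f: "f \<in> factors" and z: "z \<in> roots_Q f" and k: "k < factor_mult A f" for f z k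
  proof -
    let ?e = "factor_mult A f"
    let ?R = "roots_Q f"
    have finR: "finite ?R" using factor_roots_finite[OF f] .
    define y where "y z l = (\<Sum>k<?e. of_real (\<Theta> f k l) * C z k)" for z l
    define N where "N a l = w \<bullet> pi_perp (X *v axis (pos f a l) 1)" for a l
    define n where "n a l = \<lfloor>N a l\<rfloor>" for a l
    have Nint: "N a l = of_int (n a l)" for a l
    proof -
      have "N a l \<in> \<int>" unfolding N_def by (rule w) (auto simp: axis_def)
      then show ?thesis unfolding n_def by (auto elim: Ints_cases)
    qed
    have cnjR: "bij_betw cnj ?R ?R"
      by (rule bij_betw_byWitness[where f' = cnj]) (auto intro: roots_Q_cnj)
    have Nsum: "complex_of_real (N a l) = (\<Sum>z\<in>?R. z ^ a * y z l)" if al: "a < degree f" "l < ?e" for a l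
    proof -
      define U where "U z = (\<Sum>k<?e. \<Theta> f k l * W (z, k))" for z
      have "N a l = (\<Sum>z\<in>?R. cas (z ^ a) * U z)"
        unfolding N_def inner_pi_perp_X_axis[OF f al] U_def W_def by (simp add: sum_distrib_left mult_ac)
      then have "complex_of_real (N a l) = (\<Sum>z\<in>?R. (1 - \<i>) / 2 * (z ^ a * of_real (U z)))
          + (\<Sum>z\<in>?R. (1 + \<i>) / 2 * (cnj z ^ a * of_real (U z)))"
        by (simp add: cas_complex sum.distrib[symmetric]) (simp add: field_simps)
      also have "(\<Sum>z\<in>?R. (1 + \<i>) / 2 * (cnj z ^ a * of_real (U z)))
          = (\<Sum>z\<in>?R. (1 + \<i>) / 2 * (z ^ a * of_real (U (cnj z))))"
        using sum.reindex_bij_betw[OF cnjR, of "\<lambda>z. (1 + \<i>) / 2 * (z ^ a * of_real (U (cnj z)))"] by simp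
      also have "(\<Sum>z\<in>?R. (1 - \<i>) / 2 * (z ^ a * of_real (U z))) + \<dots> = (\<Sum>z\<in>?R. z ^ a * y z l)"
      proof -
        have "y z l = (1 - \<i>) / 2 * of_real (U z) + (1 + \<i>) / 2 * of_real (U (cnj z))" for z
          by (simp add: y_def U_def C_def sum_distrib_left sum.distrib[symmetric])
             (intro sum.cong refl, simp add: field_simps)
        then show ?thesis by (simp add: sum.distrib[symmetric] algebra_simps)
      qed
      finally show ?thesis .
    qed
    obtain F where F: "f = zrpoly F" using factor_integral[OF f] by blast
    \<comment> \<open>The dual basis formula as an integer polynomial; by
      \<open>power_sum_dual_eval\<close> its value at a root \<open>u\<close> is
      \<open>y u l * f'(u)\<close>.\<close>
    define h where "h l = (\<Sum>b\<le>degree f. \<Sum>a<b. monom (coeff F b * n a l) (b - 1 - a))" for l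
    have zs: "zpoly (sum g S) = (\<Sum>x\<in>S. zpoly (g x))" for g :: "nat \<Rightarrow> int poly" and S
      by (induction S rule: infinite_finite_induct) auto
    have h: "poly (zpoly (h l)) u = y u l * poly (pderiv (rpoly f)) u" if u: "u \<in> ?R" and l: "l < ?e" for u l
    proof -
      have "poly (zpoly (h l)) u = (\<Sum>b\<le>degree (rpoly f). coeff (rpoly f) b * (\<Sum>a<b. of_real (N a l) * u ^ (b - 1 - a)))"
        by (simp add: h_def zs poly_sum map_poly_monom poly_monom F Nint sum_distrib_left mult_ac)
      also have "\<dots> = y u l * poly (pderiv (rpoly f)) u"
        by (rule power_sum_dual_eval[OF finR _ u]) (simp_all add: roots_Q_def Nsum[unfolded roots_Q_def] l)
      finally show ?thesis .
    qed
    have Cy: "C u m = (\<Sum>l<?e. of_real (\<Theta> f m l) * y u l)" if "m < ?e" for u m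
    proof -
      have "(\<Sum>l<?e. of_real (\<Theta> f m l) * y u l) = (\<Sum>k<?e. \<Sum>l<?e. of_real (\<Theta> f m l * \<Theta> f l k) * C u k)"
        unfolding y_def by (subst sum.swap) (simp add: sum_distrib_left mult_ac householder_sym)
      also have "\<dots> = (\<Sum>k<?e. of_real (\<Sum>l<?e. \<Theta> f m l * \<Theta> f l k) * C u k)"
        by (simp add: sum_distrib_right)
      also have "\<dots> = (\<Sum>k<?e. if m = k then C u k else 0)"
        using that by (intro sum.cong refl) (simp add: householder_involution)
      also have "\<dots> = C u m" using that by simp
      finally show ?thesis by simp
    qed
    \<comment> \<open>At an eigenvalue \<open>u\<close> of \<open>A\<close> the index
      \<open>(u, 0)\<close> belongs to the first factor, where the weights are zero. So row 0 of the
      rotation supplies the linear relation that genericity excludes.\<close>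
    obtain u where u: "u \<in> ?R" "mult u > 0" using factor_eigenvalue_root[OF f] by blast
    have e0: "0 < ?e" using mult_le_factor_mult[OF f u(1)] u(2) by simp
    have "(u, 0) \<in> par_index" "(cnj u, 0) \<in> par_index"
      using u roots_Q_cnj f by (auto simp: par_index_def all_roots_def alg_mult_cnj)
    then have "C u 0 = 0" by (simp add: C_def W_def perp_weight_par)
    moreover have "(\<Sum>l<?e. of_real (\<Theta> f 0 l) * poly (zpoly (h l)) u) =
        (\<Sum>l<?e. of_real (\<Theta> f 0 l) * y u l) * poly (pderiv (rpoly f)) u"
      unfolding sum_distrib_right by (intro sum.cong refl) (simp add: h u(1))
    ultimately have "(\<Sum>l<?e. of_real (\<Theta> f 0 l) * poly (zpoly (h l)) u) = 0"
      using Cy[OF e0, of u] by simp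
    then have "poly (zpoly (h l)) v = 0" if "l < ?e" "v \<in> ?R" for l v
      using generic_combination_zero[OF f u(1) e0 _ that] by blast
    then have "y v l = 0" if "l < ?e" "v \<in> ?R" for l v
      using h that pderiv_factor_nonzero[OF f that(2)] by auto
    then have "C z k = 0" using z by (simp add: Cy[OF k])
    then show ?thesis by (rule C0)
  qed
  show ?thesis
    unfolding vec_eq_iff
  proof
    fix j
    have "\<beta> j \<in> total_index" using \<beta> by (auto simp: bij_betw_def)
    then obtain z k f where "\<beta> j = (z, k)" "f \<in> factors" "z \<in> roots_Q f" "k < factor_mult A f"
      using total_index_iff by (force simp: total_index_def all_roots_def)
    then show "w $ j = 0 $ j" using main perp_weight_\<beta>[of w j] by (simp add: W_def)
  qed
qed

section \<open>Invariance of the constructed cut-and-project set\<close>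

lemma conj_involution:
  fixes \<gamma> :: "'m \<Rightarrow> complex \<times> nat"
  assumes "bij_betw \<gamma> UNIV S" "\<And>z k. (z, k) \<in> S \<Longrightarrow> (cnj z, k) \<in> S"
  obtains \<sigma> where "\<And>i. \<gamma> (\<sigma> i) = (cnj (fst (\<gamma> i)), snd (\<gamma> i))" "\<And>i. \<sigma> (\<sigma> i) = i"
proof -
  define \<sigma> where "\<sigma> i = inv \<gamma> (cnj (fst (\<gamma> i)), snd (\<gamma> i))" for i
  have 1: "\<gamma> (\<sigma> i) = (cnj (fst (\<gamma> i)), snd (\<gamma> i))" for i
  proof -
    have "(cnj (fst (\<gamma> i)), snd (\<gamma> i)) \<in> range \<gamma>"
      using assms by (auto simp: bij_betw_def)
    then show ?thesis unfolding \<sigma>_def by (rule f_inv_into_f)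
  qed
  moreover have "\<gamma> (\<sigma> (\<sigma> i)) = \<gamma> i" for i by (simp add: 1)
  then have "\<sigma> (\<sigma> i) = i" for i using assms(1) by (metis bij_betw_def injD)
  ultimately show ?thesis using that by blast
qed

lemma total_index_cnj: "(z, k) \<in> total_index \<Longrightarrow> (cnj z, k) \<in> total_index"
  by (auto simp: total_index_def all_roots_cnj root_mult_cnj)

lemma par_index_cnj: "(z, k) \<in> par_index \<longleftrightarrow> (cnj z, k) \<in> par_index"
  using all_roots_cnj[of z] all_roots_cnj[of "cnj z"] by (auto simp: par_index_def alg_mult_cnj)

lemma perp_index_contracting:
  assumes "(z, k) \<in> total_index - par_index"
  shows "cmod z \<le> 1"
proof (rule ccontr)
  assume "\<not> cmod z \<le> 1"
  moreover obtain f where f: "f \<in> factors" "z \<in> roots_Q f" using assms by (auto simp: total_index_def all_roots_def)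
  ultimately have "mult z = root_mult z" using expanding_root_factor_mult root_mult_eq by simp
  then show False using assms by (auto simp: total_index_def par_index_def)
qed

text \<open>Multiplication of an eigencoordinate by \<open>z\<close> reads, in \<open>cas\<close>
  coordinates, as \<open>Re z\<close> times the coordinate plus \<open>Im z\<close> times the one at
  \<open>cnj z\<close>, which is what \<open>conj_block\<close> does.\<close>

lemma shift_conj_block:
  assumes x: "\<forall>i. x $ i \<in> \<int>"
    and \<sigma>: "\<And>i. \<alpha> (\<sigma> i) = (cnj (fst (\<alpha> i)), snd (\<alpha> i))"
    and \<tau>: "\<And>j. \<beta> (\<tau> j) = (cnj (fst (\<beta> j)), snd (\<beta> j))"
  shows "\<exists>x'. (\<forall>i. x' $ i \<in> \<int>) \<and> pi_par (X *v x') = conj_block \<sigma> d *v pi_par (X *v x) \<and>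
    pi_perp (X *v x') = conj_block \<tau> (\<lambda>j. fst (\<beta> j)) *v pi_perp (X *v x)"
proof -
  obtain x' where x': "\<forall>i. x' $ i \<in> \<int>"
    "\<And>f z k. f \<in> factors \<Longrightarrow> z \<in> roots_Q f \<Longrightarrow> V x' f k z = z * V x f k z"
    using integral_shift[OF x] by blast
  have *: "(X *v x') $ r = Re z * (X *v x) $ r + Im z * (X *v x) $ r'"
    if r: "\<phi> r = (z, k)" "\<phi> r' = (cnj z, k)" for r r' z k
  proof -
    obtain f where f: "f \<in> factors" "z \<in> roots_Q f"
      using \<phi>_total[of r] r by (auto simp: total_index_def all_roots_def)
    then show ?thesis
      using X_mult[OF f r(1)] X_mult[OF f(1) roots_Q_cnj[OF f(2)] r(2)] x'(2)[OF f]
      by (simp add: cas_mult V_cnj)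
  qed
  have "pi_par (X *v x') = conj_block \<sigma> d *v pi_par (X *v x)"
    unfolding vec_eq_iff
  proof
    fix i
    have "\<phi> (Inl i) = (d i, snd (\<alpha> i))" "\<phi> (Inl (\<sigma> i)) = (cnj (d i), snd (\<alpha> i))"
      using \<alpha>(2)[of i] \<sigma>[of i] by (simp_all add: \<phi>_def prod_eq_iff)
    then show "pi_par (X *v x') $ i = (conj_block \<sigma> d *v pi_par (X *v x)) $ i"
      using *[of "Inl i" "d i" "snd (\<alpha> i)" "Inl (\<sigma> i)"] by (simp add: pi_par_def conj_block_mult_vec)
  qed
  moreover have "pi_perp (X *v x') = conj_block \<tau> (\<lambda>j. fst (\<beta> j)) *v pi_perp (X *v x)"
    unfolding vec_eq_iff
  proof
    fix j
    have "\<phi> (Inr j) = (fst (\<beta> j), snd (\<beta> j))" "\<phi> (Inr (\<tau> j)) = (cnj (fst (\<beta> j)), snd (\<beta> j))"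
      using \<tau>[of j] by (simp_all add: \<phi>_def)
    then show "pi_perp (X *v x') $ j = (conj_block \<tau> (\<lambda>j. fst (\<beta> j)) *v pi_perp (X *v x)) $ j"
      using *[of "Inr j" "fst (\<beta> j)" "snd (\<beta> j)" "Inr (\<tau> j)"] by (simp add: pi_perp_def conj_block_mult_vec)
  qed
  ultimately show ?thesis using x'(1) by blast
qed

theorem invariant_cps: "invariant_cps_exists A TYPE('p)"
proof -
  obtain \<sigma> where \<sigma>: "\<And>i. \<alpha> (\<sigma> i) = (cnj (fst (\<alpha> i)), snd (\<alpha> i))" "\<And>i. \<sigma> (\<sigma> i) = i"
    using conj_involution[OF \<alpha>(1)] par_index_cnj by blast
  obtain \<tau> where \<tau>: "\<And>j. \<beta> (\<tau> j) = (cnj (fst (\<beta> j)), snd (\<beta> j))" "\<And>j. \<tau> (\<tau> j) = j"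
    using conj_involution[OF \<beta>] par_index_cnj total_index_cnj by blast
  have d\<sigma>: "d (\<sigma> i) = cnj (d i)" for i using \<sigma>(1)[of i] \<alpha>(2)[of i] \<alpha>(2)[of "\<sigma> i"] by simp
  obtain S where S: "invertible S" "A ** S = S ** conj_block \<sigma> d"
    using diagonalized_real_similar_conj_block[OF diag \<sigma>(2) d\<sigma>] by blast
  obtain S' where S': "S' ** S = mat 1" using S(1) unfolding invertible_def by blast
  \<comment> \<open>The first factor of \<open>X\<close> carries
    \<open>conj_block \<sigma> d\<close> instead of \<open>A\<close>, and \<open>S\<close> turns one
    into the other. The second factor is left alone, keeping the Euclidean norm in which its block
    does not expand.\<close>
  define L where "L = block_diag S (mat 1 :: real^'p^'p) ** X"
  have par: "pi_par (L *v x) = S *v pi_par (X *v x)" and perp: "pi_perp (L *v x) = pi_perp (X *v x)" for x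
    unfolding L_def matrix_vector_mul_assoc[symmetric] by (simp_all add: block_diag_mult_vec)
  have S0: "v = 0" if "S *v v = 0" for v
  proof -
    have "v = S' *v (S *v v)" by (simp add: matrix_vector_mul_assoc S')
    then show ?thesis using that by simp
  qed
  have zero: "pi_par (0 :: real^('n + 'p)) = (0 :: real^'n)" "pi_perp (0 :: real^('n + 'p)) = (0 :: real^'p)"
    by (simp_all add: linear_0[OF pi_par_linear(4)] linear_0[OF pi_perp_linear(4)])
  have "L *v x = 0 \<Longrightarrow> x = 0" for x
  proof -
    assume "L *v x = 0"
    then have "pi_par (X *v x) = (0 :: real^'n)" "pi_perp (X *v x) = (0 :: real^'p)"
      using par[of x] perp[of x] S0 zero by auto
    then have "X *v x = 0" by (intro pi_eqI) (simp_all add: zero)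
    then show "x = 0" by (rule X_injective)
  qed
  then have "inj ((*v) L)" using not_inj_matrix_iff[of L] by blast
  then have invL: "invertible L" using det_nz_iff_inj_mult[of L] invertible_det_nz by blast
  have mem: "l \<in> lattice_of L \<longleftrightarrow> (\<exists>x. (\<forall>i. x $ i \<in> \<int>) \<and> l = L *v x)" for l
    unfolding lattice_of_def by blast
  have inj: "inj_on h (lattice_of L)"
    if h: "\<And>u v. h (u - v) = h u - h v" and 0: "\<And>x. \<forall>i. x $ i \<in> \<int> \<Longrightarrow> h (L *v x) = 0 \<Longrightarrow> x = 0"
    for h :: "real^('n + 'p) \<Rightarrow> real^'m"
  proof (rule inj_onI)
    fix l l' assume "l \<in> lattice_of L" "l' \<in> lattice_of L" and eq: "h l = h l'"
    then obtain x y where xy: "\<forall>i. x $ i \<in> \<int>" "\<forall>i. y $ i \<in> \<int>" "l = L *v x" "l' = L *v y"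
      unfolding mem by blast
    have "h (L *v (x - y)) = 0" using eq by (simp add: xy matrix_vector_mult_diff_distrib h)
    then have "x - y = 0" using xy(1,2) by (intro 0) simp_all
    then show "l = l'" using xy by simp
  qed
  have inj_par: "inj_on (pi_par :: real^('n + 'p) \<Rightarrow> real^'n) (lattice_of L)"
    by (rule inj) (use S0 in \<open>auto simp: pi_par_linear par intro: pi_par_X_injective\<close>)
  have inj_perp: "inj_on (pi_perp :: real^('n + 'p) \<Rightarrow> real^'p) (lattice_of L)"
    by (rule inj) (auto simp: pi_perp_linear perp intro: pi_perp_X_injective)
  have sub: "additive_subgroup (pi_perp ` lattice_of L :: (real^'p) set)"
    unfolding additive_subgroup_def
  proof (intro conjI ballI)
    show "(0 :: real^'p) \<in> pi_perp ` lattice_of L"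
      using additive_subgroup_lattice_of[of L] zero by (metis additive_subgroup_def image_eqI)
    fix u v :: "real^'p" assume "u \<in> pi_perp ` lattice_of L" "v \<in> pi_perp ` lattice_of L"
    then show "u - v \<in> pi_perp ` lattice_of L"
      using additive_subgroup_lattice_of[of L] pi_perp_linear(2)
      unfolding additive_subgroup_def by (metis (no_types, lifting) imageE image_eqI)
  qed
  have dense: "closure (pi_perp ` lattice_of L) = (UNIV :: (real^'p) set)"
  proof (rule ccontr)
    assume "closure (pi_perp ` lattice_of L) \<noteq> (UNIV :: (real^'p) set)"
    then obtain w where w: "w \<noteq> 0" "\<forall>h\<in>closure (pi_perp ` lattice_of L). w \<bullet> h \<in> \<int>"
      using closed_subgroup_dual_vector[OF additive_subgroup_closure[OF sub] closed_closure] by blast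
    have "w \<bullet> pi_perp (X *v x) \<in> \<int>" if "\<forall>i. x $ i \<in> \<int>" for x
    proof -
      have "L *v x \<in> lattice_of L" using that mem by blast
      then have "pi_perp (L *v x) \<in> closure (pi_perp ` lattice_of L :: (real^'p) set)"
        using closure_subset[of "pi_perp ` lattice_of L"] by (meson image_eqI subsetD)
      then have "w \<bullet> pi_perp (L *v x) \<in> \<int>" using w(2) by blast
      then show ?thesis by (simp only: perp)
    qed
    then show False using integral_functional_zero w(1) by blast
  qed
  have "generic_cps L"
    unfolding generic_cps_def using invL inj_par inj_perp dense by blast
  moreover have "window (ball (0 :: real^'p) 1)"
    by (simp add: window_def)
  moreover have "(\<lambda>x. A *v x) ` cps_set L (ball (0 :: real^'p) 1) \<subseteq> cps_set L (ball 0 1)"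
  proof
    fix v assume "v \<in> (\<lambda>x. A *v x) ` cps_set L (ball (0 :: real^'p) 1)"
    then obtain l where l: "l \<in> lattice_of L" "pi_perp l \<in> ball (0 :: real^'p) 1" "v = A *v pi_par l"
      unfolding cps_set_def by blast
    then obtain x where x: "\<forall>i. x $ i \<in> \<int>" "l = L *v x" using mem by blast
    obtain x' where x': "\<forall>i. x' $ i \<in> \<int>" "pi_par (X *v x') = conj_block \<sigma> d *v pi_par (X *v x)"
      "pi_perp (X *v x') = conj_block \<tau> (\<lambda>j. fst (\<beta> j)) *v pi_perp (X *v x)"
      using shift_conj_block[OF x(1) \<sigma>(1) \<tau>(1)] by blast
    have "pi_par (L *v x') = (S ** conj_block \<sigma> d) *v pi_par (X *v x)"
      by (simp add: par x'(2) matrix_vector_mul_assoc)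
    also have "\<dots> = v"
      unfolding S(2)[symmetric] by (simp add: l(3) x(2) par matrix_vector_mul_assoc)
    finally have v: "v = pi_par (L *v x')" by simp
    have "cmod (fst (\<beta> j)) \<le> 1" for j
    proof (rule perp_index_contracting)
      show "(fst (\<beta> j), snd (\<beta> j)) \<in> total_index - par_index" using \<beta> by (auto simp: bij_betw_def)
    qed
    then have "norm (conj_block \<tau> (\<lambda>j. fst (\<beta> j)) *v pi_perp (X *v x)) \<le> norm (pi_perp (X *v x))"
      using \<tau> by (intro conj_block_norm_le) auto
    then have "pi_perp (L *v x') \<in> ball (0 :: real^'p) 1"
      using l(2) unfolding x(2) perp x'(3) by simp
    then show "v \<in> cps_set L (ball 0 1)"
      using v x'(1) mem unfolding cps_set_def by blast
  qed
  ultimately show ?thesis unfolding invariant_cps_exists_def by blast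
qed

end

theorem (in eigen_setup) invariant_cps_exists_s_dim:
  assumes "CARD('p::finite) = s_dim A - CARD('n)"
  shows "invariant_cps_exists A TYPE('p)"
proof -
  obtain \<alpha> where \<alpha>: "bij_betw \<alpha> (UNIV :: 'n set) par_index" "\<And>i. fst (\<alpha> i) = d i"
    using par_index_bij by blast
  have "card (total_index - par_index) = CARD('p)"
    using card_Diff_subset[OF finite_subset[OF par_subset_total finite_total_index] par_subset_total]
    by (simp add: card_total_index card_par_index assms)
  then obtain \<beta> where \<beta>: "bij_betw \<beta> (UNIV :: 'p set) (total_index - par_index)"
    using finite_same_card_bij[of "UNIV :: 'p set" "total_index - par_index"] finite_total_index by auto
  have "card coeff_index = CARD('n + 'p)"
    using card_less_s_dim by (simp add: card_coeff_index assms)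
  then obtain \<psi> where \<psi>: "bij_betw \<psi> (UNIV :: ('n + 'p) set) coeff_index"
    using finite_same_card_bij[of "UNIV :: ('n + 'p) set" coeff_index] finite_coeff_index by auto
  obtain t where t: "\<And>p. p \<noteq> 0 \<Longrightarrow> \<forall>i. coeff p i \<in> eigen_rings \<Longrightarrow> poly p (complex_of_real t) \<noteq> 0"
    using exists_real_avoiding_roots[OF countable_eigen_rings] by metis
  interpret cps_construction A P Q d \<alpha> \<beta> \<psi> t
    using \<alpha> \<beta> \<psi> t by unfold_locales
  show ?thesis by (rule invariant_cps)
qed

text \<open>Dimensions are types, so minimality is stated for an arbitrary \<open>'p\<close>:
  existence when \<open>'p\<close> has the right size, and the lower bound for every
  \<open>'p\<close>. The first conjunct makes the natural number subtraction genuine and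
  positive.\<close>

theorem theorem5:
  fixes A :: "real^'n^'n"
  assumes nonsing: "invertible A"
    and diag: "diagonalizable_C A"
    and P1: "\<forall>lam. is_eigenvalue A lam \<longrightarrow> algebraic_integer lam"
    and P2: "\<forall>\<mu> lam. is_eigenvalue A lam \<and> alg_conjugate \<mu> lam \<and> cmod \<mu> > 1 \<longrightarrow>
               is_eigenvalue A \<mu> \<and>
               (\<forall>\<nu>. alg_conjugate \<mu> \<nu> \<longrightarrow> alg_mult A \<mu> \<ge> alg_mult A \<nu>) \<and>
               (\<exists>\<nu>. alg_conjugate \<mu> \<nu> \<and> alg_mult A \<mu> > alg_mult A \<nu>)"
  shows "CARD('n) < s_dim A \<and>
         (CARD('p::finite) = s_dim A - CARD('n) \<longrightarrow> invariant_cps_exists A TYPE('p)) \<and>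
         (invariant_cps_exists A TYPE('p) \<longrightarrow> s_dim A \<le> CARD('n) + CARD('p))"
proof -
  obtain P Q d where D: "diagonalized_by A P Q d"
    using diag unfolding diagonalizable_C_def diagonalized_by_def by blast
  have "algebraic_integer (d i)" for i
    using P1 diagonalized_by_eigenvalue[OF D] by blast
  then interpret eigen_setup A P Q d
    using D nonsing P2 by unfold_locales
  show ?thesis
    using card_less_s_dim invariant_cps_exists_s_dim invariant_cps_dimension_ge by blast
qed

end
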